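(* Let $n\in\mathbb{N}^+$. Assume $u_0\in H^s(\mathbb{R})$, $s>5/2$, and $m_0=(1-\partial_x^2)u_0\ge 0$. Let $u(t,x)$ be the positive solution, with initial data $u_0$ and existence interval $[0,T)$, of the Cauchy problem for $$m_t+(u^2-u_x^2)^{n-1}u_x m+\partial_x\left[(u^2-u_x^2)^{n-1}um\right]=0,\qquad m=u-u_{xx}.$$ Then, for $t\in[0,T)$, $$\frac{(2n-1)(2-c_1)}{2n+1}M^{2n+1}(t)-\frac{2-c_1}{2}M^{2n-1}(t)\,H_1(u)+H_2(u)\le 0,$$ where $M(t)=\max_{x\in\mathbb{R}}\{u(t,x)\}$ and $c_1=\frac12+\sum_{j=1}^{n}(-1)^{j+1}\frac{2j-3}{2(2j-1)}\binom{n}{j}$.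
   Context: $\mathbb{N}^+$ is the set of positive integers. The functionals are $$H_1(u)=\int_{\mathbb{R}}(u^2+u_x^2)\,dx,\qquad H_2(u)=\int_{\mathbb{R}}\left(u^{2n+1}+\sum_{k=1}^{n}\frac{(-1)^{k+1}}{2k-1}\binom{n}{k}u^{2n-2k+1}u_x^{2k}\right)dx,$$ evaluated at $u(t,\cdot)$. The solution is the unique strong solution $u\in C([0,T);H^s(\mathbb{R}))\cap C^1([0,T);H^{s-1}(\mathbb{R}))$ of the Cauchy problem with initial data $u_0\in H^s(\mathbb{R})$, $s>5/2$. Its existence and uniqueness are known (Qu–Fu), as is the fact that if $m_0\ge 0$ then $u(t,x)$ is positive and $(1\pm\partial_x)u(t,x)\ge 0$ for all $(t,x)\in[0,T)\times\mathbb{R}$. *)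

theory Defs
  imports "HOL-Analysis.Analysis"
begin

text \<open>
  Sobolev spaces \<open>H\<^sup>s(\<real>)\<close> of real-valued functions for \<open>s \<ge> 0\<close>, via the Fourier transform on
  \<open>L\<^sup>2\<close>. The latter is the \<open>L\<^sup>2\<close> limit of the transforms of the truncations of \<open>f\<close> to \<open>[-R, R]\<close>;
  the \<open>L\<^sup>2\<close> distance is an extended nonnegative integral, so that the limit is not affected by the
  value 0 of the Bochner integral on non-integrable functions.
\<close>

definition L2_fun :: "(real \<Rightarrow> 'a::{banach, second_countable_topology}) \<Rightarrow> bool" where
  "L2_fun f \<longleftrightarrow> f \<in> borel_measurable lborel \<and> integrable lborel (\<lambda>x. (norm (f x))\<^sup>2)"

definition truncated_fourier :: "real \<Rightarrow> (real \<Rightarrow> real) \<Rightarrow> real \<Rightarrow> complex" where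
  "truncated_fourier R f \<xi> =
     (LINT x:{-R..R}|lborel. complex_of_real (f x) * cis (- (x * \<xi>))) / complex_of_real (sqrt (2 * pi))"

definition is_L2_fourier :: "(real \<Rightarrow> real) \<Rightarrow> (real \<Rightarrow> complex) \<Rightarrow> bool" where
  "is_L2_fourier f g \<longleftrightarrow> L2_fun f \<and> L2_fun g \<and>
     ((\<lambda>R. \<integral>\<^sup>+\<xi>. ennreal ((cmod (truncated_fourier R f \<xi> - g \<xi>))\<^sup>2) \<partial>lborel) \<longlongrightarrow> 0) at_top"

definition sobolev_space :: "real \<Rightarrow> (real \<Rightarrow> real) set" where
  "sobolev_space s = {f. \<exists>g. is_L2_fourier f g \<and>
     integrable lborel (\<lambda>\<xi>. (1 + \<xi>\<^sup>2) powr s * (cmod (g \<xi>))\<^sup>2)}"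

text \<open>
  The \<open>L\<^sup>2\<close> Fourier transform is unique up to null sets, so the choice below does not matter. The
  norm is meaningful for \<open>f \<in> sobolev_space s\<close>.
\<close>

definition sobolev_norm :: "real \<Rightarrow> (real \<Rightarrow> real) \<Rightarrow> real" where
  "sobolev_norm s f =
     sqrt (LINT \<xi>|lborel. (1 + \<xi>\<^sup>2) powr s * (cmod ((SOME g. is_L2_fourier f g) \<xi>))\<^sup>2)"

definition sobolev_continuous_on :: "real set \<Rightarrow> real \<Rightarrow> (real \<Rightarrow> real \<Rightarrow> real) \<Rightarrow> bool" where
  "sobolev_continuous_on I s u \<longleftrightarrow> (\<forall>t\<in>I. u t \<in> sobolev_space s \<and>
     ((\<lambda>r. sobolev_norm s (\<lambda>x. u r x - u t x)) \<longlongrightarrow> 0) (at t within I))"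

text \<open>
  \<open>u \<in> C\<^sup>1(I; H\<^sup>s)\<close> with time derivative \<open>v\<close> (one-sided at an end point of \<open>I\<close> belonging to \<open>I\<close>).
\<close>

definition sobolev_C1_on ::
    "real set \<Rightarrow> real \<Rightarrow> (real \<Rightarrow> real \<Rightarrow> real) \<Rightarrow> (real \<Rightarrow> real \<Rightarrow> real) \<Rightarrow> bool" where
  "sobolev_C1_on I s u v \<longleftrightarrow> sobolev_continuous_on I s u \<and> sobolev_continuous_on I s v \<and>
     (\<forall>t\<in>I. ((\<lambda>r. sobolev_norm s (\<lambda>x. (u r x - u t x) / (r - t) - v t x)) \<longlongrightarrow> 0) (at t within I))"

definition test_function :: "(real \<Rightarrow> real) \<Rightarrow> bool" where
  "test_function \<phi> \<longleftrightarrow> (\<forall>k x. (deriv ^^ k) \<phi> field_differentiable at x) \<and>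
     compact (closure {x. \<phi> x \<noteq> 0})"

definition momentum :: "(real \<Rightarrow> real) \<Rightarrow> real \<Rightarrow> real" where
  "momentum f x = f x - deriv (deriv f) x"

definition existence_interval :: "ereal \<Rightarrow> real set" where
  "existence_interval T = {t. 0 \<le> t \<and> ereal t < T}"

text \<open>
  For \<open>5/2 < s < 3\<close> the terms \<open>m\<^sub>t\<close> and \<open>\<partial>\<^sub>x[(u\<^sup>2 - u\<^sub>x\<^sup>2)\<^bsup>n-1\<^esup> u m]\<close> lie in \<open>H\<^bsup>s-3\<^esup>\<close>,
  which is not a space of functions. So for each \<open>t\<close> the equation
  \<open>m\<^sub>t + (u\<^sup>2 - u\<^sub>x\<^sup>2)\<^bsup>n-1\<^esup> u\<^sub>x m + \<partial>\<^sub>x[(u\<^sup>2 - u\<^sub>x\<^sup>2)\<^bsup>n-1\<^esup> u m] = 0\<close> is read as an equality of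
  distributions in \<open>x\<close>, where \<open>v = u\<^sub>t\<close> and \<open>m\<^sub>t = v - v\<^sub>x\<^sub>x\<close>. All other derivatives of \<open>u\<close> are
  classical since \<open>H\<^sup>s \<subseteq> C\<^sup>2\<close> for \<open>s > 5/2\<close>.
\<close>

definition satisfies_equation_at ::
    "nat \<Rightarrow> (real \<Rightarrow> real) \<Rightarrow> (real \<Rightarrow> real) \<Rightarrow> bool" where
  "satisfies_equation_at n f v \<longleftrightarrow> (\<forall>\<phi>. test_function \<phi> \<longrightarrow>
     (LINT x|lborel. v x * (\<phi> x - deriv (deriv \<phi>) x))
     + (LINT x|lborel. ((f x)\<^sup>2 - (deriv f x)\<^sup>2) ^ (n - 1) * deriv f x * momentum f x * \<phi> x)
     - (LINT x|lborel. ((f x)\<^sup>2 - (deriv f x)\<^sup>2) ^ (n - 1) * f x * momentum f x * deriv \<phi> x) = 0)"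

text \<open>
  Elements of \<open>sobolev_space s\<close> are functions rather than classes; \<open>u t\<close> is required to be the
  continuous representative of its class.
\<close>

definition strong_solution ::
    "nat \<Rightarrow> real \<Rightarrow> ereal \<Rightarrow> (real \<Rightarrow> real) \<Rightarrow> (real \<Rightarrow> real \<Rightarrow> real) \<Rightarrow> bool" where
  "strong_solution n s T u0 u \<longleftrightarrow>
     (\<forall>t\<in>existence_interval T. continuous_on UNIV (u t)) \<and>
     sobolev_continuous_on (existence_interval T) s u \<and>
     (\<exists>v. sobolev_C1_on (existence_interval T) (s - 1) u v \<and>
          (\<forall>t\<in>existence_interval T. satisfies_equation_at n (u t) (v t))) \<and>
     u 0 = u0"

definition H1 :: "(real \<Rightarrow> real) \<Rightarrow> real" where
  "H1 f = (LINT x|lborel. (f x)\<^sup>2 + (deriv f x)\<^sup>2)"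

definition H2 :: "nat \<Rightarrow> (real \<Rightarrow> real) \<Rightarrow> real" where
  "H2 n f = (LINT x|lborel. f x ^ (2 * n + 1) +
     (\<Sum>k=1..n. (-1) ^ (k + 1) / (2 * real k - 1) * real (n choose k)
        * f x ^ (2 * n - 2 * k + 1) * deriv f x ^ (2 * k)))"

definition max_value :: "(real \<Rightarrow> real) \<Rightarrow> real" where
  "max_value f = (GREATEST y. y \<in> range f)"

definition c1 :: "nat \<Rightarrow> real" where
  "c1 n = 1 / 2 + (\<Sum>j=1..n. (-1) ^ (j + 1) * ((2 * real j - 3) / (2 * (2 * real j - 1)))
     * real (n choose j))"

end

theory Submission
  imports Defs "HOL-Probability.Characteristic_Functions"
begin

text \<open>
  Write \<open>p = u\<^sub>x\<close> and \<open>\<kappa> = 2 - c\<^sub>1\<close>. Where \<open>\<bar>p\<bar> \<le> u\<close>, the integrand \<open>F\<close> of \<open>H\<^sub>2\<close> equals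
  \<open>u\<^bsup>2n+1\<^esup> \<phi>(p/u)\<close> with an even polynomial \<open>\<phi>\<close> such that \<open>\<phi>(q) \<le> \<kappa> (1 + q\<^sup>2) / 2\<close> on \<open>[-1, 1]\<close>, with
  equality at the end points. Since \<open>u \<le> M\<close>, this bounds \<open>F - (\<kappa>/2) M\<^bsup>2n-1\<^esup> (u\<^sup>2 + p\<^sup>2)\<close> above by both
  \<open>\<kappa> (M\<^bsup>2n-1\<^esup> - u\<^bsup>2n-1\<^esup>) u p\<close> and its negative, and these are exact derivatives. Integrating with one
  sign to the left and with the other to the right of a maximum point gives the theorem.

  The bound \<open>\<bar>p\<bar> \<le> u\<close> follows from \<open>m \<ge> 0\<close>, because \<open>e\<^sup>x (u - p)\<close> has derivative \<open>e\<^sup>x m\<close>. That \<open>m \<ge> 0\<close>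
  persists from the initial data is a maximum principle for the transport equation
  \<open>m\<^sub>t + (A m)\<^sub>x + B m = 0\<close> with \<open>A = (u\<^sup>2 - p\<^sup>2)\<^bsup>n-1\<^esup> u\<close> and \<open>B = (u\<^sup>2 - p\<^sup>2)\<^bsup>n-1\<^esup> p\<close>. As \<open>m\<close> is only
  continuous, the principle is applied to its averages over intervals \<open>[x, x + h]\<close>, which are
  \<open>C\<^sup>1\<close>. Regularity comes from the Fourier side: Gaussian summation of the \<open>L\<^sup>2\<close> Fourier integral
  yields pointwise inversion when the transform is integrable, and for \<open>s > 5/2\<close> the weight
  \<open>(1 + \<xi>\<^sup>2)\<close> times the transform of \<open>u(t)\<close> is integrable by the Cauchy-Schwarz inequality.
\<close>

subsection \<open>The density of the second functional\<close>

text \<open>The peakon profile exp(-|x|) is the guiding case: there |u_x| = u on both sides of the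
  crest, and every estimate of the fixed-time argument becomes an equality. This is why the bound
  for \<phi> has to be exact at |q| = 1, with \<kappa> = \<phi>(1), and why the two opposite
  primitives meet at a maximum point. The obstacle to the persistence of m \<ge> 0 is regularity:
  for s < 3 neither m_t nor m_x need be a function, so a minimum of m cannot be inspected directly.
  One integration in x repairs both. A primitive Y of m, namely a primitive of u minus u_x, has the
  classical time derivative "primitive of u_t minus u_tx", because u_t lies in H^(s-1) with s - 1 >
  3/2 and is therefore C^1 in x. The weak equation turns into a pointwise identity for the
  differences of Y_t in x, and the averages of m are differences of Y. The Fourier part delivers all
  limits in time uniformly in x, as the comparison argument on the whole line requires.\<close>

lemma two_minus_c1:
  assumes "n \<ge> 1"
  shows "2 - c1 n = 1 + (\<Sum>k=1..n. (-1) ^ (k + 1) / (2 * real k - 1) * real (n choose k))"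
proof -
  have "(\<Sum>i\<le>n. (-1) ^ i * real (n choose i)) = 0"
    using choose_alternating_sum[of n, where 'a=real] assms by simp
  then have "(\<Sum>i=1..n. (-1) ^ i * real (n choose i)) = - 1"
    by (simp add: atMost_atLeast0 sum.atLeast_Suc_atMost)
  then have a: "(\<Sum>i=1..n. (-1) ^ (i+1) * real (n choose i)) = 1"
    by (simp add: sum_negf)
  \<comment> \<open>Partial fractions: (2j - 3) / (2 (2j - 1)) = 1/2 - 1 / (2j - 1). By the
    alternating binomial sum the halves add up to 1/2, so \<open>c1 n\<close> is 1 minus the sum of
    the second parts.\<close>
  have "(-1) ^ (j + 1) * ((2 * real j - 3) / (2 * (2 * real j - 1))) * real (n choose j)
      = (1/2) * ((-1) ^ (j + 1) * real (n choose j))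
        - (-1) ^ (j + 1) / (2 * real j - 1) * real (n choose j)" if "j \<in> {1..n}" for j
  proof -
    have "2 * real j - 1 \<noteq> 0" using that by auto
    then have *: "(2 * real j - 3) / (2 * (2 * real j - 1)) = 1/2 - inverse (2 * real j - 1)"
      by (simp add: field_simps)
    show ?thesis unfolding * by (simp only: divide_inverse[of _ "2 * real j - 1"]) (simp add: left_diff_distrib right_diff_distrib)
  qed
  then have "(\<Sum>j=1..n. (-1) ^ (j + 1) * ((2 * real j - 3) / (2 * (2 * real j - 1))) * real (n choose j))
      = (\<Sum>j=1..n. (1/2) * ((-1) ^ (j + 1) * real (n choose j))
        - (-1) ^ (j + 1) / (2 * real j - 1) * real (n choose j))"
    by (rule sum.cong[OF refl])
  also have "\<dots> = (1/2) - (\<Sum>j=1..n. (-1) ^ (j + 1) / (2 * real j - 1) * real (n choose j))"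
    unfolding sum_subtractf sum_distrib_left[symmetric] a by simp
  finally show ?thesis unfolding c1_def by simp
qed

lemma alternating_binomial_sum:
  "(\<Sum>k=1..n. (-1) ^ (k + 1) * real (n choose k) * q ^ (2 * k)) = 1 - (1 - q\<^sup>2) ^ n"
proof -
  have "(1 - q\<^sup>2) ^ n = (\<Sum>k\<le>n. real (n choose k) * (- q\<^sup>2) ^ k)"
    using binomial_ring[of "- q\<^sup>2" 1 n] by simp
  also have "\<dots> = 1 + (\<Sum>k=1..n. real (n choose k) * (- q\<^sup>2) ^ k)"
    by (simp add: atMost_atLeast0 sum.atLeast_Suc_atMost)
  also have "(\<Sum>k=1..n. real (n choose k) * (- q\<^sup>2) ^ k)
     = - (\<Sum>k=1..n. (-1) ^ (k + 1) * real (n choose k) * q ^ (2 * k))"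
    unfolding sum_negf[symmetric]
    by (rule sum.cong) (auto simp: power_mult power_minus[of "q\<^sup>2"])
  finally show ?thesis by simp
qed

text \<open>The profile of the integrand of \<open>H2\<close>: at u > 0 the integrand is u^(2n+1)
  times the value of this polynomial at the slope ratio u_x / u. For n \<ge> 1 its value at 1 is
  \<open>2 - c1 n\<close>.\<close>

definition density_poly :: "nat \<Rightarrow> real \<Rightarrow> real" where
  "density_poly n q = 1 + (\<Sum>k=1..n. (-1) ^ (k + 1) / (2 * real k - 1) * real (n choose k) * q ^ (2 * k))"

text \<open>The antiderivative of (1 - (1 - q^2)^n) / q^2 that vanishes at 0. Unlike
  \<open>density_poly\<close> it has a derivative in closed form.\<close>

definition density_prim :: "nat \<Rightarrow> real \<Rightarrow> real" where
  "density_prim n q = (\<Sum>k=1..n. (-1) ^ (k + 1) / (2 * real k - 1) * real (n choose k) * q ^ (2 * k - 1))"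

lemma density_poly_eq: "density_poly n q = 1 + q * density_prim n q"
proof -
  have "q ^ (2 * k) = q * q ^ (2 * k - 1)" if "k \<in> {1..n}" for k
    using that by (cases k) auto
  then show ?thesis
    unfolding density_poly_def density_prim_def sum_distrib_left
    by (auto intro!: sum.cong)
qed

text \<open>Differentiation cancels the denominators 2k - 1, and the binomial theorem sums what is
  left. The factor q^2 avoids a division at q = 0.\<close>

lemma DERIV_density_prim:
  "\<exists>d. (density_prim n has_real_derivative d) (at q) \<and> q\<^sup>2 * d = 1 - (1 - q\<^sup>2) ^ n"
proof (intro exI conjI)
  have "2 * real k \<noteq> 1" for k
    by (metis of_nat_1_eq_iff of_nat_mult of_nat_numeral odd_one dvd_triv_left)
  then show "(density_prim n has_real_derivative
      (\<Sum>k=1..n. (-1) ^ (k + 1) / (2 * real k - 1) * real (n choose k) *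
          (real (2 * k - 1) * q ^ (2 * k - 1 - 1)))) (at q)"
    unfolding density_prim_def by (auto intro!: derivative_eq_intros sum.cong)
  have "q\<^sup>2 * ((-1) ^ (k + 1) / (2 * real k - 1) * real (n choose k) *
          (real (2 * k - 1) * q ^ (2 * k - 1 - 1))) = (-1) ^ (k + 1) * real (n choose k) * q ^ (2 * k)"
    if k1: "k \<in> {1..n}" for k
  proof -
    obtain j where k: "k = Suc j" using k1 not0_implies_Suc[of k] by auto
    have "1 + 2 * real j \<noteq> 0" by linarith
    then show ?thesis unfolding k by (simp add: field_simps power2_eq_square)
  qed
  then show "q\<^sup>2 * (\<Sum>k=1..n. (-1) ^ (k + 1) / (2 * real k - 1) * real (n choose k) *
          (real (2 * k - 1) * q ^ (2 * k - 1 - 1))) = 1 - (1 - q\<^sup>2) ^ n"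
    unfolding alternating_binomial_sum[symmetric] sum_distrib_left by (intro sum.cong) auto
qed

text \<open>The mean value theorem for \<open>density_prim n q - q\<close> on [0, 1] reduces this to
  d \<ge> 1, which follows from (1 - z^2)^n \<le> 1 - z^2. The result means \<open>2 - c1 n\<close>
  \<ge> 2, on which the later sign arguments rest.\<close>

lemma density_prim_1_ge:
  assumes "n \<ge> 1"
  shows "density_prim n 1 \<ge> 1"
proof -
  obtain d where d: "\<And>q. (density_prim n has_real_derivative d q) (at q)"
      "\<And>q. q\<^sup>2 * d q = 1 - (1 - q\<^sup>2) ^ n"
    using DERIV_density_prim by metis
  have "\<exists>z. 0 < z \<and> z < 1 \<and> (density_prim n 1 - 1) - (density_prim n 0 - 0) = (1 - 0) * (d z - 1)"
    by (intro MVT2) (auto intro!: derivative_eq_intros d)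
  then obtain z where z: "0 < z" "z < 1" "density_prim n 1 - 1 - density_prim n 0 = d z - 1"
    by auto
  have "z\<^sup>2 \<le> 1" using z by (simp add: power_le_one)
  then have "(1 - z\<^sup>2) ^ n \<le> (1 - z\<^sup>2) ^ 1"
    by (intro power_decreasing assms) auto
  then have "z\<^sup>2 * d z \<ge> z\<^sup>2 * 1" using d(2)[of z] by simp
  then have "d z \<ge> 1" using z by (simp del: mult_1_right)
  moreover have "density_prim n 0 = 0"
    unfolding density_prim_def by (rule sum.neutral) auto
  ultimately show ?thesis using z by simp
qed

text \<open>For 0 < q < 1 the difference of the two sides, divided by q, is \<open>X\<close>. It
  vanishes at 1 by the choice of the constant and is nonincreasing, hence nonnegative. Evenness
  reduces negative q to this case.\<close>

lemma density_poly_le: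
  assumes n: "n \<ge> 1" and q: "\<bar>q\<bar> \<le> 1"
  shows "density_poly n q \<le> (1 + density_prim n 1) * (1 + q\<^sup>2) / 2"
proof -
  define K where "K = 1 + density_prim n 1"
  have K: "K \<ge> 2" using density_prim_1_ge[OF n] by (simp add: K_def)
  obtain d where d: "\<And>q. (density_prim n has_real_derivative d q) (at q)"
      "\<And>q. q\<^sup>2 * d q = 1 - (1 - q\<^sup>2) ^ n"
    using DERIV_density_prim by metis
  have pos: "density_poly n r \<le> K * (1 + r\<^sup>2) / 2" if r: "0 < r" "r < 1" for r
  proof -
    define X where "X = (\<lambda>q. K * (1 / q + q) / 2 - 1 / q - density_prim n q)"
    have "\<exists>z>r. z < 1 \<and> X 1 - X r = (1 - r) * (K * (- 1 / z\<^sup>2 + 1) / 2 + 1 / z\<^sup>2 - d z)"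
      unfolding X_def using r
      by (intro MVT2) (auto intro!: derivative_eq_intros d simp: power2_eq_square field_simps)
    then obtain z where z: "r < z" "z < 1" "X 1 - X r = (1 - r) * (K * (- 1 / z\<^sup>2 + 1) / 2 + 1 / z\<^sup>2 - d z)"
      by auto
    \<comment> \<open>Up to the factor z^2, the derivative of \<open>X\<close> is (1 - z^2) ((1 -
      z^2)^(n-1) - K/2), and K \<ge> 2 makes the second factor nonpositive.\<close>
    have "(1 - z\<^sup>2) ^ (n - 1) \<le> 1"
      using z r by (intro power_le_one) (auto simp: power_le_one)
    moreover have z1: "z\<^sup>2 \<le> 1" using z r by (simp add: power_le_one)
    ultimately have "(1 - z\<^sup>2) * ((1 - z\<^sup>2) ^ (n - 1) - K / 2) \<le> 0"
      using K by (intro mult_nonneg_nonpos) auto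
    moreover have "z\<^sup>2 * (K * (- 1 / z\<^sup>2 + 1) / 2 + 1 / z\<^sup>2 - d z)
        = K * (z\<^sup>2 - 1) / 2 + 1 - z\<^sup>2 * d z"
      using z r by (simp add: field_simps)
    moreover have "K * (z\<^sup>2 - 1) / 2 + 1 - z\<^sup>2 * d z = (1 - z\<^sup>2) * ((1 - z\<^sup>2) ^ (n - 1) - K / 2)"
      unfolding d(2) using n by (cases n) (auto simp: field_simps)
    ultimately have "z\<^sup>2 * (K * (- 1 / z\<^sup>2 + 1) / 2 + 1 / z\<^sup>2 - d z) \<le> 0" by simp
    then have "(K * (- 1 / z\<^sup>2 + 1) / 2 + 1 / z\<^sup>2 - d z) \<le> 0"
      using z r by (simp add: mult_le_0_iff)
    then have "X 1 - X r \<le> 0" unfolding z(3) using r by (intro mult_nonneg_nonpos) auto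
    moreover have "X 1 = 0" by (simp add: X_def K_def field_simps)
    ultimately have "r * X r \<ge> 0" using r by simp
    moreover have "r * X r = K * (1 + r\<^sup>2) / 2 - density_poly n r"
      using r unfolding X_def density_poly_eq by (simp add: field_simps power2_eq_square)
    ultimately show ?thesis by simp
  qed
  have "density_poly n q = density_poly n \<bar>q\<bar>"
    unfolding density_poly_def by (simp add: power_even_abs)
  also have "\<dots> \<le> K * (1 + \<bar>q\<bar>\<^sup>2) / 2"
  proof -
    consider "\<bar>q\<bar> = 0" | "0 < \<bar>q\<bar>" "\<bar>q\<bar> < 1" | "\<bar>q\<bar> = 1" using q by linarith
    then show ?thesis
    proof cases
      case 1 then show ?thesis using K by (simp add: density_poly_eq)
    next
      case 2 then show ?thesis using pos by blast
    next
      case 3 then show ?thesis by (simp add: density_poly_eq K_def)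
    qed
  qed
  finally show ?thesis by (simp add: K_def)
qed

lemma two_minus_c1_prim: "n \<ge> 1 \<Longrightarrow> 2 - c1 n = 1 + density_prim n 1"
  by (simp add: two_minus_c1 density_prim_def)

section \<open>Homogeneity of the density\<close>

definition H2_density :: "nat \<Rightarrow> real \<Rightarrow> real \<Rightarrow> real" where
  "H2_density n a b = a ^ (2 * n + 1) + (\<Sum>k=1..n. (-1) ^ (k + 1) / (2 * real k - 1)
     * real (n choose k) * a ^ (2 * n - 2 * k + 1) * b ^ (2 * k))"

lemma H2_density_eq:
  assumes "a > 0"
  shows "H2_density n a b = a ^ (2 * n + 1) * density_poly n (b / a)"
proof -
  have "a ^ (2 * n + 1) * (b / a) ^ (2 * k) = a ^ (2 * n - 2 * k + 1) * b ^ (2 * k)"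
    if "k \<in> {1..n}" for k
  proof -
    have "a ^ (2 * n + 1) = a ^ (2 * n - 2 * k + 1) * a ^ (2 * k)"
      using that by (simp flip: power_add)
    then show ?thesis using assms by (simp add: power_divide)
  qed
  then have "c k * (a ^ (2 * n + 1) * (b / a) ^ (2 * k)) = c k * (a ^ (2 * n - 2 * k + 1) * b ^ (2 * k))"
    if "k \<in> {1..n}" for k and c :: "nat \<Rightarrow> real"
    using that by simp
  then have "(\<Sum>k=1..n. c k * (a ^ (2 * n + 1) * (b / a) ^ (2 * k)))
      = (\<Sum>k=1..n. c k * (a ^ (2 * n - 2 * k + 1) * b ^ (2 * k)))" for c :: "nat \<Rightarrow> real"
    by (rule sum.cong[OF refl])
  from this[of "\<lambda>k. (-1) ^ (k + 1) / (2 * real k - 1) * real (n choose k)"] show ?thesis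
    unfolding H2_density_def density_poly_def distrib_left sum_distrib_left
    by (simp only: mult_ac mult_1_right)
qed

lemma H2_density_le:
  assumes "n \<ge> 1" "a > 0" "\<bar>b\<bar> \<le> a"
  shows "H2_density n a b \<le> (2 - c1 n) / 2 * a ^ (2 * n - 1) * (a\<^sup>2 + b\<^sup>2)"
proof -
  have "H2_density n a b \<le> a ^ (2 * n + 1) * ((2 - c1 n) * (1 + (b / a)\<^sup>2) / 2)"
    unfolding H2_density_eq[OF assms(2)] two_minus_c1_prim[OF assms(1)]
    using assms by (intro mult_left_mono density_poly_le) auto
  also have "a ^ (2 * n + 1) = a ^ (2 * n - 1) * a\<^sup>2"
    using assms by (simp flip: power_add)
  also have "a ^ (2 * n - 1) * a\<^sup>2 * ((2 - c1 n) * (1 + (b / a)\<^sup>2) / 2)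
      = (2 - c1 n) / 2 * a ^ (2 * n - 1) * (a\<^sup>2 * (1 + (b / a)\<^sup>2))"
    by simp
  also have "a\<^sup>2 * (1 + (b / a)\<^sup>2) = a\<^sup>2 + b\<^sup>2"
    using assms by (simp add: field_simps)
  finally show ?thesis .
qed

text \<open>By homogeneity this is the boundedness of \<open>density_poly n\<close> on the compact
  interval [-1, 1]. It serves to show that the density is integrable.\<close>

lemma H2_density_bound:
  assumes "n \<ge> 1"
  obtains C where "\<And>a b. a > 0 \<Longrightarrow> \<bar>b\<bar> \<le> a \<Longrightarrow> \<bar>H2_density n a b\<bar> \<le> C * a ^ (2 * n + 1)"
proof -
  have "continuous_on {-1..1} (density_poly n)"
    unfolding density_poly_def[abs_def] by (intro continuous_intros)
  then have "compact (density_poly n ` {-1..1})"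
    by (intro compact_continuous_image) auto
  then obtain C where C: "\<And>x. x \<in> density_poly n ` {-1..1} \<Longrightarrow> \<bar>x\<bar> \<le> C"
    unfolding bounded_real by (metis bounded_real compact_imp_bounded)
  show ?thesis
  proof
    fix a b :: real assume *: "a > 0" "\<bar>b\<bar> \<le> a"
    then have "b / a \<in> {-1..1}" by (auto simp: field_simps)
    then have "\<bar>density_poly n (b/a)\<bar> \<le> C" by (intro C) auto
    then show "\<bar>H2_density n a b\<bar> \<le> C * a ^ (2 * n + 1)"
      using * by (simp add: H2_density_eq abs_mult mult.commute[of C])
  qed
qed

subsection \<open>The inequality at a fixed time\<close>

text \<open>Boundedness of f and p makes exp x (f - p) tend to 0 at minus infinity; a nondecreasing
  function with that limit is nonnegative.\<close>

lemma deriv_le_self: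
  fixes f p q :: "real \<Rightarrow> real"
  assumes f: "\<And>x. (f has_real_derivative p x) (at x)"
    and p: "\<And>x. (p has_real_derivative q x) (at x)"
    and K: "\<And>x. \<bar>f x\<bar> \<le> K" "\<And>x. \<bar>p x\<bar> \<le> K"
    and q: "\<And>x. q x \<le> f x"
  shows "p x \<le> f x"
proof -
  define g where "g = (\<lambda>x. exp x * (f x - p x))"
  have g: "(g has_real_derivative exp x * (f x - q x)) (at x)" for x
    unfolding g_def by (auto intro!: derivative_eq_intros f p simp: algebra_simps)
  have mono: "g y \<le> g x" if "y \<le> x" for y
    using that by (rule DERIV_nonneg_imp_nondecreasing) (intro exI conjI, rule g, use q in auto)
  have "(g \<longlongrightarrow> 0) at_bot"
  proof (rule Lim_null_comparison)
    show "\<forall>\<^sub>F x in at_bot. norm (g x) \<le> exp x * (2 * K)"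
    proof (intro always_eventually allI)
      fix x show "norm (g x) \<le> exp x * (2 * K)"
        using K(1)[of x] K(2)[of x] by (auto simp: g_def abs_mult)
    qed
    show "((\<lambda>x. exp x * (2 * K)) \<longlongrightarrow> 0) at_bot"
      by (rule tendsto_mult_left_zero) (rule exp_at_bot)
  qed
  moreover have "\<forall>\<^sub>F y in at_bot. g y \<le> g x"
    using eventually_le_at_bot[of x] by eventually_elim (rule mono)
  ultimately have "0 \<le> g x"
    by (rule tendsto_upperbound) simp
  then show ?thesis by (simp add: g_def zero_le_mult_iff)
qed

text \<open>The missing bound -p \<le> f is the previous lemma for the reflection x \<mapsto> f
  (-x), whose derivative is -p (-x).\<close>

lemma abs_deriv_le_self:
  fixes f p q :: "real \<Rightarrow> real"
  assumes f: "\<And>x. (f has_real_derivative p x) (at x)"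
    and p: "\<And>x. (p has_real_derivative q x) (at x)"
    and K: "\<And>x. \<bar>f x\<bar> \<le> K" "\<And>x. \<bar>p x\<bar> \<le> K"
    and q: "\<And>x. q x \<le> f x"
  shows "\<bar>p x\<bar> \<le> f x"
proof -
  have "- p (- (- x)) \<le> f (- (- x))"
  proof (rule deriv_le_self[of "\<lambda>x. f (- x)" "\<lambda>x. - p (- x)" "\<lambda>x. q (- x)" K])
    show "((\<lambda>x. f (- x)) has_real_derivative - p (- x)) (at x)" for x
      using DERIV_chain2[OF f[of "- x"] DERIV_minus[OF DERIV_ident]] by simp
    show "((\<lambda>x. - p (- x)) has_real_derivative q (- x)) (at x)" for x
      using DERIV_minus[OF DERIV_chain2[OF p[of "- x"] DERIV_minus[OF DERIV_ident]]] by simp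
  qed (use K q in auto)
  then show ?thesis using deriv_le_self[OF assms, of x] by (simp add: abs_le_iff)
qed

section \<open>Decay at infinity and attainment of the maximum\<close>

text \<open>A Harnack estimate: |p| \<le> f makes exp x f nondecreasing, so f \<ge> f x / e on
  [x, x + 1]. Hence (f x)^2 is at most e^2 times the integral of f^2 over that interval, which tends
  to 0.\<close>

lemma tendsto_0_at_top_of_square_integrable:
  fixes f p :: "real \<Rightarrow> real"
  assumes f: "\<And>x. (f has_real_derivative p x) (at x)"
    and p: "\<And>x. \<bar>p x\<bar> \<le> f x"
    and int: "integrable lborel (\<lambda>x. (f x)\<^sup>2)"
  shows "(f \<longlongrightarrow> 0) at_top"
proof -
  have nn: "f x \<ge> 0" for x using p[of x] by linarith
  have cont: "continuous_on S f" for S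
    by (meson f DERIV_continuous_on has_field_derivative_at_within)
  define J where "J = (\<lambda>x. LINT y|lborel. indicator {x..x+1} y * (f y)\<^sup>2)"
  have "((\<lambda>x. LINT y|lborel. indicator {x..x+1} y * (f y)\<^sup>2) \<longlongrightarrow> (LINT y::real|lborel. (0::real))) at_top"
  proof (rule integral_dominated_convergence_at_top[where w="\<lambda>x. (f x)\<^sup>2" and f="\<lambda>y. 0"])
    show "AE y in lborel. ((\<lambda>x. indicator {x..x+1} y * (f y)\<^sup>2) \<longlongrightarrow> 0) at_top"
    proof (intro AE_I2 tendsto_eventually)
      fix y show "\<forall>\<^sub>F x in at_top. indicator {x..x+1} y * (f y)\<^sup>2 = 0"
        using eventually_gt_at_top[of y] by eventually_elim auto
    qed
  qed (use int in \<open>auto simp: indicator_def intro!: always_eventually borel_measurable_integrable\<close>)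
  then have "(J \<longlongrightarrow> 0) at_top" by (simp add: J_def)
  then have J0: "((\<lambda>x. sqrt (exp 2 * J x)) \<longlongrightarrow> 0) at_top"
    using tendsto_real_sqrt[OF tendsto_mult_right_zero[of J at_top "exp 2"]] by simp
  have le: "f x \<le> sqrt (exp 2 * J x)" for x
  proof -
    have *: "exp x * f x \<le> exp y * f y" if "x \<le> y" for y
      using that
    proof (rule DERIV_nonneg_imp_nondecreasing)
      fix z
      have "((\<lambda>x. exp x * f x) has_real_derivative exp z * (f z + p z)) (at z)"
        by (auto intro!: derivative_eq_intros f simp: algebra_simps)
      moreover have "exp z * (f z + p z) \<ge> 0" using p[of z] by (auto simp: abs_le_iff)
      ultimately show "\<exists>y. ((\<lambda>x. exp x * f x) has_real_derivative y) (at z) \<and> 0 \<le> y" by blast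
    qed
    have low: "exp (- 2) * (f x)\<^sup>2 \<le> (f y)\<^sup>2" if "y \<in> {x..x+1}" for y
    proof -
      have "exp (-1) * f x \<le> f y"
      proof -
        have "exp (-1) * f x \<le> exp (x - y) * f x"
          using that nn by (intro mult_right_mono) auto
        also have "\<dots> = exp (- y) * (exp x * f x)" by (simp add: exp_diff exp_minus field_simps)
        also have "\<dots> \<le> exp (- y) * (exp y * f y)" using *[of y] that by (intro mult_left_mono) auto
        also have "\<dots> = f y" by (simp add: exp_minus)
        finally show ?thesis .
      qed
      then have "(exp (-1) * f x)\<^sup>2 \<le> (f y)\<^sup>2" using nn by (intro power_mono) auto
      then show ?thesis by (simp add: power_mult_distrib flip: exp_double)
    qed
    have "exp (-2) * (f x)\<^sup>2 = (LINT y|lborel. indicator {x..x+1} y * (exp (-2) * (f x)\<^sup>2))"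
      by simp
    also have "\<dots> \<le> J x"
      unfolding J_def
    proof (rule integral_mono)
      show "integrable lborel (\<lambda>y. indicator {x..x+1} y * (f y)\<^sup>2)"
        using integrable_mult_indicator[OF _ int, of "{x..x+1}"] by simp
      show "integrable lborel (\<lambda>y. indicator {x..x+1} y * (exp (-2) * (f x)\<^sup>2))"
        by (intro integrable_mult_left integrable_real_indicator) auto
    qed (use low in \<open>auto simp: indicator_def\<close>)
    finally have "exp 2 * (exp (-2) * (f x)\<^sup>2) \<le> exp 2 * J x" by (intro mult_left_mono) auto
    then have "(f x)\<^sup>2 \<le> exp 2 * J x" by (simp add: exp_minus field_simps)
    then show ?thesis using nn by (simp add: real_le_rsqrt)
  qed
  show ?thesis
    by (rule Lim_null_comparison[OF _ J0]) (use le nn in \<open>auto intro!: always_eventually\<close>)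
qed

lemma tendsto_0_at_bot_of_square_integrable:
  fixes f p :: "real \<Rightarrow> real"
  assumes f: "\<And>x. (f has_real_derivative p x) (at x)"
    and p: "\<And>x. \<bar>p x\<bar> \<le> f x"
    and int: "integrable lborel (\<lambda>x. (f x)\<^sup>2)"
  shows "(f \<longlongrightarrow> 0) at_bot"
proof -
  have "((\<lambda>x. f (- x)) \<longlongrightarrow> 0) at_top"
  proof (rule tendsto_0_at_top_of_square_integrable)
    show "((\<lambda>x. f (- x)) has_real_derivative - p (- x)) (at x)" for x
      using DERIV_chain2[OF f[of "- x"] DERIV_minus[OF DERIV_ident]] by simp
    show "integrable lborel (\<lambda>x. (f (- x))\<^sup>2)"
      using lborel_integrable_real_affine[OF int, of "-1" 0] by simp
  qed (use p in auto)
  then show ?thesis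
    by (simp add: filterlim_at_bot_mirror)
qed

text \<open>\<open>max_value\<close> is a \<open>GREATEST\<close> and describes the maximum only if
  that is attained. Positivity and decay keep f below f 0 outside a compact interval.\<close>

lemma attains_max_of_vanishing:
  fixes f :: "real \<Rightarrow> real"
  assumes "continuous_on UNIV f" "\<And>x. f x > 0" "(f \<longlongrightarrow> 0) at_top" "(f \<longlongrightarrow> 0) at_bot"
  obtains z where "\<And>x. f x \<le> f z"
proof -
  obtain a where a: "\<And>x. x \<ge> a \<Longrightarrow> f x < f 0"
    using order_tendstoD(2)[OF assms(3) assms(2)[of 0]] by (auto simp: eventually_at_top_linorder)
  obtain b where b: "\<And>x. x \<le> b \<Longrightarrow> f x < f 0"
    using order_tendstoD(2)[OF assms(4) assms(2)[of 0]] by (auto simp: eventually_at_bot_linorder)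
  have "b < 0" "a > 0" using a[of 0] b[of 0] by force+
  then obtain z where z: "z \<in> {b..a}" "\<And>x. x \<in> {b..a} \<Longrightarrow> f x \<le> f z"
    using continuous_attains_sup[of "{b..a}" f] continuous_on_subset[OF assms(1)] by auto
  have "f x \<le> f z" for x
    using z(2)[of x] z(2)[of 0] a[of x] b[of x] \<open>b < 0\<close> \<open>a > 0\<close> by force
  then show thesis by (rule that)
qed

lemma max_value_eqI:
  assumes "\<And>x. f x \<le> f z"
  shows "max_value f = f z"
  unfolding max_value_def by (rule Greatest_equality) (use assms in auto)

text \<open>A statement about a single profile: the equation and the time variable enter only
  through the bound |p| \<le> f.\<close>

lemma functional_inequality:
  fixes f p :: "real \<Rightarrow> real"
  assumes n: "n \<ge> 1"
    and f: "\<And>x. (f has_real_derivative p x) (at x)"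
    and contp: "continuous_on UNIV p"
    and pos: "\<And>x. f x > 0"
    and p: "\<And>x. \<bar>p x\<bar> \<le> f x"
    and int: "integrable lborel (\<lambda>x. (f x)\<^sup>2)"
  shows "(2 * real n - 1) * (2 - c1 n) / (2 * real n + 1) * max_value f ^ (2 * n + 1)
           - (2 - c1 n) / 2 * max_value f ^ (2 * n - 1) * H1 f + H2 n f \<le> 0"
proof -
  have contf: "continuous_on UNIV f"
    by (meson f DERIV_continuous_on has_field_derivative_at_within)
  note top = tendsto_0_at_top_of_square_integrable[OF f p int]
    and bot = tendsto_0_at_bot_of_square_integrable[OF f p int]
  obtain z where z: "\<And>x. f x \<le> f z" using attains_max_of_vanishing[OF contf pos top bot] by blast
  define M where "M = f z"
  have M: "max_value f = M" unfolding M_def by (rule max_value_eqI) (rule z)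
  have Mpos: "M > 0" unfolding M_def by (rule pos)
  define K where "K = 2 - c1 n"
  have K: "K \<ge> 2" using density_prim_1_ge[OF n] two_minus_c1_prim[OF n] by (simp add: K_def)
  have dp: "deriv f = p" using f by (auto intro!: DERIV_imp_deriv)
  have meas[measurable]: "f \<in> borel_measurable borel" "p \<in> borel_measurable borel"
    using contf contp by (auto intro: borel_measurable_continuous_onI)
  have intp: "integrable lborel (\<lambda>x. (p x)\<^sup>2)"
    by (rule Bochner_Integration.integrable_bound[OF int]) (use p in \<open>auto simp: abs_le_square_iff[symmetric] intro: order_trans[OF p abs_ge_self]\<close>)
  obtain C where C: "\<And>a b. a > 0 \<Longrightarrow> \<bar>b\<bar> \<le> a \<Longrightarrow> \<bar>H2_density n a b\<bar> \<le> C * a ^ (2 * n + 1)"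
    using H2_density_bound[OF n] by blast
  have C0: "C \<ge> 0" using C[of 1 0] by simp
  have intF: "integrable lborel (\<lambda>x. H2_density n (f x) (p x))"
  proof (rule Bochner_Integration.integrable_bound)
    show "integrable lborel (\<lambda>x. C * M ^ (2 * n - 1) * (f x)\<^sup>2)" using int by simp
    show "(\<lambda>x. H2_density n (f x) (p x)) \<in> borel_measurable lborel"
      unfolding H2_density_def by measurable
    show "AE x in lborel. norm (H2_density n (f x) (p x)) \<le> norm (C * M ^ (2 * n - 1) * (f x)\<^sup>2)"
    proof (rule AE_I2)
      fix x
      have "\<bar>H2_density n (f x) (p x)\<bar> \<le> C * f x ^ (2 * n + 1)" using C pos p by blast
      also have "f x ^ (2 * n + 1) = f x ^ (2 * n - 1) * (f x)\<^sup>2"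
        using n by (simp flip: power_add)
      also have "C * \<dots> \<le> C * (M ^ (2 * n - 1) * (f x)\<^sup>2)"
        using C0 z pos by (intro mult_left_mono mult_right_mono power_mono) (auto simp: M_def less_imp_le)
      finally show "norm (H2_density n (f x) (p x)) \<le> norm (C * M ^ (2 * n - 1) * (f x)\<^sup>2)"
        by simp
    qed
  qed
  define G where "G = (\<lambda>x. H2_density n (f x) (p x) - K / 2 * M ^ (2 * n - 1) * ((f x)\<^sup>2 + (p x)\<^sup>2))"
  have intG: "integrable lborel G" unfolding G_def using intF int intp by simp
  \<comment> \<open>The sign e selects one of the two exact derivatives. The square (f + e p)^2
    vanishes where p = -e f, the equality case of the peakon on one side of its crest.\<close>
  have G_le: "G x \<le> K * (M ^ (2 * n - 1) - f x ^ (2 * n - 1)) * (f x * e * p x)"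
    if "\<bar>e\<bar> = 1" for e x
  proof -
    have d: "M ^ (2 * n - 1) - f x ^ (2 * n - 1) \<ge> 0"
      using z[of x] pos[of x] by (auto simp: M_def intro!: power_mono)
    have "0 \<le> (f x + e * p x)\<^sup>2" by simp
    also have "(f x + e * p x)\<^sup>2 = (f x)\<^sup>2 + 2 * (f x * e * p x) + \<bar>e\<bar>\<^sup>2 * (p x)\<^sup>2"
      by (simp add: power2_eq_square algebra_simps)
    finally have "- ((f x)\<^sup>2 + (p x)\<^sup>2) / 2 \<le> f x * e * p x" using that by simp
    then have "K * (M ^ (2 * n - 1) - f x ^ (2 * n - 1)) * (- ((f x)\<^sup>2 + (p x)\<^sup>2) / 2)
       \<le> K * (M ^ (2 * n - 1) - f x ^ (2 * n - 1)) * (f x * e * p x)"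
      using d K by (intro mult_left_mono) auto
    moreover have "G x \<le> K * (M ^ (2 * n - 1) - f x ^ (2 * n - 1)) * (- ((f x)\<^sup>2 + (p x)\<^sup>2) / 2)"
      unfolding G_def using H2_density_le[OF n pos p, of x] unfolding K_def[symmetric]
      by (simp add: algebra_simps diff_divide_distrib add_divide_distrib)
    ultimately show ?thesis by linarith
  qed
  \<comment> \<open>The primitive of K (M^(2n-1) - y^(2n-1)) y with \<open>Phi 0 = 0\<close>. Its
    value at M is K M^(2n+1) (1/2 - 1/(2n+1)), and -2 \<open>Phi M\<close> gives the leading
    coefficient of the theorem.\<close>
  define Phi where "Phi = (\<lambda>y. K * (M ^ (2 * n - 1) * y\<^sup>2 / 2 - y ^ (2 * n + 1) / (2 * real n + 1)))"
  have Phi: "((\<lambda>x. Phi (f x)) has_real_derivative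
      K * (M ^ (2 * n - 1) - f x ^ (2 * n - 1)) * (f x * p x)) (at x)" for x
  proof -
    have "f x ^ (2 * n) = f x ^ (2 * n - 1) * f x"
      using n by (cases n) auto
    moreover have nz: "1 + 2 * real n \<noteq> 0" by linarith
    moreover have "((\<lambda>x. f x ^ (2 * n + 1) / (2 * real n + 1)) has_real_derivative
        (2 * real n + 1) * (p x * f x ^ (2 * n)) / (2 * real n + 1)) (at x)"
      using DERIV_cdivide[OF DERIV_power[OF f[of x], of "2 * n + 1"], of "2 * real n + 1"] nz
      by (simp add: add.commute)
    ultimately have d: "((\<lambda>x. f x ^ (2 * n + 1) / (2 * real n + 1)) has_real_derivative
        p x * (f x ^ (2 * n - 1) * f x)) (at x)"
      by simp
    have "((\<lambda>x. M ^ (2 * n - 1) * (f x)\<^sup>2 / 2) has_real_derivative M ^ (2 * n - 1) * (f x * p x)) (at x)"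
      by (auto intro!: derivative_eq_intros f)
    from DERIV_cmult[OF DERIV_diff[OF this d], of K] show ?thesis
      unfolding Phi_def by (simp add: algebra_simps)
  qed
  have contG: "continuous_on S G" for S
    unfolding G_def H2_density_def
    by (intro continuous_intros continuous_on_subset[OF contf] continuous_on_subset[OF contp]) auto
  have part: "integral {a..b} G \<le> e * (Phi (f b) - Phi (f a))" if "\<bar>e\<bar> = 1" "a \<le> b" for a b e
  proof -
    have "((\<lambda>x. Phi (f x)) has_vector_derivative
       (K * (M ^ (2 * n - 1) - f x ^ (2 * n - 1)) * (f x * p x))) (at x within {a..b})" for x
      using Phi[of x] by (simp add: has_real_derivative_iff_has_vector_derivative[symmetric] has_field_derivative_at_within)
    then have "((\<lambda>x. K * (M ^ (2 * n - 1) - f x ^ (2 * n - 1)) * (f x * p x)) has_integral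
        (Phi (f b) - Phi (f a))) {a..b}"
      using that by (intro fundamental_theorem_of_calculus) auto
    then have "((\<lambda>x. e * (K * (M ^ (2 * n - 1) - f x ^ (2 * n - 1)) * (f x * p x))) has_integral
        e * (Phi (f b) - Phi (f a))) {a..b}"
      by (rule has_integral_mult_right)
    moreover have "(G has_integral integral {a..b} G) {a..b}"
      by (intro integrable_integral integrable_continuous_interval contG)
    ultimately show ?thesis
      using G_le[OF that(1)] by (elim has_integral_le[rotated]) (auto simp: mult_ac)
  qed
  \<comment> \<open>With e = -1 to the left of z and e = 1 to the right, both halves contribute
    -\<open>Phi M\<close> at z; the other end points contribute terms that tend to
    \<open>Phi 0\<close>.\<close>
  have bound: "\<forall>\<^sub>F R in at_top. (LINT x|lborel. indicator {-R..R} x * G x) \<le> Phi (f (- R)) + Phi (f R) - 2 * Phi M"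
    using eventually_ge_at_top[of "\<bar>z\<bar>"]
  proof eventually_elim
    fix R assume R: "\<bar>z\<bar> \<le> R"
    have "(LINT x|lborel. indicator {-R..R} x * G x) = integral {-R..R} G"
      using set_borel_integral_eq_integral(2)[of "{-R..R}" G] integrable_mult_indicator[OF _ intG, of "{-R..R}"]
      by (simp add: set_lebesgue_integral_def set_integrable_def)
    also have "\<dots> = integral {-R..z} G + integral {z..R} G"
      using R by (intro Henstock_Kurzweil_Integration.integral_combine[symmetric] integrable_continuous_interval contG) auto
    also have "\<dots> \<le> Phi (f (- R)) + Phi (f R) - 2 * Phi M"
      using part[of "-1" "-R" z] part[of 1 z R] R by (auto simp: M_def abs_le_iff)
    finally show "(LINT x|lborel. indicator {-R..R} x * G x) \<le> Phi (f (- R)) + Phi (f R) - 2 * Phi M" .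
  qed
  have lim1: "((\<lambda>R. LINT x|lborel. indicator {-R..R} x * G x) \<longlongrightarrow> (LINT x|lborel. G x)) at_top"
  proof (rule integral_dominated_convergence_at_top[where w="\<lambda>x. \<bar>G x\<bar>"])
    show "AE y in lborel. ((\<lambda>R. indicator {-R..R} y * G y) \<longlongrightarrow> G y) at_top"
    proof (intro AE_I2 tendsto_eventually)
      fix y show "\<forall>\<^sub>F R in at_top. indicator {-R..R} y * G y = G y"
        using eventually_gt_at_top[of "\<bar>y\<bar>"] by eventually_elim (auto simp: indicator_def abs_less_iff)
    qed
  qed (use intG in \<open>auto simp: indicator_def intro!: always_eventually borel_measurable_integrable\<close>)
  have lim2: "((\<lambda>R. Phi (f (- R)) + Phi (f R) - 2 * Phi M) \<longlongrightarrow> Phi 0 + Phi 0 - 2 * Phi M) at_top"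
  proof -
    have "((\<lambda>R. f (- R)) \<longlongrightarrow> 0) at_top"
      using bot by (simp add: filterlim_at_bot_mirror)
    then show ?thesis unfolding Phi_def by (intro tendsto_intros top) auto
  qed
  have "(LINT x|lborel. G x) \<le> Phi 0 + Phi 0 - 2 * Phi M"
    by (rule tendsto_le[OF _ lim2 lim1 bound]) simp
  also have "\<dots> = - ((2 * real n - 1) * K / (2 * real n + 1) * M ^ (2 * n + 1))"
  proof -
    have "M ^ (2 * n + 1) = M ^ (2 * n - 1) * M\<^sup>2" using n by (simp flip: power_add)
    moreover have "1 + 2 * real n \<noteq> 0" by linarith
    ultimately show ?thesis unfolding Phi_def by (simp add: field_simps)
  qed
  also have "(LINT x|lborel. G x) = H2 n f - K / 2 * M ^ (2 * n - 1) * H1 f"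
    unfolding G_def H1_def H2_def dp H2_density_def[symmetric] using intF int intp by simp
  finally show ?thesis unfolding M K_def by linarith
qed

subsection \<open>A maximum principle for transport equations\<close>

lemma DERIV_sqrt_1_plus_square:
  "((\<lambda>x. sqrt (1 + x\<^sup>2)) has_real_derivative x / sqrt (1 + x\<^sup>2)) (at x)"
proof -
  have "1 + x\<^sup>2 > 0" by (simp add: add_pos_nonneg)
  then show ?thesis
    by (auto intro!: derivative_eq_intros simp: field_simps)
qed

lemma abs_le_sqrt_1_plus_square: "\<bar>x\<bar> \<le> sqrt (1 + x\<^sup>2)"
  by (rule real_le_rsqrt) auto

text \<open>
  \<open>Y\<close> is a primitive of \<open>m\<close>, so \<open>(Y t (x + h) - Y t x) / h\<close> is an average of \<open>m\<close>. The average
  satisfies the transport equation up to \<open>(A(x + h) - A(x)) / h\<close> times the oscillation of \<open>m\<close> on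
  \<open>[x, x + h]\<close>; on the compact set where a first violation can occur this is below \<open>\<delta>\<close> once \<open>h \<le> h0\<close>,
  and the growing barrier \<open>\<delta> exp(\<lambda> t) (1 + sqrt(1 + x\<^sup>2))\<close> absorbs it. The weight in \<open>x\<close> provides that
  compactness although \<open>m\<close> is not known to decay.
\<close>

lemma transport_nonneg_aux:
  fixes Y m A B :: "real \<Rightarrow> real \<Rightarrow> real"
  assumes t1: "t1 \<ge> 0"
    and cont: "continuous_on ({0..t1} \<times> UNIV) (\<lambda>(t, x). m t x)"
    and m: "\<And>t x. t \<in> {0..t1} \<Longrightarrow> \<bar>m t x\<bar> \<le> K"
    and A: "\<And>t x. t \<in> {0..t1} \<Longrightarrow> \<bar>A t x\<bar> \<le> K"
    and B: "\<And>t x. t \<in> {0..t1} \<Longrightarrow> \<bar>B t x\<bar> \<le> K"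
    and AL: "\<And>t x y. t \<in> {0..t1} \<Longrightarrow> \<bar>A t y - A t x\<bar> \<le> L * \<bar>y - x\<bar>"
    and Bc: "\<And>t. t \<in> {0..t1} \<Longrightarrow> continuous_on UNIV (B t)"
    and Yx: "\<And>t x. t \<in> {0..t1} \<Longrightarrow> (Y t has_real_derivative m t x) (at x)"
    and Yt: "\<And>t x. t \<in> {0..t1} \<Longrightarrow> ((\<lambda>r. Y r x) has_real_derivative Z t x) (at t within {0..t1})"
    and Z: "\<And>t x y. t \<in> {0..t1} \<Longrightarrow> x \<le> y \<Longrightarrow>
        Z t y - Z t x = - (A t y * m t y - A t x * m t x) - integral {x..y} (\<lambda>z. B t z * m t z)"
    and init: "\<And>x. m 0 x \<ge> 0"
    and \<delta>: "\<delta> > 0"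
  obtains h0 where "h0 > 0" "\<And>h t x. 0 < h \<Longrightarrow> h \<le> h0 \<Longrightarrow> t \<in> {0..t1} \<Longrightarrow>
    (Y t (x + h) - Y t x) / h > - \<delta> * exp ((4 * K + 3 * L + 1) * t) * (1 + sqrt (1 + x\<^sup>2))"
proof -
  have K0: "K \<ge> 0" using m[of 0 0] t1 by auto
  have L0: "L \<ge> 0" using AL[of 0 1 0] t1 by auto
  \<comment> \<open>For |x| > K/\<delta> the barrier exceeds K, the bound of all averages, so a
    violation can only occur in [-X, X].\<close>
  define X where "X = K / \<delta>"
  have "X \<ge> 0" using K0 \<delta> by (simp add: X_def)
  \<comment> \<open>The interval reaches to X + 1 so as to contain [x, x + h] for |x| \<le> X and h
    \<le> h0 \<le> 1.\<close>
  have "uniformly_continuous_on ({0..t1} \<times> {-X..X+1}) (\<lambda>(t, x). m t x)"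
    by (intro compact_uniformly_continuous continuous_on_subset[OF cont] compact_Times) auto
  then obtain d where d: "d > 0" "\<And>p q. p \<in> {0..t1} \<times> {-X..X+1} \<Longrightarrow> q \<in> {0..t1} \<times> {-X..X+1} \<Longrightarrow>
      dist q p < d \<Longrightarrow> dist (case q of (t, x) \<Rightarrow> m t x) (case p of (t, x) \<Rightarrow> m t x) < \<delta>"
    unfolding uniformly_continuous_on_def using \<delta> by metis
  define h0 where "h0 = min 1 (d / 2)"
  \<comment> \<open>Read off from the final estimate: the terms to be absorbed are at most (3K + 3L
    + K) D w, and the summand 1 makes the inequality strict.\<close>
  define lam where "lam = 4 * K + 3 * L + 1"
  define w where "w = (\<lambda>x. 1 + sqrt (1 + x\<^sup>2))"
  have w1: "w x \<ge> 1" for x by (simp add: w_def)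
  have wx: "w x > \<bar>x\<bar>" for x using abs_le_sqrt_1_plus_square[of x] by (simp add: w_def)
  have h0: "h0 > 0" "h0 \<le> 1" "h0 < d" using d by (auto simp: h0_def)
  have close: "\<bar>m t y - m t x\<bar> < \<delta>" if "t \<in> {0..t1}" "\<bar>x\<bar> \<le> X" "x \<le> y" "y \<le> x + h0" for t x y
    using d(2)[of "(t, x)" "(t, y)"] that h0 by (auto simp: dist_Pair_Pair dist_real_def)
  have main: "(Y t (x + h) - Y t x) / h > - \<delta> * exp (lam * t) * w x"
    if h: "0 < h" "h \<le> h0" and t: "t \<in> {0..t1}" for h t x
  proof (rule ccontr)
    define g where "g = (\<lambda>t x. (Y t (x + h) - Y t x) / h)"
    define \<psi> where "\<psi> = (\<lambda>t x. g t x + \<delta> * exp (lam * t) * w x)"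
    assume "\<not> (Y t (x + h) - Y t x) / h > - \<delta> * exp (lam * t) * w x"
    then have neg: "\<psi> t x \<le> 0" by (simp add: \<psi>_def g_def)
    have gm: "\<exists>z. x < z \<and> z < x + h \<and> g t x = m t z" if "t \<in> {0..t1}" for t x
    proof -
      have "\<exists>z>x. z < x + h \<and> Y t (x + h) - Y t x = (x + h - x) * m t z"
        using h by (intro MVT2) (auto intro!: Yx that)
      then show ?thesis using h by (auto simp: g_def field_simps)
    qed
    have gK: "\<bar>g t x\<bar> \<le> K" if "t \<in> {0..t1}" for t x
      using gm[OF that, of x] m[OF that] by auto
    have pos0: "\<psi> 0 x > 0" for x
    proof -
      have "g 0 x \<ge> 0" using gm[of 0 x] init t1 by auto
      then show ?thesis using \<delta> w1[of x] by (simp add: \<psi>_def add_nonneg_pos)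
    qed
    have far: "\<psi> t x > 0" if "t \<in> {0..t1}" "\<bar>x\<bar> > X" for t x
    proof -
      have lam0: "lam * t \<ge> 0" using that K0 L0 by (simp add: lam_def)
      have "K = \<delta> * X" using \<delta> by (simp add: X_def)
      also have "\<dots> < \<delta> * w x" using that wx[of x] \<delta> by (intro mult_strict_left_mono) auto
      also have "\<dots> \<le> \<delta> * exp (lam * t) * w x"
        using \<delta> w1[of x] lam0 by (intro mult_right_mono) auto
      finally show ?thesis using gK[OF that(1), of x] by (simp add: \<psi>_def)
    qed
    have Yt_cont: "continuous_on {0..t1} (\<lambda>t. Y t x)" for x
      using Yt by (rule DERIV_continuous_on)
    have Y_lip: "\<bar>Y t y - Y t x\<bar> \<le> K * \<bar>y - x\<bar>" if "t \<in> {0..t1}" for t x y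
      using field_differentiable_bound[of UNIV "Y t" "m t" K y x] Yx[OF that] m[OF that]
      by (auto simp: has_field_derivative_at_within)
    \<comment> \<open>Joint continuity combines continuity in t at fixed x with a Lipschitz bound in
      x that is uniform in t.\<close>
    have Y_cont: "continuous_on ({0..t1} \<times> UNIV) (\<lambda>(t, x). Y t x)"
      unfolding continuous_on_def
    proof
      fix p :: "real \<times> real" assume p: "p \<in> {0..t1} \<times> UNIV"
      obtain t x where tx: "p = (t, x)" "t \<in> {0..t1}" using p by auto
      let ?F = "at p within {0..t1} \<times> (UNIV :: real set)"
      have fst: "((\<lambda>q. fst q) \<longlongrightarrow> t) ?F" "((\<lambda>q. snd q) \<longlongrightarrow> x) ?F"
        unfolding tx by (auto intro!: tendsto_eq_intros)
      have 1: "((\<lambda>q. Y (fst q) x) \<longlongrightarrow> Y t x) ?F"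
        by (rule continuous_on_tendsto_compose[OF Yt_cont fst(1)])
          (use tx in \<open>auto simp: eventually_at_filter intro!: always_eventually\<close>)
      have 2: "((\<lambda>q. Y (fst q) (snd q) - Y (fst q) x) \<longlongrightarrow> 0) ?F"
      proof (rule Lim_null_comparison)
        show "\<forall>\<^sub>F q in ?F. norm (Y (fst q) (snd q) - Y (fst q) x) \<le> K * \<bar>snd q - x\<bar>"
          unfolding eventually_at_filter by (intro always_eventually) (auto intro: Y_lip)
        show "((\<lambda>q. K * \<bar>snd q - x\<bar>) \<longlongrightarrow> 0) ?F"
          by (rule tendsto_eq_intros fst refl)+ simp
      qed
      show "((\<lambda>(t, x). Y t x) \<longlongrightarrow> (case p of (t, x) \<Rightarrow> Y t x)) ?F"
        using tendsto_add[OF 1 2] by (simp add: tx case_prod_unfold)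
    qed
    have \<psi>_cont: "continuous_on ({0..t1} \<times> UNIV) (\<lambda>(t, x). \<psi> t x)"
    proof -
      have "continuous_on ({0..t1} \<times> UNIV) (\<lambda>p. (\<lambda>(t, x). Y t x) (fst p, snd p + h))"
        by (rule continuous_on_compose2[OF Y_cont]) (auto intro!: continuous_intros)
      then show ?thesis
        unfolding \<psi>_def g_def w_def case_prod_unfold using Y_cont h
        by (auto intro!: continuous_intros simp: case_prod_unfold)
    qed
    define S where "S = {p \<in> {0..t1} \<times> {-X..X}. (case p of (t, x) \<Rightarrow> \<psi> t x) \<le> 0}"
    have "compact S"
    proof -
      have "closedin (top_of_set ({0..t1} \<times> {-X..X})) S"
        unfolding S_def
        by (intro continuous_closedin_preimage[of _ _ "{..0}", simplified vimage_def Int_def, simplified]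
            continuous_on_subset[OF \<psi>_cont]) auto
      then show ?thesis by (rule closedin_compact[rotated]) (auto intro!: compact_Times)
    qed
    moreover have "(t, x) \<in> S" using neg far[OF t, of x] t by (force simp: S_def)
    \<comment> \<open>The violating set is compact and nonempty, so there is a first time of contact
      \<open>a\<close>, at the point \<open>b\<close>.\<close>
    ultimately obtain p where p: "p \<in> S" "\<And>q. q \<in> S \<Longrightarrow> fst p \<le> fst q"
      using continuous_attains_inf[of S fst] continuous_on_fst[OF continuous_on_id, of S] by blast
    define a b where "a = fst p" and "b = snd p"
    have a: "a \<in> {0..t1}" and b: "\<bar>b\<bar> \<le> X" and ab: "\<psi> a b \<le> 0"
      using p(1) by (auto simp: S_def a_def b_def abs_le_iff)
    have "a \<noteq> 0" using pos0[of b] ab by auto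
    then have a0: "a > 0" using a by auto
    have before: "\<psi> r y > 0" if "0 \<le> r" "r < a" for r y
    proof (rule ccontr)
      assume "\<not> \<psi> r y > 0"
      then have "(r, y) \<in> S" using far[of r y] that a by (force simp: S_def)
      then show False using p(2)[of "(r, y)"] that by (auto simp: a_def)
    qed
    define D where "D = \<delta> * exp (lam * a)"
    have D: "D \<ge> \<delta>" "D > 0" using \<delta> a K0 L0 by (auto simp: D_def lam_def)
    define dt where "dt = (Z a (b + h) - Z a b) / h + lam * D * w b"
    have \<psi>t: "((\<lambda>r. \<psi> r y) has_real_derivative (Z a (y + h) - Z a y) / h + lam * D * w y) (at a within {0..t1})" for y
      unfolding \<psi>_def g_def D_def using h
      by (auto intro!: derivative_eq_intros Yt a simp: field_simps)
    \<comment> \<open>Strict positivity before time \<open>a\<close> passes to the limit, so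
      \<open>\<psi> a\<close> is nonnegative everywhere and has a global minimum at
      \<open>b\<close>, with value 0.\<close>
    have at_a: "\<psi> a y \<ge> 0" for y
    proof -
      have "((\<lambda>r. \<psi> r y) \<longlongrightarrow> \<psi> a y) (at a within {0..t1})"
        using \<psi>t[of y] by (meson DERIV_isCont has_field_derivative_imp_has_derivative has_derivative_continuous continuous_within)
      then have "((\<lambda>r. \<psi> r y) \<longlongrightarrow> \<psi> a y) (at a within {0..<a})"
        by (rule tendsto_within_subset) (use a in auto)
      moreover have "\<forall>\<^sub>F r in at a within {0..<a}. \<psi> r y \<ge> 0"
        unfolding eventually_at_filter using before by (intro always_eventually) (auto intro: less_imp_le)
      moreover have "at a within {0..<a} \<noteq> bot" using a0 by (simp add: trivial_limit_within islimpt_in_closure)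
      ultimately show ?thesis by (intro tendsto_lowerbound) auto
    qed
    have \<psi>ab: "\<psi> a b = 0" using at_a[of b] ab by simp
    have gab: "g a b = - D * w b" using \<psi>ab by (simp add: \<psi>_def D_def)
    have "((\<lambda>x. \<psi> a x) has_real_derivative (m a (b + h) - m a b) / h + D * (b / sqrt (1 + b\<^sup>2))) (at b)"
    proof -
      have "((\<lambda>x. Y a (x + h)) has_real_derivative m a (b + h)) (at b)"
        using DERIV_shift[of "Y a" "m a (b + h)" b h] Yx[OF a] by simp
      from DERIV_add[OF DERIV_cdivide[OF DERIV_diff[OF this Yx[OF a, of b]], of h]
          DERIV_cmult[OF DERIV_add[OF DERIV_const[of 1] DERIV_sqrt_1_plus_square[of b]], of "\<delta> * exp (lam * a)"]]
      show ?thesis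
        unfolding \<psi>_def g_def w_def D_def by simp
    qed
    \<comment> \<open>The x-derivative of an average of m is a difference quotient of m. Criticality
      at \<open>b\<close> therefore bounds this quotient by \<open>D\<close>, although m itself need
      not be differentiable.\<close>
    then have dx: "(m a (b + h) - m a b) / h + D * (b / sqrt (1 + b\<^sup>2)) = 0"
      by (rule DERIV_local_min[where d=1]) (use \<psi>ab at_a in auto)
    have bb: "\<bar>b / sqrt (1 + b\<^sup>2)\<bar> \<le> 1"
      using abs_le_sqrt_1_plus_square[of b] by (simp add: divide_le_eq add_pos_nonneg)
    have "\<bar>D * (b / sqrt (1 + b\<^sup>2))\<bar> \<le> D"
      using mult_left_mono[OF bb, of D] D by (simp add: abs_mult)
    then have dm: "\<bar>(m a (b + h) - m a b) / h\<bar> \<le> D" using dx by linarith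
    \<comment> \<open>A positive time derivative at the first contact would make \<psi> negative
      slightly earlier.\<close>
    have dt_le: "dt \<le> 0"
    proof (rule ccontr)
      assume "\<not> dt \<le> 0"
      then have "\<exists>d>0. \<forall>h>0. a - h \<in> {0..t1} \<longrightarrow> h < d \<longrightarrow> \<psi> (a - h) b < \<psi> a b"
        using has_real_derivative_pos_inc_left[OF \<psi>t[of b]] by (auto simp: dt_def)
      then obtain e where e: "e > 0" "\<And>h. h > 0 \<Longrightarrow> a - h \<in> {0..t1} \<Longrightarrow> h < e \<Longrightarrow> \<psi> (a - h) b < \<psi> a b" by blast
      define k where "k = min (e / 2) a"
      have "\<psi> (a - k) b < \<psi> a b" using e a0 a by (intro e) (auto simp: k_def min_def)
      moreover have "\<psi> (a - k) b > 0" using e a0 by (intro before) (auto simp: k_def min_def)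
      ultimately show False using \<psi>ab by simp
    qed
    \<comment> \<open>The average is a value of m at some intermediate y and equals -D w at contact;
      m varies by less than 2 \<delta> on [b, b + h].\<close>
    have mz: "\<bar>m a z\<bar> \<le> D * w b + 2 * \<delta>" if "z \<in> {b..b+h}" for z
    proof -
      obtain y where y: "b < y" "y < b + h" "g a b = m a y" using gm[OF a, of b] by blast
      have "\<bar>m a z - m a b\<bar> < \<delta>" using that h by (intro close a b) auto
      moreover have "\<bar>m a y - m a b\<bar> < \<delta>" using y h by (intro close a b) auto
      moreover have "m a y = - (D * w b)" using y gab by simp
      moreover have "D * w b \<ge> 0" using D w1[of b] by simp
      ultimately show ?thesis by linarith
    qed
    define Q where "Q = D * w b + 2 * \<delta>"
    have i: "\<bar>integral {b..b+h} (\<lambda>z. B a z * m a z)\<bar> \<le> K * Q * h"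
    proof -
      have "continuous_on UNIV (\<lambda>x. (\<lambda>(t, x). m t x) (a, x))"
        by (rule continuous_on_compose2[OF cont continuous_on_Pair[OF continuous_on_const continuous_on_id]])
          (use a in auto)
      then have "continuous_on UNIV (m a)" by simp
      then have "norm (integral {b..b+h} (\<lambda>z. B a z * m a z)) \<le> (K * Q) * (b + h - b)"
        using h Bc[OF a] K0 by (intro integral_bound)
          (auto intro!: continuous_intros mult_mono B a mz[unfolded Q_def[symmetric]] simp: abs_mult intro: continuous_on_subset)
      then show ?thesis by simp
    qed
    have "\<bar>A a (b + h) - A a b\<bar> \<le> L * h" using AL[OF a, of "b + h" b] h by simp
    then have j: "\<bar>(A a (b + h) - A a b) * m a (b + h)\<bar> \<le> L * h * Q"
      unfolding abs_mult using mz[of "b + h"] h L0 by (intro mult_mono) (auto simp: Q_def)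
    have k: "\<bar>A a b * (m a (b + h) - m a b)\<bar> \<le> K * (D * h)"
      unfolding abs_mult using dm h K0 by (intro mult_mono A a) (auto simp: field_simps)
    have "\<bar>Z a (b + h) - Z a b\<bar> \<le> K * Q * h + L * h * Q + K * (D * h)"
    proof -
      \<comment> \<open>The discrete product rule: the first term is controlled by the Lipschitz
        constant of A and the size of m, the second by the quotient bound \<open>dm\<close>.\<close>
      have "A a (b + h) * m a (b + h) - A a b * m a b
         = (A a (b + h) - A a b) * m a (b + h) + A a b * (m a (b + h) - m a b)"
        by (simp add: algebra_simps)
      then show ?thesis using Z[OF a, of b "b + h"] h i j k by linarith
    qed
    also have "\<dots> = (K * Q + L * Q + K * D) * h" by (simp add: algebra_simps)
    finally have "\<bar>(Z a (b + h) - Z a b) / h\<bar> \<le> K * Q + L * Q + K * D"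
      using h by (simp add: field_simps)
    then have "dt \<ge> lam * D * w b - (K * Q + L * Q + K * D)" unfolding dt_def by linarith
    moreover have "lam * D * w b - (K * Q + L * Q + K * D) > 0"
    proof -
      have Dw: "D \<le> D * w b" using D w1[of b] by (simp add: mult_le_cancel_left1)
      then have "Q \<le> 3 * (D * w b)" using D unfolding Q_def by linarith
      then have "K * Q \<le> K * (3 * (D * w b))" "L * Q \<le> L * (3 * (D * w b))" "K * D \<le> K * (D * w b)"
        using K0 L0 Dw by (auto intro!: mult_left_mono)
      moreover have "D * w b > 0" using D Dw by linarith
      ultimately show ?thesis by (simp add: lam_def algebra_simps)
    qed
    ultimately show False using dt_le by linarith
  qed
  show thesis
    using main h0 by (intro that[of h0]) (auto simp: lam_def w_def)
qed

text \<open>First h tends to 0, which turns the average into \<open>m t x\<close>, and then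
  \<delta>; the order matters because \<open>h0\<close> depends on \<delta>.\<close>

lemma transport_nonneg:
  fixes Y m A B :: "real \<Rightarrow> real \<Rightarrow> real"
  assumes t1: "t1 \<ge> 0"
    and cont: "continuous_on ({0..t1} \<times> UNIV) (\<lambda>(t, x). m t x)"
    and m: "\<And>t x. t \<in> {0..t1} \<Longrightarrow> \<bar>m t x\<bar> \<le> K"
    and A: "\<And>t x. t \<in> {0..t1} \<Longrightarrow> \<bar>A t x\<bar> \<le> K"
    and B: "\<And>t x. t \<in> {0..t1} \<Longrightarrow> \<bar>B t x\<bar> \<le> K"
    and AL: "\<And>t x y. t \<in> {0..t1} \<Longrightarrow> \<bar>A t y - A t x\<bar> \<le> L * \<bar>y - x\<bar>"
    and Bc: "\<And>t. t \<in> {0..t1} \<Longrightarrow> continuous_on UNIV (B t)"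
    and Yx: "\<And>t x. t \<in> {0..t1} \<Longrightarrow> (Y t has_real_derivative m t x) (at x)"
    and Yt: "\<And>t x. t \<in> {0..t1} \<Longrightarrow> ((\<lambda>r. Y r x) has_real_derivative Z t x) (at t within {0..t1})"
    and Z: "\<And>t x y. t \<in> {0..t1} \<Longrightarrow> x \<le> y \<Longrightarrow>
        Z t y - Z t x = - (A t y * m t y - A t x * m t x) - integral {x..y} (\<lambda>z. B t z * m t z)"
    and init: "\<And>x. m 0 x \<ge> 0"
    and t: "t \<in> {0..t1}"
  shows "m t x \<ge> 0"
proof -
  define c where "c = exp ((4 * K + 3 * L + 1) * t) * (1 + sqrt (1 + x\<^sup>2))"
  have low: "m t x \<ge> - \<delta> * c" if \<delta>: "\<delta> > 0" for \<delta>
  proof -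
    obtain h0 where h0: "h0 > 0" "\<And>h. 0 < h \<Longrightarrow> h \<le> h0 \<Longrightarrow> (Y t (x + h) - Y t x) / h > - \<delta> * c"
      using transport_nonneg_aux[OF t1 cont m A B AL Bc Yx Yt Z init \<delta>] t
      unfolding c_def mult.assoc by metis
    have "((\<lambda>h. (Y t (x + h) - Y t x) / h) \<longlongrightarrow> m t x) (at_right 0)"
      using Yx[OF t, of x] unfolding DERIV_def by (rule filterlim_mono) (auto simp: at_le)
    moreover have "\<forall>\<^sub>F h in at_right 0. (Y t (x + h) - Y t x) / h \<ge> - \<delta> * c"
      unfolding eventually_at_right_field using h0 by (intro exI[of _ h0]) (auto intro: less_imp_le)
    ultimately show ?thesis by (intro tendsto_lowerbound) auto
  qed
  have "((\<lambda>\<delta>. - \<delta> * c) \<longlongrightarrow> - 0 * c) (at_right 0)" by (intro tendsto_intros)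
  moreover have "\<forall>\<^sub>F \<delta> in at_right 0. - \<delta> * c \<le> m t x"
    using low by (auto simp: eventually_at_right_field intro: exI[of _ 1])
  ultimately show ?thesis using tendsto_upperbound[of "\<lambda>\<delta>. - \<delta> * c" "- 0 * c" "at_right 0" "m t x"] by simp
qed

subsection \<open>Smooth bumps and integration of the weak equation\<close>

lemma continuous_on_of_DERIV:
  fixes f f' :: "real \<Rightarrow> real"
  assumes "\<And>x. (f has_real_derivative f' x) (at x)"
  shows "continuous_on S f"
  using assms by (blast intro: continuous_at_imp_continuous_on DERIV_isCont)

section \<open>Differentiability of finite order and flat functions\<close>

text \<open>Finite orders allow induction: each closure rule at order \<open>Suc k\<close> follows
  from the derivative rule and the closure at order k. Test functions require all orders at
  once.\<close>

definition differentiable_upto :: "nat \<Rightarrow> (real \<Rightarrow> real) \<Rightarrow> bool" where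
  "differentiable_upto k f \<longleftrightarrow> (\<forall>j<k. \<forall>x. (deriv ^^ j) f field_differentiable at x)"

lemma differentiable_upto_0 [simp]: "differentiable_upto 0 f"
  by (simp add: differentiable_upto_def)

lemma differentiable_upto_Suc:
  "differentiable_upto (Suc k) f \<longleftrightarrow> (\<forall>x. f field_differentiable at x) \<and> differentiable_upto k (deriv f)"
  unfolding differentiable_upto_def All_less_Suc2
  by (simp add: funpow_Suc_right del: funpow.simps(2))

lemma differentiable_upto_SucI:
  assumes "\<And>x. (f has_real_derivative f' x) (at x)" "differentiable_upto k f'"
  shows "differentiable_upto (Suc k) f"
proof -
  have "deriv f = f'" using assms(1) by (auto intro: DERIV_imp_deriv)
  then show ?thesis using assms by (auto simp: differentiable_upto_Suc field_differentiable_def)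
qed

lemma differentiable_upto_SucE:
  assumes "differentiable_upto (Suc k) f"
  obtains f' where "\<And>x. (f has_real_derivative f' x) (at x)" "differentiable_upto k f'"
proof
  show "(f has_real_derivative deriv f x) (at x)" for x
    using assms by (auto simp: differentiable_upto_Suc field_differentiable_derivI)
  show "differentiable_upto k (deriv f)" using assms by (simp add: differentiable_upto_Suc)
qed

lemma differentiable_upto_mono: "differentiable_upto k f \<Longrightarrow> j \<le> k \<Longrightarrow> differentiable_upto j f"
  by (auto simp: differentiable_upto_def)

lemma differentiable_upto_add:
  "differentiable_upto k f \<Longrightarrow> differentiable_upto k g \<Longrightarrow> differentiable_upto k (\<lambda>x. f x + g x)"
proof (induction k arbitrary: f g)
  case (Suc k)
  obtain f' where f': "\<And>x. (f has_real_derivative f' x) (at x)" "differentiable_upto k f'"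
    using differentiable_upto_SucE[OF Suc.prems(1)] by blast
  obtain g' where g': "\<And>x. (g has_real_derivative g' x) (at x)" "differentiable_upto k g'"
    using differentiable_upto_SucE[OF Suc.prems(2)] by blast
  show ?case
    by (rule differentiable_upto_SucI[OF DERIV_add[OF f'(1) g'(1)] Suc.IH[OF f'(2) g'(2)]])
qed simp

lemma differentiable_upto_mult:
  "differentiable_upto k f \<Longrightarrow> differentiable_upto k g \<Longrightarrow> differentiable_upto k (\<lambda>x. f x * g x)"
proof (induction k arbitrary: f g)
  case (Suc k)
  obtain f' where f': "\<And>x. (f has_real_derivative f' x) (at x)" "differentiable_upto k f'"
    using differentiable_upto_SucE[OF Suc.prems(1)] by blast
  obtain g' where g': "\<And>x. (g has_real_derivative g' x) (at x)" "differentiable_upto k g'"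
    using differentiable_upto_SucE[OF Suc.prems(2)] by blast
  have fg: "differentiable_upto k f" "differentiable_upto k g"
    using Suc.prems by (auto intro: differentiable_upto_mono)
  show ?case
    by (rule differentiable_upto_SucI[OF DERIV_mult[OF f'(1) g'(1)]])
      (intro differentiable_upto_add Suc.IH f' g' fg)
qed simp

lemma differentiable_upto_const: "differentiable_upto k (\<lambda>x. c)"
  by (induction k arbitrary: c) (auto intro!: differentiable_upto_SucI[OF DERIV_const])

lemma differentiable_upto_affine:
  "differentiable_upto k f \<Longrightarrow> differentiable_upto k (\<lambda>x. f (a * x + b))"
proof (induction k arbitrary: f)
  case (Suc k)
  obtain f' where f': "\<And>x. (f has_real_derivative f' x) (at x)" "differentiable_upto k f'"
    using differentiable_upto_SucE[OF Suc.prems] by blast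
  show ?case
  proof (rule differentiable_upto_SucI)
    show "((\<lambda>x. f (a * x + b)) has_real_derivative f' (a * x + b) * a) (at x)" for x
      by (rule DERIV_chain2[OF f'(1)]) (auto intro!: derivative_eq_intros)
    show "differentiable_upto k (\<lambda>x. f' (a * x + b) * a)"
      by (intro differentiable_upto_mult differentiable_upto_const Suc.IH f')
  qed
qed simp

text \<open>The classical smooth function exp(-1/x) extended by 0, with a polynomial factor in 1/x
  so that the family is closed under differentiation.\<close>

definition flat_exp :: "real poly \<Rightarrow> real \<Rightarrow> real" where
  "flat_exp p x = (if x > 0 then poly p (1 / x) * exp (- 1 / x) else 0)"

lemma poly_exp_tendsto_0: "((\<lambda>y. poly p y * exp (- y)) \<longlongrightarrow> (0::real)) at_top"
proof -
  have "((\<lambda>y. \<Sum>i\<le>degree p. coeff p i * (y ^ i / exp y)) \<longlongrightarrow> (\<Sum>i\<le>degree p. coeff p i * 0)) at_top"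
    by (intro tendsto_sum tendsto_mult tendsto_const tendsto_power_div_exp_0)
  then show ?thesis
    by (simp add: poly_altdef exp_minus sum_distrib_right divide_inverse mult.assoc)
qed

lemma flat_exp_tendsto_0: "(flat_exp p \<longlongrightarrow> 0) (at_right 0)"
proof -
  have "((\<lambda>x. poly p (1 / x) * exp (- (1 / x))) \<longlongrightarrow> 0) (at_right 0)"
    by (rule filterlim_compose[OF poly_exp_tendsto_0]) (auto simp: filterlim_inverse_at_top_right inverse_eq_divide[symmetric])
  then show ?thesis
    by (rule Lim_transform_eventually) (auto simp: flat_exp_def eventually_at_right_field intro: exI[of _ 1])
qed

text \<open>In y = 1/x the new factor is y^2 (p - p'); the two outer \<open>pCons 0\<close> multiply
  by y^2. At x = 0 the right difference quotient is \<open>flat_exp\<close> of y p, which tends to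
  0.\<close>

lemma DERIV_flat_exp:
  "(flat_exp p has_real_derivative flat_exp (pCons 0 (pCons 0 (p - pderiv p))) x) (at x)"
proof -
  consider "x > 0" | "x < 0" | "x = 0" by linarith
  then show ?thesis
  proof cases
    case 1
    have "((\<lambda>x. poly p (1 / x) * exp (- 1 / x)) has_real_derivative
        flat_exp (pCons 0 (pCons 0 (p - pderiv p))) x) (at x)"
      using 1 by (auto intro!: derivative_eq_intros DERIV_chain2[OF poly_DERIV] simp: flat_exp_def field_simps power2_eq_square)
    then show ?thesis
      by (rule DERIV_cong_ev[THEN iffD1, rotated -1, OF _ refl _ refl])
        (use 1 in \<open>auto intro!: eventually_mono[OF eventually_nhds_in_open[of "{0<..}"]] simp: flat_exp_def\<close>)
  next
    case 2
    have "((\<lambda>x. 0) has_real_derivative 0) (at x)" by simp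
    then show ?thesis using 2
      by (subst DERIV_cong_ev[OF refl _ refl, of _ "\<lambda>x. 0"])
        (auto intro!: eventually_mono[OF eventually_nhds_in_open[of "{..<0}"]] simp: flat_exp_def)
  next
    case 3
    have "((\<lambda>h. flat_exp p h / h) \<longlongrightarrow> 0) (at_right 0)"
      using flat_exp_tendsto_0[of "pCons 0 p"]
      by (rule Lim_transform_eventually) (auto simp: flat_exp_def eventually_at_right_field intro: exI[of _ 1])
    moreover have "((\<lambda>h. flat_exp p h / h) \<longlongrightarrow> 0) (at_left 0)"
      by (rule tendsto_eventually) (auto simp: flat_exp_def eventually_at_left_field intro: exI[of _ "-1"])
    ultimately have "((\<lambda>h. flat_exp p h / h) \<longlongrightarrow> 0) (at 0)"
      by (rule filterlim_split_at[rotated])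
    then show ?thesis using 3 by (simp add: DERIV_def flat_exp_def)
  qed
qed

lemma differentiable_upto_flat_exp: "differentiable_upto k (flat_exp p)"
  by (induction k arbitrary: p) (auto intro: differentiable_upto_SucI[OF DERIV_flat_exp])

lemma test_functionI:
  assumes "\<And>k. differentiable_upto k \<phi>" "\<And>x. x \<notin> {a..b} \<Longrightarrow> \<phi> x = 0"
  shows "test_function \<phi>"
  unfolding test_function_def
proof (intro conjI allI)
  fix k x show "(deriv ^^ k) \<phi> field_differentiable at x"
    using assms(1)[of "Suc k"] by (auto simp: differentiable_upto_def)
  have "{x. \<phi> x \<noteq> 0} \<subseteq> {a..b}" using assms(2) by blast
  then have "closure {x. \<phi> x \<noteq> 0} \<subseteq> {a..b}" by (rule closure_minimal) simp
  then show "compact (closure {x. \<phi> x \<noteq> 0})"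
    by (metis bounded_closed_interval bounded_subset closed_closure compact_eq_bounded_closed)
qed

section \<open>Integrals of compactly supported functions and the weak equation\<close>

lemma compact_support_integral:
  fixes f :: "real \<Rightarrow> real"
  assumes "continuous_on UNIV f" "\<And>x. x \<notin> {a..b} \<Longrightarrow> f x = 0"
  shows "integrable lborel f" "(LINT x|lborel. f x) = integral {a..b} f"
proof -
  have *: "(\<lambda>x. indicator {a..b} x *\<^sub>R f x) = f"
  proof
    fix x show "indicator {a..b} x *\<^sub>R f x = f x"
      using assms(2)[of x] by (cases "x \<in> {a..b}") auto
  qed
  have "set_integrable lborel {a..b} f"
    by (rule borel_integrable_atLeastAtMost') (rule continuous_on_subset[OF assms(1)], simp)
  then show "integrable lborel f" "(LINT x|lborel. f x) = integral {a..b} f"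
    using set_borel_integral_eq_integral(2)[of "{a..b}" f]
    unfolding set_integrable_def set_lebesgue_integral_def * by auto
qed

lemma LINT_deriv_compact_support:
  fixes F G :: "real \<Rightarrow> real"
  assumes "\<And>x. (F has_real_derivative G x) (at x)" "continuous_on UNIV G"
    and "\<And>x. x \<notin> {a..b} \<Longrightarrow> F x = 0" "\<And>x. x \<notin> {a..b} \<Longrightarrow> G x = 0"
  shows "(LINT x|lborel. G x) = 0"
proof (cases "a \<le> b")
  case True
  have "(LINT x|lborel. G x) = integral {a - 1..b + 1} G"
    by (rule compact_support_integral) (use assms in auto)
  also have "\<dots> = F (b + 1) - F (a - 1)"
    using True assms(1)
    by (intro integral_unique fundamental_theorem_of_calculus)
      (auto simp: has_real_derivative_iff_has_vector_derivative[symmetric] intro: has_field_derivative_at_within)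
  finally show ?thesis using assms(3) by simp
next
  case False
  then have "G = (\<lambda>x. 0)" using assms(4) by auto
  then show ?thesis by simp
qed

lemma continuous_on_antiderivative:
  fixes f :: "real \<Rightarrow> real"
  assumes "continuous_on UNIV f"
  obtains F where "\<And>x. (F has_real_derivative f x) (at x)"
proof -
  have "\<exists>F. \<forall>x::real. - \<infinity> < ereal x \<longrightarrow> ereal x < \<infinity> \<longrightarrow> (F has_vector_derivative f x) (at x)"
    by (rule einterval_antiderivative) (use assms in \<open>auto simp: continuous_on_eq_continuous_at\<close>)
  then show ?thesis
    using that by (auto simp: has_real_derivative_iff_has_vector_derivative)
qed

definition bump :: "real \<Rightarrow> real" where
  "bump x = flat_exp 1 (x + 1) * flat_exp 1 (1 - x)"

lemma differentiable_upto_bump: "differentiable_upto k bump"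
proof -
  have "differentiable_upto k (\<lambda>x. flat_exp 1 (1 * x + 1) * flat_exp 1 ((- 1) * x + 1))"
    by (intro differentiable_upto_mult differentiable_upto_affine differentiable_upto_flat_exp)
  then show ?thesis unfolding bump_def[abs_def] by (simp add: add.commute)
qed

lemma bump_nonneg: "bump x \<ge> 0" and bump_0: "bump 0 > 0" and bump_outside: "\<bar>x\<bar> \<ge> 1 \<Longrightarrow> bump x = 0"
  by (auto simp: bump_def flat_exp_def)

text \<open>
  A du Bois-Reymond lemma: with \<open>U = Q - W + \<integral>(V + P)\<close> the hypothesis reads \<open>\<integral> U \<phi>' = 0\<close>, and
  the test functions \<open>\<phi>\<close> whose derivative is the difference of two translates of one bump show that
  \<open>U\<close> is constant.
\<close>

lemma integrated_of_weak:
  fixes V W P Q :: "real \<Rightarrow> real"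
  assumes V: "\<And>x. (V has_real_derivative W x) (at x)"
    and W: "continuous_on UNIV W" and P: "continuous_on UNIV P" and Q: "continuous_on UNIV Q"
    and weak: "\<And>\<phi>. test_function \<phi> \<Longrightarrow> (LINT x|lborel. V x * (\<phi> x - deriv (deriv \<phi>) x))
      + (LINT x|lborel. P x * \<phi> x) - (LINT x|lborel. Q x * deriv \<phi> x) = 0"
    and xy: "x \<le> y"
  shows "(Q y - W y) - (Q x - W x) = - integral {x..y} (\<lambda>z. V z + P z)"
proof -
  have Vc: "continuous_on UNIV V"
    by (rule continuous_on_of_DERIV) (rule V)
  obtain I where I: "\<And>x. (I has_real_derivative V x + P x) (at x)"
    using continuous_on_antiderivative[OF continuous_on_add[OF Vc P]] by blast
  have Ic: "continuous_on UNIV I"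
    by (rule continuous_on_of_DERIV) (rule I)
  define U where "U = (\<lambda>z. Q z - W z + I z)"
  have Uc: "continuous_on UNIV U" unfolding U_def by (intro continuous_intros Q W Ic)
  have Ucs: "continuous_on S (\<lambda>z. U (z + a))" for a S
    by (rule continuous_on_compose2[OF Uc]) (auto intro!: continuous_intros)
  obtain bump' where bump': "\<And>x. (bump has_real_derivative bump' x) (at x)" "differentiable_upto 1 bump'"
    using differentiable_upto_SucE[OF differentiable_upto_bump[of "Suc 1"]] by blast
  have bc: "continuous_on UNIV bump"
    by (rule continuous_on_of_DERIV) (rule bump'(1))
  have b'c: "continuous_on UNIV bump'"
    using differentiable_upto_SucE[of 0 bump'] bump'(2) continuous_on_of_DERIV[of bump']
    by (metis One_nat_def)
  have key: "(LINT z|lborel. (U (z + x) - U (z + y)) * bump (z / e)) = 0" if e: "e > 0" for e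
  proof -
    have bce: "continuous_on S (\<lambda>z. bump ((z - a) / e))" for S a
      by (rule continuous_on_compose2[OF bc]) (use e in \<open>auto intro!: continuous_intros\<close>)
    have b'ce: "continuous_on S (\<lambda>z. bump' ((z - a) / e))" for S a
      by (rule continuous_on_compose2[OF b'c]) (use e in \<open>auto intro!: continuous_intros\<close>)
    have be: "((\<lambda>z. bump ((z - a) / e)) has_real_derivative bump' ((z - a) / e) / e) (at z)" for a z
    proof -
      have "((\<lambda>z. (z - a) / e) has_real_derivative 1 / e) (at z)"
        using e by (auto intro!: derivative_eq_intros)
      from DERIV_chain2[OF bump'(1) this] show ?thesis by simp
    qed
    obtain R where R: "\<And>z. (R has_real_derivative bump (z / e)) (at z)"
      using continuous_on_antiderivative[OF bce[of UNIV 0]] by auto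
    have dR: "differentiable_upto k R" for k
    proof (rule differentiable_upto_mono[of "Suc k"])
      show "differentiable_upto (Suc k) R"
        using differentiable_upto_SucI[OF R] differentiable_upto_affine[OF differentiable_upto_bump, of k "1/e" 0]
        by simp
    qed simp
    \<comment> \<open>\<open>R\<close> itself is not compactly supported. It is constant on either
      side of [-e, e], so its translates to x and y cancel outside [x - e, y + e].\<close>
    have R_const: "R z = R w" if "z \<le> w" "\<And>u. z < u \<Longrightarrow> u < w \<Longrightarrow> \<bar>u\<bar> \<ge> e" for z w
    proof (cases "z = w")
      case False
      have "R w = R z"
      proof (rule DERIV_isconst_end[of z w R])
        show "z < w" using that False by simp
        show "continuous_on {z..w} R" by (rule continuous_on_of_DERIV) (rule R)
        show "(R has_real_derivative 0) (at u)" if "z < u" "u < w" for u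
          using R[of u] bump_outside[of "u / e"] \<open>\<And>u. z < u \<Longrightarrow> u < w \<Longrightarrow> \<bar>u\<bar> \<ge> e\<close>[OF that] e
          by (simp add: field_simps)
      qed
      then show ?thesis by simp
    qed simp
    define \<phi> where "\<phi> = (\<lambda>z. R (z - x) - R (z - y))"
    define \<phi>1 where "\<phi>1 = (\<lambda>z. bump ((z - x) / e) - bump ((z - y) / e))"
    define \<phi>2 where "\<phi>2 = (\<lambda>z. bump' ((z - x) / e) / e - bump' ((z - y) / e) / e)"
    define a b where "a = x - e" and "b = y + e"
    have \<phi>0: "\<phi> z = 0" if "z \<notin> {a..b}" for z
    proof -
      have "z < a \<or> z > b" using that by auto
      then show ?thesis
      proof
        assume "z < a"
        then have "R (z - y) = R (z - x)" using xy e by (intro R_const) (auto simp: a_def)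
        then show ?thesis by (simp add: \<phi>_def)
      next
        assume "z > b"
        then have "R (z - y) = R (z - x)" using xy e by (intro R_const) (auto simp: b_def)
        then show ?thesis by (simp add: \<phi>_def)
      qed
    qed
    have d1: "(\<phi> has_real_derivative \<phi>1 z) (at z)" for z
    proof -
      have "((\<lambda>z. R (z - c)) has_real_derivative bump ((z - c) / e)) (at z)" for c
        using DERIV_shift[of R "bump ((z - c) / e)" z "- c"] R[of "z - c"] by simp
      then show ?thesis unfolding \<phi>_def \<phi>1_def by (intro DERIV_diff)
    qed
    have d2: "(\<phi>1 has_real_derivative \<phi>2 z) (at z)" for z
      unfolding \<phi>1_def \<phi>2_def by (intro DERIV_diff be)
    have \<phi>10: "\<phi>1 z = 0" if "z \<notin> {a..b}" for z
      using that xy e bump_outside[of "(z - x) / e"] bump_outside[of "(z - y) / e"]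
      by (auto simp: \<phi>1_def a_def b_def field_simps)
    have \<phi>20: "\<phi>2 z = 0" if "z \<notin> {a..b}" for z
    proof (rule DERIV_unique[OF d2])
      have "((\<lambda>x. 0) has_real_derivative 0) (at z)" by simp
      then show "(\<phi>1 has_real_derivative 0) (at z)"
        by (rule DERIV_cong_ev[THEN iffD1, rotated -1, OF _ refl _ refl])
          (use that \<phi>10 in \<open>auto intro!: eventually_mono[OF eventually_nhds_in_open[of "- {a..b}"]]\<close>)
    qed
    have dd: "deriv \<phi> = \<phi>1" "deriv \<phi>1 = \<phi>2" using d1 d2 by (auto intro!: DERIV_imp_deriv)
    have c0: "continuous_on UNIV \<phi>" by (rule continuous_on_of_DERIV) (rule d1)
    have c1: "continuous_on UNIV \<phi>1" unfolding \<phi>1_def by (intro continuous_intros bce)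
    have c2: "continuous_on UNIV \<phi>2" unfolding \<phi>2_def using e by (intro continuous_intros b'ce) auto
    have test: "test_function \<phi>"
    proof (rule test_functionI[OF _ \<phi>0])
      fix k
      have "differentiable_upto k (\<lambda>z. R (1 * z + (- x)) + (- 1) * R (1 * z + (- y)))"
        by (intro differentiable_upto_add differentiable_upto_mult differentiable_upto_const differentiable_upto_affine dR)
      then show "differentiable_upto k \<phi>" by (simp add: \<phi>_def)
    qed
    note int = compact_support_integral(1)[where a=a and b=b]
    have i: "integrable lborel (\<lambda>z. f z * g z)"
      if "continuous_on UNIV f" "continuous_on UNIV g" "\<And>z. z \<notin> {a..b} \<Longrightarrow> g z = 0" for f g :: "real \<Rightarrow> real"
      by (rule int) (use that in \<open>auto intro!: continuous_intros\<close>)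
    \<comment> \<open>Integration by parts: the integrands here and in the identity behind
      \<open>e2\<close> are the derivatives of V \<open>\<phi>1\<close> and I \<phi>. With them
      every term of the weak equation takes the form of a coefficient times \<open>\<phi>1\<close>,
      and the coefficients add up to -U.\<close>
    have "(LINT z|lborel. W z * \<phi>1 z + V z * \<phi>2 z) = 0"
      by (rule LINT_deriv_compact_support[of "\<lambda>z. V z * \<phi>1 z" _ a b])
        (use \<phi>10 \<phi>20 in \<open>auto intro!: derivative_eq_intros V d2 continuous_intros W Vc c1 c2\<close>)
    then have e1: "(LINT z|lborel. W z * \<phi>1 z) + (LINT z|lborel. V z * \<phi>2 z) = 0"
      using i[OF W c1 \<phi>10] i[OF Vc c2 \<phi>20] by simp
    have "(LINT z|lborel. (V z + P z) * \<phi> z + I z * \<phi>1 z) = 0"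
      by (rule LINT_deriv_compact_support[of "\<lambda>z. I z * \<phi> z" _ a b])
        (use \<phi>10 \<phi>0 in \<open>auto intro!: derivative_eq_intros I d1 continuous_intros P Vc Ic c0 c1\<close>)
    then have e2: "(LINT z|lborel. V z * \<phi> z) + (LINT z|lborel. P z * \<phi> z) + (LINT z|lborel. I z * \<phi>1 z) = 0"
      using i[OF Vc c0 \<phi>0] i[OF P c0 \<phi>0] i[OF Ic c1 \<phi>10] by (simp add: distrib_right)
    have e3: "(LINT z|lborel. V z * \<phi> z) - (LINT z|lborel. V z * \<phi>2 z)
       + (LINT x|lborel. P x * \<phi> x) - (LINT x|lborel. Q x * \<phi>1 x) = 0"
      using weak[OF test] i[OF Vc c0 \<phi>0] i[OF Vc c2 \<phi>20] by (simp add: dd right_diff_distrib)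
    have "(LINT z|lborel. U z * \<phi>1 z)
       = (LINT z|lborel. Q z * \<phi>1 z) - (LINT z|lborel. W z * \<phi>1 z) + (LINT z|lborel. I z * \<phi>1 z)"
      unfolding U_def using i[OF Q c1 \<phi>10] i[OF W c1 \<phi>10] i[OF Ic c1 \<phi>10]
      by (simp add: distrib_right left_diff_distrib)
    then have "(LINT z|lborel. U z * \<phi>1 z) = 0" using e1 e2 e3 by linarith
    moreover have ib: "integrable lborel (\<lambda>z. U z * bump ((z - c) / e))" for c
      by (rule compact_support_integral(1)[of _ "c - e" "c + e"])
        (use e bump_outside[of "(z - c) / e" for z] in \<open>auto intro!: continuous_intros Uc bce simp: field_simps\<close>)
    ultimately have "(LINT z|lborel. U z * bump ((z - x) / e)) - (LINT z|lborel. U z * bump ((z - y) / e)) = 0"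
      using ib[of x] ib[of y] by (simp add: \<phi>1_def right_diff_distrib)
    moreover have "(LINT z|lborel. U z * bump ((z - c) / e)) = (LINT z|lborel. U (z + c) * bump (z / e))"
      and ib2: "integrable lborel (\<lambda>z. U (z + c) * bump (z / e))" for c
      using lborel_integral_real_affine[of 1 "\<lambda>z. U z * bump ((z - c) / e)" c]
        lborel_integrable_real_affine[OF ib[of c], of 1 c] by (simp_all add: add.commute)
    ultimately show ?thesis using ib2[of x] ib2[of y] by (simp add: left_diff_distrib)
  qed
  \<comment> \<open>Localisation: choose e so small that \<open>s * D\<close> is positive on (-e,
    e). The nonnegative continuous function \<open>s * D z * bump (z / e)\<close> has integral 0, so
    it vanishes, in particular at 0, against \<open>bump 0 > 0\<close>.\<close>
  have key2: "U (z + x) - U (z + y) = 0" if "z = 0" for z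
  proof (rule ccontr)
    define D where "D = (\<lambda>z. U (z + x) - U (z + y))"
    define s where "s = sgn (D 0)"
    assume "U (z + x) - U (z + y) \<noteq> 0"
    then have D0: "s * D 0 > 0" by (simp add: that s_def D_def sgn_if mult_less_0_iff)
    have Dc: "continuous_on UNIV (\<lambda>z. s * D z)" unfolding D_def by (intro continuous_intros Ucs)
    then have lim: "(\<lambda>z. s * D z) \<midarrow>0\<rightarrow> s * D 0"
      by (simp add: continuous_on_eq_continuous_at isCont_def)
    have "\<forall>\<^sub>F z in at 0. 0 < s * D z" using order_tendstoD(1)[OF lim D0] .
    then obtain e where "e > 0" "\<forall>z. z \<noteq> 0 \<and> dist z 0 < e \<longrightarrow> 0 < s * D z"
      unfolding eventually_at by auto
    then have e: "e > 0" "\<And>z. z \<noteq> 0 \<Longrightarrow> \<bar>z\<bar> < e \<Longrightarrow> s * D z > 0" by auto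
    have pos: "s * D z > 0" if "\<bar>z\<bar> < e" for z using e(2)[of z] D0 that by (cases "z = 0") auto
    have out: "bump (z / e) = 0" if "\<not> \<bar>z\<bar> < e" for z
      using that e(1) by (intro bump_outside) (auto simp: field_simps)
    have c: "continuous_on UNIV (\<lambda>z. s * D z * bump (z / e))"
      by (intro continuous_intros Dc continuous_on_compose2[OF bc]) (use e in auto)
    have "integral {-e..e} (\<lambda>z. s * D z * bump (z / e)) = (LINT z|lborel. s * D z * bump (z / e))"
      by (rule compact_support_integral(2)[symmetric, OF c]) (use out in auto)
    also have "\<dots> = s * (LINT z|lborel. D z * bump (z / e))" by (simp add: mult.assoc)
    also have "\<dots> = 0" using key[OF e(1)] by (simp add: D_def)
    finally have i0: "integral {-e..e} (\<lambda>z. s * D z * bump (z / e)) = 0" .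
    have "s * D z * bump (z / e) \<ge> 0" for z
      using pos[of z] out[of z] bump_nonneg[of "z / e"]
      by (cases "\<bar>z\<bar> < e") (simp_all add: mult_nonneg_nonneg less_imp_le)
    then have "\<forall>z\<in>{-e..e}. s * D z * bump (z / e) = 0"
      using integral_eq_0_iff[OF continuous_on_subset[OF c], of "-e" e] i0 e(1) by auto
    then have "s * D 0 * bump (0 / e) = 0" by (rule bspec) (use e(1) in simp)
    then show False using D0 bump_0 by auto
  qed
  have "((\<lambda>z. V z + P z) has_integral (I y - I x)) {x..y}"
    using xy I by (intro fundamental_theorem_of_calculus)
      (auto simp: has_real_derivative_iff_has_vector_derivative[symmetric] intro: has_field_derivative_at_within)
  then have "integral {x..y} (\<lambda>z. V z + P z) = I y - I x" by (rule integral_unique)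
  then show ?thesis using key2[of 0] by (simp add: U_def)
qed

subsection \<open>Fourier inversion on square integrable functions\<close>

text \<open>A plain Bochner integral, normalised as in \<open>truncated_fourier\<close>. It is
  meaningful for integrable g and involves no limit in L^2.\<close>

definition inv_fourier :: "(real \<Rightarrow> complex) \<Rightarrow> real \<Rightarrow> complex" where
  "inv_fourier g x = (LINT \<xi>|lborel. g \<xi> * cis (x * \<xi>)) / complex_of_real (sqrt (2 * pi))"

section \<open>Gaussian summation of the Fourier integral\<close>

lemma cis_measurable [measurable]: "cis \<in> borel_measurable borel"
  by (intro borel_measurable_continuous_onI continuous_intros)

text \<open>The characteristic function of the standard normal law, rescaled by \<sigma>. Gaussian
  damping in frequency thus corresponds to averaging against \<open>normal_density\<close>.\<close>

lemma gaussian_fourier: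
  assumes "\<sigma> > 0"
  shows "(LINT \<xi>|lborel. cis (z * \<xi>) * complex_of_real (exp (- (\<sigma>\<^sup>2 * \<xi>\<^sup>2) / 2)))
       = complex_of_real (2 * pi * normal_density 0 \<sigma> z)"
proof -
  define f where "f = (\<lambda>x. std_normal_density x *\<^sub>R iexp ((z / \<sigma>) * x))"
  have iexp: "iexp y = cis y" for y by (simp add: cis_conv_exp)
  have "complex_of_real (exp (- ((z / \<sigma>)\<^sup>2) / 2)) = char std_normal_distribution (z / \<sigma>)"
    by (simp add: char_std_normal_distribution)
  also have "\<dots> = (LINT x|lborel. f x)"
    unfolding char_def f_def by (subst integral_density) auto
  also have "\<dots> = \<bar>\<sigma>\<bar> *\<^sub>R (LINT x|lborel. f (0 + \<sigma> * x))"
    using assms by (intro lborel_integral_real_affine) auto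
  also have "(\<lambda>x. f (0 + \<sigma> * x)) = (\<lambda>x. complex_of_real (1 / sqrt (2 * pi)) *
      (cis (z * x) * complex_of_real (exp (- (\<sigma>\<^sup>2 * x\<^sup>2) / 2))))"
    unfolding f_def iexp using assms
    by (intro ext) (simp add: std_normal_density_def scaleR_conv_of_real power_mult_distrib)
  finally have *: "complex_of_real (exp (- ((z / \<sigma>)\<^sup>2) / 2)) = complex_of_real \<sigma> * (complex_of_real (1 / sqrt (2 * pi)) *
     (LINT \<xi>|lborel. cis (z * \<xi>) * complex_of_real (exp (- (\<sigma>\<^sup>2 * \<xi>\<^sup>2) / 2))))"
    using assms by (simp add: scaleR_conv_of_real)
  have n: "2 * pi * normal_density 0 \<sigma> z = sqrt (2 * pi) / \<sigma> * exp (- ((z / \<sigma>)\<^sup>2) / 2)"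
  proof -
    define c where "c = sqrt (2 * pi)"
    have c: "2 * pi = c * c" "c > 0" unfolding c_def by simp_all
    have "2 * pi * (1 / (sqrt (2 * pi) * \<sigma>)) = sqrt (2 * pi) / \<sigma>"
      unfolding c_def[symmetric] c(1) using assms c(2) by (simp add: field_simps)
    moreover have r: "sqrt (2 * pi * \<sigma>\<^sup>2) = sqrt (2 * pi) * \<sigma>"
      using assms by (simp add: real_sqrt_mult)
    have "- (z - 0)\<^sup>2 / (2 * \<sigma>\<^sup>2) = - ((z / \<sigma>)\<^sup>2) / 2" by (simp add: power_divide)
    then have "2 * pi * normal_density 0 \<sigma> z
        = (2 * pi * (1 / (sqrt (2 * pi) * \<sigma>))) * exp (- ((z / \<sigma>)\<^sup>2) / 2)"
      unfolding normal_density_def r by (simp only: mult.assoc)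
    ultimately show ?thesis by simp
  qed
  show ?thesis
    unfolding n using assms *
    by (simp add: field_simps flip: of_real_mult) 
qed

lemma L2_mult_integrable:
  fixes f g :: "'a \<Rightarrow> 'b::{banach, second_countable_topology, real_normed_algebra}"
  assumes "f \<in> borel_measurable M" "g \<in> borel_measurable M"
    and "integrable M (\<lambda>x. (norm (f x))\<^sup>2)" "integrable M (\<lambda>x. (norm (g x))\<^sup>2)"
  shows "integrable M (\<lambda>x. f x * g x)"
proof (rule Bochner_Integration.integrable_bound)
  show "integrable M (\<lambda>x. (norm (f x))\<^sup>2 + (norm (g x))\<^sup>2)" using assms by simp
  show "AE x in M. norm (f x * g x) \<le> norm ((norm (f x))\<^sup>2 + (norm (g x))\<^sup>2)"
  proof (rule AE_I2)
    fix x
    have "norm (f x * g x) \<le> norm (f x) * norm (g x)" by (rule norm_mult_ineq)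
    also have "\<dots> \<le> (norm (f x))\<^sup>2 + (norm (g x))\<^sup>2"
      using sum_squares_bound[of "norm (f x)" "norm (g x)"] by (simp add: mult.assoc)
        (smt (verit) norm_ge_zero mult_nonneg_nonneg)
    finally show "norm (f x * g x) \<le> norm ((norm (f x))\<^sup>2 + (norm (g x))\<^sup>2)" by simp
  qed
qed (use assms in simp)

text \<open>The right side uses extended integrals so as to apply to the L^2 distance in
  \<open>is_L2_fourier\<close> without prior knowledge that it is finite.\<close>

lemma Cauchy_Schwarz_LINT:
  fixes f g :: "'a \<Rightarrow> 'b::{banach, second_countable_topology, real_normed_div_algebra}"
  assumes [measurable]: "f \<in> borel_measurable M" "g \<in> borel_measurable M"
    and int: "integrable M (\<lambda>x. f x * g x)"
  shows "ennreal ((norm (LINT x|M. f x * g x))\<^sup>2)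
    \<le> (\<integral>\<^sup>+x. ennreal ((norm (f x))\<^sup>2) \<partial>M) * (\<integral>\<^sup>+x. ennreal ((norm (g x))\<^sup>2) \<partial>M)"
proof -
  have "ennreal (norm (LINT x|M. f x * g x)) \<le> (\<integral>\<^sup>+x. ennreal (norm (f x * g x)) \<partial>M)"
    by (rule integral_norm_bound_ennreal[OF int])
  also have "\<dots> = (\<integral>\<^sup>+x. ennreal (norm (f x)) * ennreal (norm (g x)) \<partial>M)"
    by (simp add: norm_mult ennreal_mult)
  finally have "(ennreal (norm (LINT x|M. f x * g x)))\<^sup>2 \<le> (\<integral>\<^sup>+x. ennreal (norm (f x)) * ennreal (norm (g x)) \<partial>M)\<^sup>2"
    by (rule power_mono) simp
  also have "\<dots> \<le> (\<integral>\<^sup>+x. (ennreal (norm (f x)))\<^sup>2 \<partial>M) * (\<integral>\<^sup>+x. (ennreal (norm (g x)))\<^sup>2 \<partial>M)"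
    by (rule Cauchy_Schwarz_nn_integral) auto
  finally show ?thesis by (simp add: ennreal_power)
qed

lemma normal_density_shift: "normal_density 0 \<sigma> (a - x) = normal_density a \<sigma> x"
  unfolding normal_density_def by (simp add: power2_commute)

lemma integrable_gaussian:
  fixes \<sigma> :: real
  assumes "\<sigma> > 0"
  shows "integrable lborel (\<lambda>\<xi>. exp (- (\<sigma>\<^sup>2 * \<xi>\<^sup>2) / 2))"
proof -
  have "(\<lambda>\<xi>. exp (- (\<sigma>\<^sup>2 * \<xi>\<^sup>2) / 2)) = (\<lambda>\<xi>. sqrt (2 * pi * (1 / \<sigma>)\<^sup>2) * normal_density 0 (1 / \<sigma>) \<xi>)"
    using assms unfolding normal_density_def by (intro ext) (simp add: power_divide field_simps)
  then show ?thesis using assms by simp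
qed

lemma integrable_truncation:
  fixes f :: "real \<Rightarrow> real"
  assumes "L2_fun f"
  shows "integrable lborel (\<lambda>x. indicator {-R..R} x * f x)"
proof (rule L2_mult_integrable)
  have "(\<lambda>x. (norm (indicator {-R..R} x :: real))\<^sup>2) = indicator {-R..R}"
    by (auto simp: indicator_def)
  then show "integrable lborel (\<lambda>x. (norm (indicator {-R..R} x :: real))\<^sup>2)"
    by (simp add: integrable_real_indicator emeasure_lborel_Icc_eq)
qed (use assms in \<open>auto simp: L2_fun_def\<close>)

text \<open>Fubini applies because the truncation of f and the Gaussian weight are both integrable;
  the inner frequency integral is \<open>gaussian_fourier\<close>.\<close>

lemma truncated_fourier_gauss:
  fixes f :: "real \<Rightarrow> real" and a :: real
  assumes f: "L2_fun f" and \<sigma>: "\<sigma> > 0"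
  defines "w \<equiv> \<lambda>\<xi>. cis (a * \<xi>) * complex_of_real (exp (- (\<sigma>\<^sup>2 * \<xi>\<^sup>2) / 2))"
  shows "integrable lborel (\<lambda>\<xi>. truncated_fourier R f \<xi> * w \<xi>)"
    and "truncated_fourier R f \<in> borel_measurable lborel"
    and "(LINT \<xi>|lborel. truncated_fourier R f \<xi> * w \<xi>) / complex_of_real (sqrt (2 * pi))
       = complex_of_real (LINT x|lborel. indicator {-R..R} x * f x * normal_density a \<sigma> x)"
proof -
  define fR where "fR = (\<lambda>x. indicator {-R..R} x * f x)"
  define c where "c = sqrt (2 * pi)"
  have c: "c > 0" "c * c = 2 * pi" by (simp_all add: c_def)
  have fRint: "integrable lborel fR" unfolding fR_def by (rule integrable_truncation[OF f])
  have [measurable]: "fR \<in> borel_measurable borel" using fRint by auto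
  have [measurable]: "w \<in> borel_measurable borel" unfolding w_def by measurable
  have nw: "norm (w \<xi>) = exp (- (\<sigma>\<^sup>2 * \<xi>\<^sup>2) / 2)" for \<xi> unfolding w_def by (simp add: norm_mult)
  have wint: "integrable lborel w"
    by (rule Bochner_Integration.integrable_bound[OF integrable_gaussian[OF \<sigma>]]) (simp_all add: nw)
  define h where "h = (\<lambda>x \<xi>. complex_of_real (fR x) * cis (- (x * \<xi>)))"
  have T: "truncated_fourier R f \<xi> = (LINT x|lborel. h x \<xi>) / c" for \<xi>
    unfolding truncated_fourier_def set_lebesgue_integral_def h_def fR_def c_def
    by (simp add: scaleR_conv_of_real mult.assoc)
  have hm [measurable]: "case_prod h \<in> borel_measurable (borel \<Otimes>\<^sub>M borel)"
    unfolding h_def by measurable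
  show Tm: "truncated_fourier R f \<in> borel_measurable lborel"
    unfolding T[abs_def] h_def by measurable
  have hi: "integrable lborel (\<lambda>x. h x \<xi>)" for \<xi>
    by (rule Bochner_Integration.integrable_bound[OF fRint]) (auto simp: h_def norm_mult)
  have Tb: "norm (truncated_fourier R f \<xi>) \<le> (LINT x|lborel. \<bar>fR x\<bar>) / c" for \<xi>
  proof -
    have "norm (LINT x|lborel. h x \<xi>) \<le> (LINT x|lborel. norm (h x \<xi>))" by (rule integral_norm_bound)
    then show ?thesis unfolding T using c by (simp add: norm_divide h_def norm_mult divide_right_mono)
  qed
  show "integrable lborel (\<lambda>\<xi>. truncated_fourier R f \<xi> * w \<xi>)"
  proof (rule Bochner_Integration.integrable_bound)
    show "integrable lborel (\<lambda>\<xi>. ((LINT x|lborel. \<bar>fR x\<bar>) / c) * norm (w \<xi>))"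
      using wint by simp
    show "AE \<xi> in lborel. norm (truncated_fourier R f \<xi> * w \<xi>)
        \<le> norm ((LINT x|lborel. \<bar>fR x\<bar>) / c * norm (w \<xi>))"
      using mult_right_mono[OF Tb norm_ge_zero[of "w _"]] c(1) by (intro AE_I2) (simp add: norm_mult)
  qed (use Tm in simp)
  have Fub: "integrable (lborel \<Otimes>\<^sub>M lborel) (\<lambda>(x, \<xi>). h x \<xi> * w \<xi>)"
  proof (rule lborel_pair.Fubini_integrable)
    have "(LINT y|lborel. norm (case (x, y) of (x, \<xi>) \<Rightarrow> h x \<xi> * w \<xi>)) = \<bar>fR x\<bar> * (LINT y|lborel. norm (w y))" for x
      by (simp add: h_def norm_mult mult.assoc)
    then show "integrable lborel (\<lambda>x. LINT y|lborel. norm (case (x, y) of (x, \<xi>) \<Rightarrow> h x \<xi> * w \<xi>))"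
      using fRint by simp
    show "AE x in lborel. integrable lborel (\<lambda>y. case (x, y) of (x, \<xi>) \<Rightarrow> h x \<xi> * w \<xi>)"
    proof (rule AE_I2)
      fix x
      show "integrable lborel (\<lambda>y. case (x, y) of (x, \<xi>) \<Rightarrow> h x \<xi> * w \<xi>)"
      proof (rule Bochner_Integration.integrable_bound)
        show "integrable lborel (\<lambda>y. \<bar>fR x\<bar> * norm (w y))" using wint by simp
      qed (auto simp: h_def norm_mult)
    qed
  qed simp
  have "(LINT \<xi>|lborel. truncated_fourier R f \<xi> * w \<xi>) = (LINT \<xi>|lborel. (LINT x|lborel. h x \<xi> * w \<xi>)) / c"
    unfolding T using hi by simp
  also have "(LINT \<xi>|lborel. (LINT x|lborel. h x \<xi> * w \<xi>)) = (LINT x|lborel. (LINT \<xi>|lborel. h x \<xi> * w \<xi>))"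
    by (rule lborel_pair.Fubini_integral[OF Fub])
  also have "(\<lambda>x. LINT \<xi>|lborel. h x \<xi> * w \<xi>) = (\<lambda>x. complex_of_real (2 * pi * (fR x * normal_density a \<sigma> x)))"
  proof
    fix x
    have "h x \<xi> * w \<xi> = complex_of_real (fR x) * (cis ((a - x) * \<xi>) * complex_of_real (exp (- (\<sigma>\<^sup>2 * \<xi>\<^sup>2) / 2)))" for \<xi>
    proof -
      have "cis (- (x * \<xi>)) * cis (a * \<xi>) = cis ((a - x) * \<xi>)" by (simp add: cis_mult algebra_simps)
      then show ?thesis unfolding h_def w_def by (metis (no_types, lifting) mult.assoc)
    qed
    then show "(LINT \<xi>|lborel. h x \<xi> * w \<xi>) = complex_of_real (2 * pi * (fR x * normal_density a \<sigma> x))"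
      by (simp only: integral_mult_right_zero gaussian_fourier[OF \<sigma>] normal_density_shift)
        (simp add: mult_ac)
  qed
  also have "(LINT x|lborel. complex_of_real (2 * pi * (fR x * normal_density a \<sigma> x)))
     = complex_of_real (c * c * (LINT x|lborel. fR x * normal_density a \<sigma> x))"
    unfolding integral_complex_of_real c by simp
  finally show "(LINT \<xi>|lborel. truncated_fourier R f \<xi> * w \<xi>) / complex_of_real (sqrt (2 * pi))
       = complex_of_real (LINT x|lborel. indicator {-R..R} x * f x * normal_density a \<sigma> x)"
    unfolding c_def[symmetric] using c(1) by (simp add: fR_def)
qed

lemma normal_density_le: "normal_density a \<sigma> x \<le> 1 / sqrt (2 * pi * \<sigma>\<^sup>2)"
  unfolding normal_density_def by (intro mult_left_le) auto

text \<open>The truncation is removed on both sides: by dominated convergence on the left, and on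
  the right by testing the L^2 convergence of the transforms against the square integrable weight
  w.\<close>

lemma L2_fourier_gauss:
  assumes F: "is_L2_fourier f g" and \<sigma>: "\<sigma> > 0"
  shows "integrable lborel (\<lambda>x. f x * normal_density a \<sigma> x)"
    and "complex_of_real (LINT x|lborel. f x * normal_density a \<sigma> x)
     = (LINT \<xi>|lborel. g \<xi> * (cis (a * \<xi>) * complex_of_real (exp (- (\<sigma>\<^sup>2 * \<xi>\<^sup>2) / 2)))) / complex_of_real (sqrt (2 * pi))"
proof -
  have f: "L2_fun f" and g: "L2_fun g"
    and lim: "((\<lambda>R. \<integral>\<^sup>+\<xi>. ennreal ((cmod (truncated_fourier R f \<xi> - g \<xi>))\<^sup>2) \<partial>lborel) \<longlongrightarrow> 0) at_top"
    using F by (auto simp: is_L2_fourier_def)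
  define w where "w = (\<lambda>\<xi>. cis (a * \<xi>) * complex_of_real (exp (- (\<sigma>\<^sup>2 * \<xi>\<^sup>2) / 2)))"
  have [measurable]: "w \<in> borel_measurable borel" "f \<in> borel_measurable borel" "g \<in> borel_measurable borel"
    using f g by (auto simp: L2_fun_def w_def)
  have w: "cis (a * \<xi>) * complex_of_real (exp (- (\<sigma>\<^sup>2 * \<xi>\<^sup>2) / 2)) = w \<xi>" for \<xi>
    by (simp add: w_def)
  note T = truncated_fourier_gauss(1)[OF f \<sigma>, where a=a, unfolded w]
    truncated_fourier_gauss(2)[OF f \<sigma>]
    truncated_fourier_gauss(3)[OF f \<sigma>, where a=a, unfolded w]
  have nw: "norm (w \<xi>) = exp (- (\<sigma>\<^sup>2 * \<xi>\<^sup>2) / 2)" for \<xi> unfolding w_def by (simp add: norm_mult)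
  have w2: "integrable lborel (\<lambda>\<xi>. (norm (w \<xi>))\<^sup>2)"
  proof (rule Bochner_Integration.integrable_bound[OF integrable_gaussian[OF \<sigma>]])
    show "AE \<xi> in lborel. norm ((norm (w \<xi>))\<^sup>2) \<le> norm (exp (- (\<sigma>\<^sup>2 * \<xi>\<^sup>2) / 2))"
      by (rule AE_I2) (auto simp: nw power2_eq_square mult_left_le)
  qed simp
  have gw: "integrable lborel (\<lambda>\<xi>. g \<xi> * w \<xi>)"
    by (rule L2_mult_integrable) (use g w2 in \<open>auto simp: L2_fun_def\<close>)
  have N2: "integrable lborel (\<lambda>x. (norm (normal_density a \<sigma> x))\<^sup>2)"
  proof (rule Bochner_Integration.integrable_bound)
    show "integrable lborel (\<lambda>x. 1 / sqrt (2 * pi * \<sigma>\<^sup>2) * normal_density a \<sigma> x)" using \<sigma> by simp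
    show "AE x in lborel. norm ((norm (normal_density a \<sigma> x))\<^sup>2) \<le> norm (1 / sqrt (2 * pi * \<sigma>\<^sup>2) * normal_density a \<sigma> x)"
      using mult_right_mono[OF normal_density_le normal_density_nonneg, of a \<sigma> _ a \<sigma>]
      by (intro AE_I2) (simp add: power2_eq_square)
  qed simp
  show fN: "integrable lborel (\<lambda>x. f x * normal_density a \<sigma> x)"
    by (rule L2_mult_integrable) (use f N2 in \<open>auto simp: L2_fun_def\<close>)
  have L1: "(\<lambda>n. LINT x|lborel. indicator {- real n..real n} x * f x * normal_density a \<sigma> x)
      \<longlonglongrightarrow> (LINT x|lborel. f x * normal_density a \<sigma> x)"
  proof (rule integral_dominated_convergence)
    show "integrable lborel (\<lambda>x. norm (f x * normal_density a \<sigma> x))" using fN by (rule integrable_norm)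
    show "AE x in lborel. (\<lambda>n. indicator {- real n..real n} x * f x * normal_density a \<sigma> x) \<longlonglongrightarrow> f x * normal_density a \<sigma> x"
    proof (intro AE_I2 tendsto_eventually)
      fix x
      show "\<forall>\<^sub>F n in sequentially. indicator {- real n..real n} x * f x * normal_density a \<sigma> x = f x * normal_density a \<sigma> x"
        using eventually_ge_at_top[of "nat \<lceil>\<bar>x\<bar>\<rceil>"]
        by eventually_elim (simp add: indicator_def, linarith)
    qed
    show "AE x in lborel. norm (indicator {- real n..real n} x * f x * normal_density a \<sigma> x) \<le> norm (f x * normal_density a \<sigma> x)" for n
      by (rule AE_I2) (auto simp: indicator_def)
  qed auto
  have CS: "ennreal ((cmod ((LINT \<xi>|lborel. truncated_fourier R f \<xi> * w \<xi>) - (LINT \<xi>|lborel. g \<xi> * w \<xi>)))\<^sup>2)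
     \<le> (\<integral>\<^sup>+\<xi>. ennreal ((cmod (truncated_fourier R f \<xi> - g \<xi>))\<^sup>2) \<partial>lborel) * (\<integral>\<^sup>+\<xi>. ennreal ((cmod (w \<xi>))\<^sup>2) \<partial>lborel)" for R
  proof -
    have "integrable lborel (\<lambda>\<xi>. (truncated_fourier R f \<xi> - g \<xi>) * w \<xi>)"
      using Bochner_Integration.integrable_diff[OF T(1) gw] by (simp add: left_diff_distrib)
    from Cauchy_Schwarz_LINT[OF _ _ this] T(2) show ?thesis
      using T(1) gw by (simp add: left_diff_distrib)
  qed
  have "(\<integral>\<^sup>+\<xi>. ennreal ((cmod (w \<xi>))\<^sup>2) \<partial>lborel) = ennreal (LINT \<xi>|lborel. (cmod (w \<xi>))\<^sup>2)"
    by (rule nn_integral_eq_integral[OF w2]) simp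
  then have "((\<lambda>R. (\<integral>\<^sup>+\<xi>. ennreal ((cmod (truncated_fourier R f \<xi> - g \<xi>))\<^sup>2) \<partial>lborel) * (\<integral>\<^sup>+\<xi>. ennreal ((cmod (w \<xi>))\<^sup>2) \<partial>lborel)) \<longlongrightarrow> 0 * (\<integral>\<^sup>+\<xi>. ennreal ((cmod (w \<xi>))\<^sup>2) \<partial>lborel)) at_top"
    by (intro tendsto_mult_ennreal lim tendsto_const) auto
  then have "((\<lambda>R. ennreal ((cmod ((LINT \<xi>|lborel. truncated_fourier R f \<xi> * w \<xi>) - (LINT \<xi>|lborel. g \<xi> * w \<xi>)))\<^sup>2)) \<longlongrightarrow> 0) at_top"
    by (intro tendsto_sandwich[OF _ always_eventually[OF allI[OF CS]] tendsto_const, of "0"]) (auto intro!: always_eventually)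
  then have "((\<lambda>R. (cmod ((LINT \<xi>|lborel. truncated_fourier R f \<xi> * w \<xi>) - (LINT \<xi>|lborel. g \<xi> * w \<xi>)))\<^sup>2) \<longlongrightarrow> 0) at_top"
    by (subst (asm) ennreal_0[symmetric], subst (asm) tendsto_ennreal_iff) auto
  from tendsto_real_sqrt[OF this]
  have "((\<lambda>R. (LINT \<xi>|lborel. truncated_fourier R f \<xi> * w \<xi>) - (LINT \<xi>|lborel. g \<xi> * w \<xi>)) \<longlongrightarrow> 0) at_top"
    by (subst tendsto_norm_zero_iff[symmetric]) simp
  then have "((\<lambda>R. LINT \<xi>|lborel. truncated_fourier R f \<xi> * w \<xi>) \<longlongrightarrow> (LINT \<xi>|lborel. g \<xi> * w \<xi>)) at_top"
    by (rule LIM_zero_cancel)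
  then have "(\<lambda>n. (LINT \<xi>|lborel. truncated_fourier (real n) f \<xi> * w \<xi>) / complex_of_real (sqrt (2 * pi)))
      \<longlonglongrightarrow> (LINT \<xi>|lborel. g \<xi> * w \<xi>) / complex_of_real (sqrt (2 * pi))"
    by (intro tendsto_divide tendsto_const) (auto intro: filterlim_compose[OF _ filterlim_real_sequentially])
  then have "(\<lambda>n. complex_of_real (LINT x|lborel. indicator {- real n..real n} x * f x * normal_density a \<sigma> x))
      \<longlonglongrightarrow> (LINT \<xi>|lborel. g \<xi> * w \<xi>) / complex_of_real (sqrt (2 * pi))"
    unfolding T(3) .
  then show "complex_of_real (LINT x|lborel. f x * normal_density a \<sigma> x)
     = (LINT \<xi>|lborel. g \<xi> * (cis (a * \<xi>) * complex_of_real (exp (- (\<sigma>\<^sup>2 * \<xi>\<^sup>2) / 2)))) / complex_of_real (sqrt (2 * pi))"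
    unfolding w using tendsto_of_real[OF L1] by (rule LIMSEQ_unique[rotated])
qed

text \<open>The threshold 1/2 is that of the one-dimensional Sobolev embedding. Off [-1, 1] the
  majorant is |x|^(-2p), with 2p > 1.\<close>

lemma integrable_powr_decay:
  assumes p: "p > 1 / 2"
  shows "integrable lborel (\<lambda>x::real. (1 + x\<^sup>2) powr (- p))"
proof -
  define k where "k = (\<lambda>x::real. x powr (- 2 * p) * indicator {1..} x)"
  have "(\<integral>\<^sup>+x. ennreal (x powr (- 2 * p)) * indicator {1..} x \<partial>lborel)
     = ennreal (0 - 1 powr (1 - 2 * p) / (1 - 2 * p))"
  proof (rule nn_integral_FTC_atLeast[where F="\<lambda>x. x powr (1 - 2 * p) / (1 - 2 * p)"])
    show "((\<lambda>x. x powr (1 - 2 * p) / (1 - 2 * p)) has_real_derivative x powr (- 2 * p)) (at x)" if "1 \<le> x" for x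
      using that p by (auto intro!: derivative_eq_intros)
    have "((\<lambda>x. x powr (1 - 2 * p)) \<longlongrightarrow> 0) at_top"
      using p by (intro tendsto_neg_powr filterlim_ident) auto
    from tendsto_divide[OF this tendsto_const[of "1 - 2 * p"]] p
    show "((\<lambda>x. x powr (1 - 2 * p) / (1 - 2 * p)) \<longlongrightarrow> 0) at_top" by simp
  qed auto
  moreover have "(\<integral>\<^sup>+x. ennreal (norm (k x)) \<partial>lborel) = (\<integral>\<^sup>+x. ennreal (x powr (- 2 * p)) * indicator {1..} x \<partial>lborel)"
    by (intro nn_integral_cong) (simp add: k_def indicator_def)
  ultimately have k: "integrable lborel k"
    by (intro integrableI_bounded) (auto simp: k_def)
  have k': "integrable lborel (\<lambda>x. k (- x))"
    using lborel_integrable_real_affine[OF k, of "-1" 0] by simp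
  show ?thesis
  proof (rule Bochner_Integration.integrable_bound)
    show "integrable lborel (\<lambda>x. indicator {-1..1} x + k x + k (- x) :: real)"
      using k k' by (intro Bochner_Integration.integrable_add integrable_real_indicator) auto
    have b: "(1 + x\<^sup>2) powr (- p) \<le> \<bar>x\<bar> powr (- 2 * p)" if "\<bar>x\<bar> \<ge> 1" for x :: real
    proof -
      have "\<bar>x\<bar> powr (- 2 * p) = (\<bar>x\<bar> powr 2) powr (- p)" by (simp only: powr_powr) simp
      also have "\<bar>x\<bar> powr 2 = x\<^sup>2" using that powr_numeral[of "\<bar>x\<bar>" "num.Bit0 num.One"] by simp
      finally show ?thesis using p that by (auto intro!: powr_mono2')
    qed
    have c: "(1 + x\<^sup>2) powr (- p) \<le> 1" for x :: real
      using powr_mono2'[of "- p" 1 "1 + x\<^sup>2"] p by simp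
    show "AE x in lborel. norm ((1 + x\<^sup>2) powr (- p)) \<le> norm (indicator {-1..1} x + k x + k (- x) :: real)"
    proof (rule AE_I2)
      fix x :: real
      show "norm ((1 + x\<^sup>2) powr (- p)) \<le> norm (indicator {-1..1} x + k x + k (- x) :: real)"
        using b[of x] c[of x] by (cases "\<bar>x\<bar> \<le> 1") (auto simp: k_def indicator_def abs_if split: if_splits)
    qed
  qed simp
qed

lemma integrable_inverse_1_plus_square: "integrable lborel (\<lambda>x::real. 1 / (1 + x\<^sup>2))"
proof -
  have "(1 + x\<^sup>2) powr (- 1) = 1 / (1 + x\<^sup>2)" for x :: real
    by (simp add: powr_minus_divide add_pos_nonneg)
  then show ?thesis using integrable_powr_decay[of 1] by simp
qed

lemma normal_density_affine:
  assumes "\<sigma> > 0"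
  shows "normal_density (x + \<sigma> * y) \<sigma> x = std_normal_density y / \<sigma>"
  using assms unfolding normal_density_def
  by (simp add: real_sqrt_mult power_mult_distrib)

text \<open>The decay survives averaging with a constant independent of \<sigma>: for z = x +
  \<sigma> y and \<sigma> \<le> 1 one has 1 + x^2 \<le> 2 (1 + y^2) (1 + z^2), and 1 + y^2 has
  Gaussian mean 2. This gives the factor 4 and a majorant for all \<sigma> at once.\<close>

lemma gaussian_average:
  fixes \<psi> :: "real \<Rightarrow> real"
  assumes [measurable]: "\<psi> \<in> borel_measurable borel"
    and \<psi>: "\<And>a. \<bar>\<psi> a\<bar> \<le> K / (1 + a\<^sup>2)" and \<sigma>: "0 < \<sigma>" "\<sigma> \<le> 1"
  shows "integrable lborel (\<lambda>a. \<psi> a * normal_density a \<sigma> x)"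
    and "(LINT a|lborel. \<psi> a * normal_density a \<sigma> x) = (LINT y|lborel. \<psi> (x + \<sigma> * y) * std_normal_density y)"
    and "(LINT a|lborel. \<bar>\<psi> a\<bar> * normal_density a \<sigma> x) \<le> 4 * K / (1 + x\<^sup>2)"
proof -
  have K: "K \<ge> 0" using \<psi>[of 0] by simp
  define B where "B = (\<lambda>y. (2 * K / (1 + x\<^sup>2)) * (std_normal_density y * y ^ 0 + std_normal_density y * y\<^sup>2))"
  have Bi: "integrable lborel B"
    unfolding B_def by (intro integrable_mult_right Bochner_Integration.integrable_add integrable_std_normal_moment)
  have BI: "(LINT y|lborel. B y) = 4 * K / (1 + x\<^sup>2)"
    unfolding B_def
    using integral_std_normal_moment_even[of 0] integral_std_normal_moment_even[of 1]
    by (simp add: integrable_std_normal_moment integrable_std_normal_moment[of 0, simplified] fact_numeral)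
  have b: "\<bar>\<psi> (x + \<sigma> * y)\<bar> * std_normal_density y \<le> B y" for y
  proof -
    define z where "z = x + \<sigma> * y"
    have pos: "1 + z\<^sup>2 > 0" "1 + x\<^sup>2 > 0" by (simp_all add: add_pos_nonneg)
    have "x\<^sup>2 \<le> 2 * z\<^sup>2 + 2 * (\<sigma> * y)\<^sup>2"
      using sum_squares_ge_zero[of "z + \<sigma> * y" 0] by (simp add: z_def power2_eq_square algebra_simps)
    moreover have "(\<sigma> * y)\<^sup>2 \<le> y\<^sup>2"
      using \<sigma> by (simp add: power_mult_distrib mult_left_le_one_le power_le_one)
    moreover have "2 * (1 + y\<^sup>2) * (1 + z\<^sup>2) = 2 + 2 * y\<^sup>2 + 2 * z\<^sup>2 + 2 * (y\<^sup>2 * z\<^sup>2)"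
      by (simp add: algebra_simps)
    moreover have "y\<^sup>2 * z\<^sup>2 \<ge> 0" by simp
    ultimately have "1 + x\<^sup>2 \<le> 2 * (1 + y\<^sup>2) * (1 + z\<^sup>2)" by linarith
    then have "1 / (1 + z\<^sup>2) \<le> 2 * (1 + y\<^sup>2) / (1 + x\<^sup>2)"
      using pos by (simp add: field_simps)
    from mult_left_mono[OF this K] \<psi>[of z]
    have "\<bar>\<psi> z\<bar> \<le> (2 * K / (1 + x\<^sup>2)) * (1 + y\<^sup>2)" by (simp add: mult_ac)
    from mult_right_mono[OF this normal_density_nonneg[of 0 1 y]]
    show ?thesis by (simp add: B_def z_def algebra_simps add_divide_distrib)
  qed
  have aff: "\<psi> (x + \<sigma> * y) * normal_density (x + \<sigma> * y) \<sigma> x = \<psi> (x + \<sigma> * y) * std_normal_density y / \<sigma>" for y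
    by (simp add: normal_density_affine[OF \<sigma>(1)])
  have i: "integrable lborel (\<lambda>y. \<psi> (x + \<sigma> * y) * std_normal_density y)"
    by (rule Bochner_Integration.integrable_bound[OF Bi])
      (use b in \<open>auto simp: abs_mult intro!: AE_I2 order_trans[OF b abs_ge_self]\<close>)
  then have "integrable lborel (\<lambda>y. \<psi> (x + \<sigma> * y) * std_normal_density y / \<sigma>)" by simp
  then show int: "integrable lborel (\<lambda>a. \<psi> a * normal_density a \<sigma> x)"
    using lborel_integrable_real_affine_iff[of \<sigma> "\<lambda>a. \<psi> a * normal_density a \<sigma> x" x] \<sigma>
    by (simp only: aff)
  show "(LINT a|lborel. \<psi> a * normal_density a \<sigma> x) = (LINT y|lborel. \<psi> (x + \<sigma> * y) * std_normal_density y)"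
    using lborel_integral_real_affine[of \<sigma> "\<lambda>a. \<psi> a * normal_density a \<sigma> x" x] \<sigma> by (simp add: aff)
  have "(LINT a|lborel. \<bar>\<psi> a\<bar> * normal_density a \<sigma> x) = (LINT y|lborel. \<bar>\<psi> (x + \<sigma> * y)\<bar> * std_normal_density y)"
    using lborel_integral_real_affine[of \<sigma> "\<lambda>a. \<bar>\<psi> a\<bar> * normal_density a \<sigma> x" x] \<sigma>
    by (simp add: normal_density_affine[OF \<sigma>(1)])
  also have "\<dots> \<le> (LINT y|lborel. B y)"
  proof (rule integral_mono[OF _ Bi b])
    show "integrable lborel (\<lambda>y. \<bar>\<psi> (x + \<sigma> * y)\<bar> * std_normal_density y)"
      using integrable_abs[OF i] by (simp add: abs_mult)
  qed
  finally show "(LINT a|lborel. \<bar>\<psi> a\<bar> * normal_density a \<sigma> x) \<le> 4 * K / (1 + x\<^sup>2)"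
    unfolding BI .
qed

lemma inverse_1_plus_square_L2: "integrable lborel (\<lambda>x::real. (norm (1 / (1 + x\<^sup>2)))\<^sup>2)"
proof (rule Bochner_Integration.integrable_bound[OF integrable_inverse_1_plus_square])
  have "(1 / (1 + x\<^sup>2))\<^sup>2 \<le> 1 / (1 + x\<^sup>2)" for x :: real
  proof -
    have "1 / (1 + x\<^sup>2) \<le> 1" "1 / (1 + x\<^sup>2) \<ge> 0" by (simp_all add: divide_le_eq_1 add_pos_nonneg)
    then show ?thesis unfolding power2_eq_square[of "1 / (1 + x\<^sup>2)"] by (rule mult_left_le)
  qed
  then show "AE x::real in lborel. norm ((norm (1 / (1 + x\<^sup>2)))\<^sup>2) \<le> norm (1 / (1 + x\<^sup>2))"
    by (intro AE_I2) simp
qed simp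

lemma compact_support_decay:
  fixes \<psi> :: "real \<Rightarrow> real"
  assumes c: "continuous_on UNIV \<psi>" and 0: "\<And>x. x \<notin> {a..b} \<Longrightarrow> \<psi> x = 0"
  obtains K where "\<And>x. \<bar>\<psi> x\<bar> \<le> K / (1 + x\<^sup>2)"
proof -
  have "continuous_on {a..b} (\<lambda>x. \<psi> x * (1 + x\<^sup>2))"
    by (intro continuous_intros continuous_on_subset[OF c]) auto
  then have "bounded ((\<lambda>x. \<psi> x * (1 + x\<^sup>2)) ` {a..b})"
    by (intro compact_imp_bounded compact_continuous_image) auto
  then obtain K where K: "\<forall>x\<in>{a..b}. \<bar>\<psi> x * (1 + x\<^sup>2)\<bar> \<le> K"
    unfolding bounded_real by auto
  have "\<bar>\<psi> x\<bar> \<le> \<bar>K\<bar> / (1 + x\<^sup>2)" for x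
  proof (cases "x \<in> {a..b}")
    case True
    have "1 + x\<^sup>2 > 0" by (simp add: add_pos_nonneg)
    then show ?thesis using bspec[OF K True] by (simp add: abs_mult pos_le_divide_eq)
  next
    case False
    then show ?thesis using 0 by (simp add: add_nonneg_nonneg)
  qed
  then show thesis by (rule that)
qed

text \<open>Gaussian averages of \<psi> are moved onto f by Fubini, where
  \<open>L2_fourier_gauss\<close> evaluates them; then \<sigma> tends to 0, with |g| as majorant on
  the frequency side. Pairings are compared because f may be an arbitrary representative of its
  class.\<close>

lemma L2_fourier_pairing:
  fixes \<psi> :: "real \<Rightarrow> real"
  assumes F: "is_L2_fourier f g" and g: "integrable lborel g"
    and \<psi>c: "continuous_on UNIV \<psi>" and \<psi>0: "\<And>x. x \<notin> {a..b} \<Longrightarrow> \<psi> x = 0"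
  shows "(LINT x|lborel. f x * \<psi> x) = (LINT x|lborel. Re (inv_fourier g x) * \<psi> x)"
proof -
  have f: "L2_fun f" using F by (auto simp: is_L2_fourier_def)
  have [measurable]: "f \<in> borel_measurable borel" "g \<in> borel_measurable borel" "\<psi> \<in> borel_measurable borel"
    using f g \<psi>c by (auto simp: L2_fun_def intro: borel_measurable_continuous_onI)
  obtain K where K: "\<And>x. \<bar>\<psi> x\<bar> \<le> K / (1 + x\<^sup>2)" using compact_support_decay[OF \<psi>c \<psi>0] by blast
  have K0: "K \<ge> 0" using K[of 0] by simp
  have \<psi>K: "\<bar>\<psi> x\<bar> \<le> K" for x
  proof -
    have "K / (1 + x\<^sup>2) \<le> K / 1" using K0 by (intro divide_left_mono) (auto simp: add_pos_nonneg)
    then show ?thesis using K[of x] by simp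
  qed
  define \<sigma> where "\<sigma> = (\<lambda>n. 1 / real (Suc n))"
  have \<sigma>: "0 < \<sigma> n" "\<sigma> n \<le> 1" for n by (auto simp: \<sigma>_def)
  have \<sigma>0: "\<sigma> \<longlonglongrightarrow> 0" unfolding \<sigma>_def using LIMSEQ_inverse_real_of_nat by (simp add: inverse_eq_divide)
  have \<psi>m: "\<psi> \<in> borel_measurable borel" by simp
  note avg = gaussian_average[OF \<psi>m K \<sigma>]
  define P where "P = (\<lambda>n x. LINT a|lborel. \<psi> a * normal_density a (\<sigma> n) x)"
  have nm [measurable]: "(\<lambda>p. normal_density (fst p) s (snd p)) \<in> borel_measurable (borel \<Otimes>\<^sub>M borel)"
    "(\<lambda>p. normal_density (snd p) s (fst p)) \<in> borel_measurable (borel \<Otimes>\<^sub>M borel)"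
    "(\<lambda>a. normal_density a s x) \<in> borel_measurable borel" for s x
    unfolding normal_density_def by measurable
  have Pm [measurable]: "P n \<in> borel_measurable borel" for n
    unfolding P_def normal_density_def by measurable
  have Pb: "\<bar>P n x\<bar> \<le> 4 * K / (1 + x\<^sup>2)" for n x
  proof -
    have "\<bar>P n x\<bar> \<le> (LINT a|lborel. norm (\<psi> a * normal_density a (\<sigma> n) x))"
      unfolding P_def using integral_norm_bound[of lborel "\<lambda>a. \<psi> a * normal_density a (\<sigma> n) x"] by simp
    also have "\<dots> \<le> 4 * K / (1 + x\<^sup>2)" using avg(3)[of n x] by (simp add: abs_mult)
    finally show ?thesis .
  qed
  have Plim: "(\<lambda>n. P n x) \<longlonglongrightarrow> \<psi> x" for x
  proof -
    have "(\<lambda>n. LINT y|lborel. \<psi> (x + \<sigma> n * y) * std_normal_density y) \<longlonglongrightarrow> (LINT y|lborel. \<psi> x * std_normal_density y)"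
    proof (rule integral_dominated_convergence)
      show "integrable lborel (\<lambda>y. K * std_normal_density y)" by simp
      show "AE y in lborel. (\<lambda>n. \<psi> (x + \<sigma> n * y) * std_normal_density y) \<longlonglongrightarrow> \<psi> x * std_normal_density y"
      proof (intro AE_I2 tendsto_mult tendsto_const)
        fix y
        have "(\<lambda>n. x + \<sigma> n * y) \<longlonglongrightarrow> x + 0 * y" by (intro tendsto_intros \<sigma>0)
        then have "(\<lambda>n. x + \<sigma> n * y) \<longlonglongrightarrow> x" by simp
        then show "(\<lambda>n. \<psi> (x + \<sigma> n * y)) \<longlonglongrightarrow> \<psi> x"
          by (intro continuous_on_tendsto_compose[OF \<psi>c]) auto
      qed
      show "AE y in lborel. norm (\<psi> (x + \<sigma> n * y) * std_normal_density y) \<le> K * std_normal_density y" for n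
        using \<psi>K by (intro AE_I2) (simp add: abs_mult mult_right_mono)
    qed auto
    then show ?thesis unfolding P_def using avg(2) by simp
  qed
  have fd: "integrable lborel (\<lambda>x. f x * (1 / (1 + x\<^sup>2)))"
    by (rule L2_mult_integrable) (use f inverse_1_plus_square_L2 in \<open>auto simp: L2_fun_def\<close>)
  have fd': "integrable lborel (\<lambda>x. \<bar>f x\<bar> * (4 * K / (1 + x\<^sup>2)))"
    using integrable_mult_right[OF integrable_abs[OF fd], of "4 * K"]
    by (simp add: abs_mult mult_ac add_nonneg_nonneg)
  have lim1: "(\<lambda>n. LINT x|lborel. f x * P n x) \<longlonglongrightarrow> (LINT x|lborel. f x * \<psi> x)"
  proof (rule integral_dominated_convergence[OF _ _ fd'])
    show "AE x in lborel. (\<lambda>n. f x * P n x) \<longlonglongrightarrow> f x * \<psi> x"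
      by (intro AE_I2 tendsto_mult tendsto_const Plim)
    show "AE x in lborel. norm (f x * P n x) \<le> \<bar>f x\<bar> * (4 * K / (1 + x\<^sup>2))" for n
      by (intro AE_I2) (simp only: real_norm_def abs_mult, intro mult_left_mono Pb, simp)
  qed auto
  \<comment> \<open>The Fubini majorant |f x| 4 K / (1 + x^2) is integrable as a product of square
    integrable functions.\<close>
  have swap: "(LINT x|lborel. f x * P n x) = (LINT a|lborel. \<psi> a * (LINT x|lborel. f x * normal_density a (\<sigma> n) x))" for n
  proof -
    define h where "h = (\<lambda>x a. f x * (\<psi> a * normal_density a (\<sigma> n) x))"
    have hm: "case_prod h \<in> borel_measurable (lborel \<Otimes>\<^sub>M lborel)"
      unfolding h_def normal_density_def by measurable
    have hi: "integrable lborel (\<lambda>a. h x a)" for x unfolding h_def using avg(1)[of n x] by simp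
    have hb: "(LINT a|lborel. norm (h x a)) = \<bar>f x\<bar> * (LINT a|lborel. \<bar>\<psi> a\<bar> * normal_density a (\<sigma> n) x)" for x
      by (simp add: h_def abs_mult)
    have "integrable (lborel \<Otimes>\<^sub>M lborel) (case_prod h)"
    proof (rule lborel_pair.Fubini_integrable[OF hm])
      show "integrable lborel (\<lambda>x. LINT a|lborel. norm (case_prod h (x, a)))"
      proof (rule Bochner_Integration.integrable_bound[OF fd'])
        show "(\<lambda>x. LINT a|lborel. norm (case_prod h (x, a))) \<in> borel_measurable lborel"
          using hm by measurable
        show "AE x in lborel. norm (LINT a|lborel. norm (case_prod h (x, a))) \<le> norm (\<bar>f x\<bar> * (4 * K / (1 + x\<^sup>2)))"
        proof (rule AE_I2)
          fix x
          have nn: "(LINT a|lborel. \<bar>\<psi> a\<bar> * normal_density a (\<sigma> n) x) \<ge> 0" by simp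
          have e: "(LINT a|lborel. norm (case_prod h (x, a))) = \<bar>f x\<bar> * (LINT a|lborel. \<bar>\<psi> a\<bar> * normal_density a (\<sigma> n) x)"
            using hb by simp
          show "norm (LINT a|lborel. norm (case_prod h (x, a))) \<le> norm (\<bar>f x\<bar> * (4 * K / (1 + x\<^sup>2)))"
            using mult_left_mono[OF avg(3)[of n x] abs_ge_zero[of "f x"]] mult_nonneg_nonneg[OF abs_ge_zero nn, of "f x"]
            unfolding e unfolding real_norm_def by linarith
        qed
      qed
      show "AE x in lborel. integrable lborel (\<lambda>y. case_prod h (x, y))" using hi by simp
    qed
    from lborel_pair.Fubini_integral[OF this]
    have "(LINT a|lborel. LINT x|lborel. h x a) = (LINT x|lborel. LINT a|lborel. h x a)" .
    moreover have "(LINT x|lborel. h x a) = \<psi> a * (LINT x|lborel. f x * normal_density a (\<sigma> n) x)" for a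
      unfolding h_def by (simp add: mult.left_commute)
    moreover have "(LINT a|lborel. h x a) = f x * P n x" for x unfolding h_def P_def by simp
    ultimately show ?thesis by simp
  qed
  define w where "w = (\<lambda>n a \<xi>. g \<xi> * (cis (a * \<xi>) * complex_of_real (exp (- ((\<sigma> n)\<^sup>2 * \<xi>\<^sup>2) / 2))))"
  define E where "E = (\<lambda>n a. LINT x|lborel. f x * normal_density a (\<sigma> n) x)"
  have E: "complex_of_real (E n a) = (LINT \<xi>|lborel. w n a \<xi>) / complex_of_real (sqrt (2 * pi))" for n a
    unfolding E_def w_def by (rule L2_fourier_gauss(2)[OF F \<sigma>(1)])
  have wb: "norm (w n a \<xi>) \<le> norm (g \<xi>)" for n a \<xi>
    unfolding w_def norm_mult by (simp add: mult_left_le)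
  have wm [measurable]: "w n a \<in> borel_measurable borel" for n a unfolding w_def by measurable
  have "(\<lambda>n. LINT \<xi>|lborel. w n a \<xi>) \<longlonglongrightarrow> (LINT \<xi>|lborel. g \<xi> * cis (a * \<xi>))" for a
  proof (rule integral_dominated_convergence)
    show "integrable lborel (\<lambda>\<xi>. norm (g \<xi>))" using g by simp
    show "AE \<xi> in lborel. (\<lambda>n. w n a \<xi>) \<longlonglongrightarrow> g \<xi> * cis (a * \<xi>)"
    proof (rule AE_I2)
      fix \<xi>
      have "(\<lambda>n. w n a \<xi>) \<longlonglongrightarrow> g \<xi> * (cis (a * \<xi>) * complex_of_real (exp (- (0\<^sup>2 * \<xi>\<^sup>2) / 2)))"
        unfolding w_def by (intro tendsto_intros \<sigma>0) auto
      then show "(\<lambda>n. w n a \<xi>) \<longlonglongrightarrow> g \<xi> * cis (a * \<xi>)" by simp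
    qed
  qed (use wb in auto)
  then have "(\<lambda>n. complex_of_real (E n a)) \<longlonglongrightarrow> inv_fourier g a" for a
    unfolding E inv_fourier_def by (intro tendsto_divide tendsto_const) auto
  from tendsto_Re[OF this] have Elim: "(\<lambda>n. E n a) \<longlonglongrightarrow> Re (inv_fourier g a)" for a by simp
  have Eb: "\<bar>E n a\<bar> \<le> (LINT \<xi>|lborel. norm (g \<xi>))" for n a
  proof -
    have "\<bar>E n a\<bar> = norm (complex_of_real (E n a))" by simp
    also have "\<dots> = norm (LINT \<xi>|lborel. w n a \<xi>) / sqrt (2 * pi)" unfolding E by (simp add: norm_divide)
    also have "\<dots> \<le> norm (LINT \<xi>|lborel. w n a \<xi>) / 1"
      using pi_ge_two by (intro divide_left_mono) auto
    also have "\<dots> \<le> (LINT \<xi>|lborel. norm (w n a \<xi>))" using integral_norm_bound by simp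
    also have "\<dots> \<le> (LINT \<xi>|lborel. norm (g \<xi>))"
      using g wb by (intro integral_mono integrable_norm Bochner_Integration.integrable_bound[OF g]) auto
    finally show ?thesis .
  qed
  have Em [measurable]: "E n \<in> borel_measurable borel" for n
    unfolding E_def normal_density_def by measurable
  have im [measurable]: "(\<lambda>a. Re (inv_fourier g a)) \<in> borel_measurable borel"
    unfolding inv_fourier_def by measurable
  have "(\<lambda>n. LINT a|lborel. \<psi> a * E n a) \<longlonglongrightarrow> (LINT a|lborel. \<psi> a * Re (inv_fourier g a))"
  proof (rule integral_dominated_convergence)
    show "integrable lborel (\<lambda>a. (K * (1 / (1 + a\<^sup>2))) * (LINT \<xi>|lborel. norm (g \<xi>)))"
      by (intro integrable_mult_left integrable_mult_right integrable_inverse_1_plus_square)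
    show "AE a in lborel. (\<lambda>n. \<psi> a * E n a) \<longlonglongrightarrow> \<psi> a * Re (inv_fourier g a)"
      by (intro AE_I2 tendsto_mult tendsto_const Elim)
    show "AE a in lborel. norm (\<psi> a * E n a) \<le> (K * (1 / (1 + a\<^sup>2))) * (LINT \<xi>|lborel. norm (g \<xi>))" for n
      using K by (intro AE_I2) (simp only: real_norm_def abs_mult, intro mult_mono Eb, auto simp: K0)
  qed auto
  moreover have "(\<lambda>n. LINT a|lborel. \<psi> a * E n a) \<longlonglongrightarrow> (LINT x|lborel. f x * \<psi> x)"
    using lim1 unfolding swap E_def .
  ultimately have "(LINT a|lborel. \<psi> a * Re (inv_fourier g a)) = (LINT x|lborel. f x * \<psi> x)"
    by (rule LIMSEQ_unique)
  then show ?thesis by (simp add: mult.commute)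
qed

section \<open>Regularity of inverse Fourier integrals\<close>

lemma inv_fourier_norm_le:
  assumes "integrable lborel g"
  shows "norm (inv_fourier g x) \<le> (LINT \<xi>|lborel. norm (g \<xi>))"
proof -
  have "norm (inv_fourier g x) = norm (LINT \<xi>|lborel. g \<xi> * cis (x * \<xi>)) / sqrt (2 * pi)"
    unfolding inv_fourier_def by (simp add: norm_divide)
  also have "\<dots> \<le> norm (LINT \<xi>|lborel. g \<xi> * cis (x * \<xi>)) / 1"
    using pi_ge_two by (intro divide_left_mono) auto
  also have "\<dots> \<le> (LINT \<xi>|lborel. norm (g \<xi> * cis (x * \<xi>)))" using integral_norm_bound by simp
  also have "\<dots> = (LINT \<xi>|lborel. norm (g \<xi>))" by (simp add: norm_mult)
  finally show ?thesis .
qed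

lemma integrable_mult_cis:
  assumes "integrable lborel g"
  shows "integrable lborel (\<lambda>\<xi>. g \<xi> * cis (x * \<xi>))"
proof (rule Bochner_Integration.integrable_bound[OF assms])
  have "g \<in> borel_measurable borel" using assms by auto
  then show "(\<lambda>\<xi>. g \<xi> * cis (x * \<xi>)) \<in> borel_measurable lborel" by measurable
qed (simp add: norm_mult)

lemma inv_fourier_linear:
  assumes "integrable lborel g" "integrable lborel h"
  shows "inv_fourier (\<lambda>\<xi>. a * g \<xi> + b * h \<xi>) x = a * inv_fourier g x + b * inv_fourier h x"
  using integrable_mult_cis[OF assms(1)] integrable_mult_cis[OF assms(2)]
  unfolding inv_fourier_def by (simp add: distrib_right mult.assoc add_divide_distrib)

lemma continuous_on_inv_fourier:
  assumes g: "integrable lborel g"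
  shows "continuous_on S (inv_fourier g)"
proof (rule continuous_at_imp_continuous_on, rule ballI)
  fix x
  show "isCont (inv_fourier g) x"
  proof (rule continuous_at_sequentiallyI)
    fix X assume X: "X \<longlonglongrightarrow> x"
    have "(\<lambda>n. LINT \<xi>|lborel. g \<xi> * cis (X n * \<xi>)) \<longlonglongrightarrow> (LINT \<xi>|lborel. g \<xi> * cis (x * \<xi>))"
    proof (rule integral_dominated_convergence)
      show "integrable lborel (\<lambda>\<xi>. norm (g \<xi>))" using g by simp
      show "AE \<xi> in lborel. (\<lambda>n. g \<xi> * cis (X n * \<xi>)) \<longlonglongrightarrow> g \<xi> * cis (x * \<xi>)"
      proof (intro AE_I2 tendsto_mult tendsto_const)
        fix \<xi>
        have "(\<lambda>n. Complex (cos (X n * \<xi>)) (sin (X n * \<xi>))) \<longlonglongrightarrow> Complex (cos (x * \<xi>)) (sin (x * \<xi>))"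
          by (intro tendsto_Complex tendsto_cos tendsto_sin tendsto_mult tendsto_const X)
        moreover have "Complex (cos y) (sin y) = cis y" for y by (simp add: complex_eq_iff)
        ultimately show "(\<lambda>n. cis (X n * \<xi>)) \<longlonglongrightarrow> cis (x * \<xi>)" by simp
      qed
    qed (use integrable_mult_cis[OF g] in \<open>auto simp: norm_mult intro: borel_measurable_integrable\<close>)
    then show "(\<lambda>n. inv_fourier g (X n)) \<longlonglongrightarrow> inv_fourier g x"
      unfolding inv_fourier_def by (intro tendsto_divide tendsto_const) auto
  qed
qed

lemma cis_difference_quotient:
  fixes \<xi> :: real
  shows "((\<lambda>h. (cis (h * \<xi>) - 1) / complex_of_real h) \<longlongrightarrow> \<i> * complex_of_real \<xi>) (at 0)"
proof -
  have c: "((\<lambda>h. cos (h * \<xi>)) has_real_derivative 0) (at 0)"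
    and s: "((\<lambda>h. sin (h * \<xi>)) has_real_derivative \<xi>) (at 0)"
    by (auto intro!: derivative_eq_intros)
  have "((\<lambda>h. Complex ((cos (h * \<xi>) - 1) / h) (sin (h * \<xi>) / h)) \<longlongrightarrow> Complex 0 \<xi>) (at 0)"
    using c s by (intro tendsto_Complex) (simp_all add: DERIV_def)
  moreover have "Complex ((cos (h * \<xi>) - 1) / h) (sin (h * \<xi>) / h) = (cis (h * \<xi>) - 1) / complex_of_real h" for h
    by (simp add: complex_eq_iff)
  moreover have "Complex 0 \<xi> = \<i> * complex_of_real \<xi>" by (simp add: complex_eq_iff)
  ultimately show ?thesis by simp
qed

lemma norm_cis_minus_1: "norm (cis y - 1) \<le> \<bar>y\<bar>"
  using iexp_approx1[of y 0] by (simp add: cis_conv_exp)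

text \<open>Dominated convergence of the difference quotients: |cis (h \<xi>) - 1| \<le> |h \<xi>|
  gives the majorant |\<xi> g|.\<close>

lemma DERIV_inv_fourier:
  assumes g: "integrable lborel g" and g': "integrable lborel (\<lambda>\<xi>. \<i> * complex_of_real \<xi> * g \<xi>)"
  shows "((\<lambda>x. Re (inv_fourier g x)) has_real_derivative Re (inv_fourier (\<lambda>\<xi>. \<i> * complex_of_real \<xi> * g \<xi>) x)) (at x)"
proof -
  have [measurable]: "g \<in> borel_measurable borel" using g by auto
  have "((\<lambda>h. (inv_fourier g (x + h) - inv_fourier g x) / complex_of_real h)
      \<longlongrightarrow> inv_fourier (\<lambda>\<xi>. \<i> * complex_of_real \<xi> * g \<xi>) x) (at 0)"
    unfolding tendsto_at_iff_sequentially comp_def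
  proof (intro allI impI)
    fix X :: "nat \<Rightarrow> real"
    assume X: "\<forall>i. X i \<in> UNIV - {0}" "X \<longlonglongrightarrow> 0"
    have X0: "filterlim X (at 0) sequentially"
      using X by (auto simp: filterlim_at)
    define k where "k = (\<lambda>n \<xi>. g \<xi> * cis (x * \<xi>) * ((cis (X n * \<xi>) - 1) / complex_of_real (X n)))"
    have "(\<lambda>n. LINT \<xi>|lborel. k n \<xi>) \<longlonglongrightarrow> (LINT \<xi>|lborel. \<i> * complex_of_real \<xi> * g \<xi> * cis (x * \<xi>))"
    proof (rule integral_dominated_convergence)
      show "integrable lborel (\<lambda>\<xi>. norm (\<i> * complex_of_real \<xi> * g \<xi>))" using g' by (rule integrable_norm)
      show "AE \<xi> in lborel. (\<lambda>n. k n \<xi>) \<longlonglongrightarrow> \<i> * complex_of_real \<xi> * g \<xi> * cis (x * \<xi>)"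
      proof (rule AE_I2)
        fix \<xi>
        have "(\<lambda>n. k n \<xi>) \<longlonglongrightarrow> g \<xi> * cis (x * \<xi>) * (\<i> * complex_of_real \<xi>)"
          unfolding k_def
          by (intro tendsto_mult tendsto_const filterlim_compose[OF cis_difference_quotient X0])
        then show "(\<lambda>n. k n \<xi>) \<longlonglongrightarrow> \<i> * complex_of_real \<xi> * g \<xi> * cis (x * \<xi>)" by (simp add: mult_ac)
      qed
      show "AE \<xi> in lborel. norm (k n \<xi>) \<le> norm (\<i> * complex_of_real \<xi> * g \<xi>)" for n
      proof (rule AE_I2)
        fix \<xi>
        have "X n \<noteq> 0" using X by auto
        then have "norm ((cis (X n * \<xi>) - 1) / complex_of_real (X n)) \<le> \<bar>\<xi>\<bar>"
          using norm_cis_minus_1[of "X n * \<xi>"] by (simp add: norm_divide abs_mult divide_le_eq mult.commute)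
        from mult_left_mono[OF this norm_ge_zero[of "g \<xi>"]]
        show "norm (k n \<xi>) \<le> norm (\<i> * complex_of_real \<xi> * g \<xi>)"
          unfolding k_def
          by (simp only: norm_mult norm_cis mult_1_right mult_1_left norm_ii norm_of_real mult.commute[of "\<bar>\<xi>\<bar>"])
      qed
      show "k n \<in> borel_measurable lborel" for n unfolding k_def by measurable
    qed measurable
    then have "(\<lambda>n. (LINT \<xi>|lborel. k n \<xi>) / complex_of_real (sqrt (2 * pi)))
        \<longlonglongrightarrow> inv_fourier (\<lambda>\<xi>. \<i> * complex_of_real \<xi> * g \<xi>) x"
      unfolding inv_fourier_def by (intro tendsto_divide tendsto_const) auto
    moreover have "(LINT \<xi>|lborel. k n \<xi>) / complex_of_real (sqrt (2 * pi))
        = (inv_fourier g (x + X n) - inv_fourier g x) / complex_of_real (X n)" for n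
    proof -
      have "k n \<xi> = (g \<xi> * cis ((x + X n) * \<xi>) - g \<xi> * cis (x * \<xi>)) / complex_of_real (X n)" for \<xi>
        unfolding k_def by (simp add: distrib_right cis_mult[symmetric] right_diff_distrib mult.assoc)
      then have "(LINT \<xi>|lborel. k n \<xi>)
        = ((LINT \<xi>|lborel. g \<xi> * cis ((x + X n) * \<xi>)) - (LINT \<xi>|lborel. g \<xi> * cis (x * \<xi>))) / complex_of_real (X n)"
        using integrable_mult_cis[OF g] by simp
      then show ?thesis unfolding inv_fourier_def by (simp add: diff_divide_distrib mult.commute)
    qed
    ultimately show "(\<lambda>n. (inv_fourier g (x + X n) - inv_fourier g x) / complex_of_real (X n))
        \<longlonglongrightarrow> inv_fourier (\<lambda>\<xi>. \<i> * complex_of_real \<xi> * g \<xi>) x" by simp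
  qed
  from tendsto_Re[OF this] show ?thesis
    by (simp add: DERIV_def Re_divide_of_real)
qed

text \<open>Equality almost everywhere is upgraded by continuity. The difference f - r is paired
  with itself times a tent function centred at x; the integral vanishes, hence so does the
  nonnegative integrand, and the tent equals 1 at x.\<close>

lemma fourier_inversion:
  assumes F: "is_L2_fourier f g" and g: "integrable lborel g" and f: "continuous_on UNIV f"
  shows "f x = Re (inv_fourier g x)"
proof -
  define r where "r = (\<lambda>z. Re (inv_fourier g z))"
  have r: "continuous_on UNIV r"
    unfolding r_def by (intro continuous_on_Re continuous_on_inv_fourier g)
  define \<psi> where "\<psi> = (\<lambda>z. (f z - r z) * max 0 (1 - \<bar>z - x\<bar>))"
  have \<psi>: "continuous_on UNIV \<psi>" unfolding \<psi>_def by (intro continuous_intros f r)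
  have \<psi>0: "\<psi> z = 0" if "z \<notin> {x - 1..x + 1}" for z
    using that by (auto simp: \<psi>_def max_def)
  have "(LINT z|lborel. f z * \<psi> z) = (LINT z|lborel. r z * \<psi> z)"
    unfolding r_def by (rule L2_fourier_pairing[OF F g \<psi> \<psi>0])
  moreover have i: "integrable lborel (\<lambda>z. h z * \<psi> z)" if "continuous_on UNIV h" for h :: "real \<Rightarrow> real"
    by (rule compact_support_integral(1)[of _ "x - 1" "x + 1"]) (use \<psi>0 in \<open>auto intro!: continuous_intros that \<psi>\<close>)
  ultimately have "(LINT z|lborel. (f z - r z) * \<psi> z) = 0"
    using i[OF f] i[OF r] by (simp add: left_diff_distrib)
  moreover have c: "continuous_on UNIV (\<lambda>z. (f z - r z) * \<psi> z)" by (intro continuous_intros f r \<psi>)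
  have "(LINT z|lborel. (f z - r z) * \<psi> z) = integral {x - 1..x + 1} (\<lambda>z. (f z - r z) * \<psi> z)"
    by (rule compact_support_integral(2)[OF c]) (use \<psi>0 in auto)
  ultimately have 0: "integral {x - 1..x + 1} (\<lambda>z. (f z - r z) * \<psi> z) = 0" by simp
  have "(f z - r z) * \<psi> z \<ge> 0" for z
  proof -
    have "(f z - r z) * \<psi> z = (f z - r z)\<^sup>2 * max 0 (1 - \<bar>z - x\<bar>)"
      by (simp add: \<psi>_def power2_eq_square)
    then show ?thesis by simp
  qed
  then have "\<forall>z\<in>{x - 1..x + 1}. (f z - r z) * \<psi> z = 0"
    using integral_eq_0_iff[OF continuous_on_subset[OF c], of "x - 1" "x + 1"] 0 by auto
  then have "(f x - r x) * \<psi> x = 0" by (rule bspec) simp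
  then show ?thesis by (simp add: \<psi>_def r_def)
qed

section \<open>Linearity and uniqueness of the L^2 transform\<close>

lemma L2_fun_linear:
  fixes f g :: "real \<Rightarrow> 'a::{banach, second_countable_topology, real_normed_div_algebra}"
  assumes "L2_fun f" "L2_fun g"
  shows "L2_fun (\<lambda>x. a * f x + b * g x)"
  unfolding L2_fun_def
proof
  have [measurable]: "f \<in> borel_measurable borel" "g \<in> borel_measurable borel" using assms by (auto simp: L2_fun_def)
  show "(\<lambda>x. a * f x + b * g x) \<in> borel_measurable lborel" by measurable
  show "integrable lborel (\<lambda>x. (norm (a * f x + b * g x))\<^sup>2)"
  proof (rule Bochner_Integration.integrable_bound)
    show "integrable lborel (\<lambda>x. 2 * (norm a)\<^sup>2 * (norm (f x))\<^sup>2 + 2 * (norm b)\<^sup>2 * (norm (g x))\<^sup>2)"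
      using assms by (auto simp: L2_fun_def)
    show "AE x in lborel. norm ((norm (a * f x + b * g x))\<^sup>2)
        \<le> norm (2 * (norm a)\<^sup>2 * (norm (f x))\<^sup>2 + 2 * (norm b)\<^sup>2 * (norm (g x))\<^sup>2)"
    proof (rule AE_I2)
      fix x
      have "(norm (a * f x + b * g x))\<^sup>2 \<le> (norm (a * f x) + norm (b * g x))\<^sup>2"
        by (intro power_mono norm_triangle_ineq) simp
      also have "\<dots> \<le> 2 * (norm (a * f x))\<^sup>2 + 2 * (norm (b * g x))\<^sup>2"
        using sum_squares_bound[of "norm (a * f x)" "norm (b * g x)"] by (simp add: power2_sum)
      finally show "norm ((norm (a * f x + b * g x))\<^sup>2)
        \<le> norm (2 * (norm a)\<^sup>2 * (norm (f x))\<^sup>2 + 2 * (norm b)\<^sup>2 * (norm (g x))\<^sup>2)"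
        by (simp add: norm_mult power_mult_distrib)
    qed
  qed measurable
qed

lemma nn_integral_norm_square_linear:
  fixes f g :: "real \<Rightarrow> complex"
  assumes [measurable]: "f \<in> borel_measurable lborel" "g \<in> borel_measurable lborel"
  shows "(\<integral>\<^sup>+x. ennreal ((cmod (a * f x + b * g x))\<^sup>2) \<partial>lborel)
    \<le> ennreal (2 * (cmod a)\<^sup>2) * (\<integral>\<^sup>+x. ennreal ((cmod (f x))\<^sup>2) \<partial>lborel)
      + ennreal (2 * (cmod b)\<^sup>2) * (\<integral>\<^sup>+x. ennreal ((cmod (g x))\<^sup>2) \<partial>lborel)"
proof -
  have "(\<integral>\<^sup>+x. ennreal ((cmod (a * f x + b * g x))\<^sup>2) \<partial>lborel)
    \<le> (\<integral>\<^sup>+x. ennreal (2 * (cmod a)\<^sup>2) * ennreal ((cmod (f x))\<^sup>2) + ennreal (2 * (cmod b)\<^sup>2) * ennreal ((cmod (g x))\<^sup>2) \<partial>lborel)"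
  proof (rule nn_integral_mono)
    fix x
    have "(norm (a * f x + b * g x))\<^sup>2 \<le> (norm (a * f x) + norm (b * g x))\<^sup>2"
      by (intro power_mono norm_triangle_ineq) simp
    also have "\<dots> \<le> 2 * (norm (a * f x))\<^sup>2 + 2 * (norm (b * g x))\<^sup>2"
      using sum_squares_bound[of "norm (a * f x)" "norm (b * g x)"] by (simp add: power2_sum)
    also have "\<dots> = 2 * (cmod a)\<^sup>2 * (cmod (f x))\<^sup>2 + 2 * (cmod b)\<^sup>2 * (cmod (g x))\<^sup>2"
      by (simp add: norm_mult power_mult_distrib)
    finally show "ennreal ((cmod (a * f x + b * g x))\<^sup>2) \<le> ennreal (2 * (cmod a)\<^sup>2) * ennreal ((cmod (f x))\<^sup>2) + ennreal (2 * (cmod b)\<^sup>2) * ennreal ((cmod (g x))\<^sup>2)"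
      by (simp flip: ennreal_mult ennreal_plus)
  qed
  also have "\<dots> = ennreal (2 * (cmod a)\<^sup>2) * (\<integral>\<^sup>+x. ennreal ((cmod (f x))\<^sup>2) \<partial>lborel)
      + ennreal (2 * (cmod b)\<^sup>2) * (\<integral>\<^sup>+x. ennreal ((cmod (g x))\<^sup>2) \<partial>lborel)"
    by (simp add: nn_integral_add nn_integral_cmult)
  finally show ?thesis .
qed

lemma truncated_fourier_linear:
  fixes f1 f2 :: "real \<Rightarrow> real"
  assumes "L2_fun f1" "L2_fun f2"
  shows "truncated_fourier R (\<lambda>x. a * f1 x + b * f2 x) \<xi>
    = complex_of_real a * truncated_fourier R f1 \<xi> + complex_of_real b * truncated_fourier R f2 \<xi>"
proof -
  define h where "h = (\<lambda>f x. indicator {-R..R} x *\<^sub>R (complex_of_real (f x) * cis (- (x * \<xi>))))"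
  have i: "integrable lborel (h f)" if "L2_fun f" for f
  proof (rule Bochner_Integration.integrable_bound[OF integrable_truncation[OF that, of R]])
    have [measurable]: "f \<in> borel_measurable borel" using that by (simp add: L2_fun_def)
    show "h f \<in> borel_measurable lborel" unfolding h_def by measurable
  qed (auto simp: h_def norm_mult)
  have eq: "h (\<lambda>x. a * f1 x + b * f2 x) = (\<lambda>x. complex_of_real a * h f1 x + complex_of_real b * h f2 x)"
    by (auto simp: h_def indicator_def algebra_simps)
  have "(LINT x|lborel. h (\<lambda>x. a * f1 x + b * f2 x) x)
      = complex_of_real a * (LINT x|lborel. h f1 x) + complex_of_real b * (LINT x|lborel. h f2 x)"
    unfolding eq using i[OF assms(1)] i[OF assms(2)] by simp
  moreover have "truncated_fourier R f \<xi> = (LINT x|lborel. h f x) / complex_of_real (sqrt (2 * pi))" for f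
    unfolding truncated_fourier_def set_lebesgue_integral_def h_def ..
  ultimately show ?thesis by (simp add: add_divide_distrib)
qed

lemma truncated_fourier_measurable:
  fixes f :: "real \<Rightarrow> real"
  shows "L2_fun f \<Longrightarrow> truncated_fourier R f \<in> borel_measurable lborel"
  using truncated_fourier_gauss(2)[of f 1] by simp

lemma is_L2_fourier_linear:
  assumes "is_L2_fourier f1 g1" "is_L2_fourier f2 g2"
  shows "is_L2_fourier (\<lambda>x. a * f1 x + b * f2 x) (\<lambda>\<xi>. complex_of_real a * g1 \<xi> + complex_of_real b * g2 \<xi>)"
  unfolding is_L2_fourier_def
proof (intro conjI)
  have L: "L2_fun f1" "L2_fun f2" "L2_fun g1" "L2_fun g2" using assms by (auto simp: is_L2_fourier_def)
  have m [measurable]: "truncated_fourier R f1 \<in> borel_measurable borel" "truncated_fourier R f2 \<in> borel_measurable borel"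
     "g1 \<in> borel_measurable borel" "g2 \<in> borel_measurable borel" for R
    using L truncated_fourier_measurable[of f1 R] truncated_fourier_measurable[of f2 R] by (auto simp: L2_fun_def)
  show "L2_fun (\<lambda>x. a * f1 x + b * f2 x)" using L by (intro L2_fun_linear)
  show "L2_fun (\<lambda>\<xi>. complex_of_real a * g1 \<xi> + complex_of_real b * g2 \<xi>)" using L by (intro L2_fun_linear)
  let ?N = "\<lambda>f g R. \<integral>\<^sup>+\<xi>. ennreal ((cmod (truncated_fourier R f \<xi> - g \<xi>))\<^sup>2) \<partial>lborel"
  have "((\<lambda>R. ennreal (2 * (cmod (complex_of_real a))\<^sup>2) * ?N f1 g1 R + ennreal (2 * (cmod (complex_of_real b))\<^sup>2) * ?N f2 g2 R)
      \<longlongrightarrow> ennreal (2 * (cmod (complex_of_real a))\<^sup>2) * 0 + ennreal (2 * (cmod (complex_of_real b))\<^sup>2) * 0) at_top"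
    using assms unfolding is_L2_fourier_def
    by (intro tendsto_add tendsto_mult_ennreal tendsto_const) auto
  then have lim: "((\<lambda>R. ennreal (2 * (cmod (complex_of_real a))\<^sup>2) * ?N f1 g1 R + ennreal (2 * (cmod (complex_of_real b))\<^sup>2) * ?N f2 g2 R) \<longlongrightarrow> 0) at_top"
    by simp
  have le: "?N (\<lambda>x. a * f1 x + b * f2 x) (\<lambda>\<xi>. complex_of_real a * g1 \<xi> + complex_of_real b * g2 \<xi>) R
     \<le> ennreal (2 * (cmod (complex_of_real a))\<^sup>2) * ?N f1 g1 R + ennreal (2 * (cmod (complex_of_real b))\<^sup>2) * ?N f2 g2 R" for R
  proof -
    have "truncated_fourier R (\<lambda>x. a * f1 x + b * f2 x) \<xi> - (complex_of_real a * g1 \<xi> + complex_of_real b * g2 \<xi>)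
       = complex_of_real a * (truncated_fourier R f1 \<xi> - g1 \<xi>) + complex_of_real b * (truncated_fourier R f2 \<xi> - g2 \<xi>)" for \<xi>
      unfolding truncated_fourier_linear[OF L(1,2)] by (simp add: algebra_simps)
    then show ?thesis
      using nn_integral_norm_square_linear[of "\<lambda>\<xi>. truncated_fourier R f1 \<xi> - g1 \<xi>" "\<lambda>\<xi>. truncated_fourier R f2 \<xi> - g2 \<xi>"
          "complex_of_real a" "complex_of_real b"]
      by simp
  qed
  show "(?N (\<lambda>x. a * f1 x + b * f2 x) (\<lambda>\<xi>. complex_of_real a * g1 \<xi> + complex_of_real b * g2 \<xi>) \<longlongrightarrow> 0) at_top"
    by (rule tendsto_sandwich[OF _ always_eventually[OF allI[OF le]] tendsto_const lim]) simp
qed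

text \<open>Both are limits of the same truncated transforms, so the distance is at most twice the
  sum of two quantities tending to 0.\<close>

lemma is_L2_fourier_unique:
  assumes "is_L2_fourier f g1" "is_L2_fourier f g2"
  shows "AE \<xi> in lborel. g1 \<xi> = g2 \<xi>"
proof -
  have L: "L2_fun f" "L2_fun g1" "L2_fun g2" using assms by (auto simp: is_L2_fourier_def)
  have m [measurable]: "truncated_fourier R f \<in> borel_measurable borel"
     "g1 \<in> borel_measurable borel" "g2 \<in> borel_measurable borel" for R
    using L truncated_fourier_measurable[of f R] by (auto simp: L2_fun_def)
  let ?N = "\<lambda>g R. \<integral>\<^sup>+\<xi>. ennreal ((cmod (truncated_fourier R f \<xi> - g \<xi>))\<^sup>2) \<partial>lborel"
  have "((\<lambda>R. ennreal 2 * ?N g2 R + ennreal 2 * ?N g1 R) \<longlongrightarrow> ennreal 2 * 0 + ennreal 2 * 0) at_top"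
    using assms unfolding is_L2_fourier_def
    by (intro tendsto_add tendsto_mult_ennreal tendsto_const) auto
  moreover have "(\<integral>\<^sup>+\<xi>. ennreal ((cmod (g1 \<xi> - g2 \<xi>))\<^sup>2) \<partial>lborel) \<le> ennreal 2 * ?N g2 R + ennreal 2 * ?N g1 R" for R
    using nn_integral_norm_square_linear[of "\<lambda>\<xi>. truncated_fourier R f \<xi> - g2 \<xi>" "\<lambda>\<xi>. truncated_fourier R f \<xi> - g1 \<xi>" 1 "- 1"]
    by simp
  ultimately have "(\<integral>\<^sup>+\<xi>. ennreal ((cmod (g1 \<xi> - g2 \<xi>))\<^sup>2) \<partial>lborel) \<le> ennreal 2 * 0 + ennreal 2 * 0"
    by (intro tendsto_lowerbound[of _ _ at_top]) (auto intro!: always_eventually)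
  then have "(\<integral>\<^sup>+\<xi>. ennreal ((cmod (g1 \<xi> - g2 \<xi>))\<^sup>2) \<partial>lborel) = 0" by simp
  then have "AE \<xi> in lborel. ennreal ((cmod (g1 \<xi> - g2 \<xi>))\<^sup>2) = 0"
    by (subst (asm) nn_integral_0_iff_AE) auto
  then show ?thesis by eventually_elim simp
qed

subsection \<open>Sobolev embedding\<close>

definition fourier_of :: "(real \<Rightarrow> real) \<Rightarrow> real \<Rightarrow> complex" where
  "fourier_of f = (SOME g. is_L2_fourier f g)"

text \<open>A weighted L^1 condition on the transform. As |\<xi>| \<le> (1 + \<xi>^2)^(1/2), each
  derivative costs 1/2 in r: r = 1 yields two bounded continuous derivatives and r = 1/2 yields
  one.\<close>

definition weighted_integrable :: "real \<Rightarrow> (real \<Rightarrow> complex) \<Rightarrow> bool" where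
  "weighted_integrable r g \<longleftrightarrow> g \<in> borel_measurable borel \<and> integrable lborel (\<lambda>\<xi>. (1 + \<xi>\<^sup>2) powr r * cmod (g \<xi>))"

definition weighted_norm :: "real \<Rightarrow> (real \<Rightarrow> complex) \<Rightarrow> real" where
  "weighted_norm r g = (LINT \<xi>|lborel. (1 + \<xi>\<^sup>2) powr r * cmod (g \<xi>))"

definition fourier_D :: "(real \<Rightarrow> complex) \<Rightarrow> real \<Rightarrow> complex" where
  "fourier_D g \<xi> = \<i> * complex_of_real \<xi> * g \<xi>"

lemma one_le_weight: "r \<ge> 0 \<Longrightarrow> (1 + \<xi>\<^sup>2) powr r \<ge> (1::real)"
  by (intro ge_one_powr_ge_zero) auto

lemma weighted_norm_nonneg: "weighted_norm r g \<ge> 0"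
  unfolding weighted_norm_def by (intro Bochner_Integration.integral_nonneg) auto

lemma weighted_integrable_integrable:
  assumes "weighted_integrable r g" "r \<ge> 0"
  shows "integrable lborel g" "(LINT \<xi>|lborel. norm (g \<xi>)) \<le> weighted_norm r g"
proof -
  have b: "norm (g \<xi>) \<le> (1 + \<xi>\<^sup>2) powr r * cmod (g \<xi>)" for \<xi>
    using mult_right_mono[OF one_le_weight[OF assms(2), of \<xi>] norm_ge_zero[of "g \<xi>"]] by simp
  show i: "integrable lborel g"
    by (rule Bochner_Integration.integrable_bound[of _ "\<lambda>\<xi>. (1 + \<xi>\<^sup>2) powr r * cmod (g \<xi>)"])
      (use assms(1) b in \<open>auto simp: weighted_integrable_def\<close>)
  show "(LINT \<xi>|lborel. norm (g \<xi>)) \<le> weighted_norm r g"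
    unfolding weighted_norm_def
    by (rule integral_mono) (use assms(1) b i in \<open>auto simp: weighted_integrable_def\<close>)
qed

lemma weighted_integrable_D:
  assumes "weighted_integrable r g"
  shows "weighted_integrable (r - 1 / 2) (fourier_D g)"
    and "weighted_norm (r - 1 / 2) (fourier_D g) \<le> weighted_norm r g"
proof -
  have [measurable]: "g \<in> borel_measurable borel" using assms by (simp add: weighted_integrable_def)
  have m [measurable]: "fourier_D g \<in> borel_measurable borel" unfolding fourier_D_def[abs_def] by measurable
  have b: "(1 + \<xi>\<^sup>2) powr (r - 1 / 2) * cmod (fourier_D g \<xi>) \<le> (1 + \<xi>\<^sup>2) powr r * cmod (g \<xi>)" for \<xi>
  proof -
    have pos: "1 + \<xi>\<^sup>2 > 0" by (simp add: add_pos_nonneg)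
    have "\<bar>\<xi>\<bar> \<le> (1 + \<xi>\<^sup>2) powr (1 / 2)"
      using pos by (simp add: powr_half_sqrt real_le_rsqrt)
    then have "(1 + \<xi>\<^sup>2) powr (r - 1 / 2) * \<bar>\<xi>\<bar> \<le> (1 + \<xi>\<^sup>2) powr (r - 1 / 2) * (1 + \<xi>\<^sup>2) powr (1 / 2)"
      by (intro mult_left_mono) auto
    also have "\<dots> = (1 + \<xi>\<^sup>2) powr r" by (simp flip: powr_add)
    finally show ?thesis
      using mult_right_mono[OF _ norm_ge_zero[of "g \<xi>"]] by (simp add: fourier_D_def norm_mult mult.assoc[symmetric])
  qed
  have i: "integrable lborel (\<lambda>\<xi>. (1 + \<xi>\<^sup>2) powr r * cmod (g \<xi>))"
    using assms by (simp add: weighted_integrable_def)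
  have j: "integrable lborel (\<lambda>\<xi>. (1 + \<xi>\<^sup>2) powr (r - 1 / 2) * cmod (fourier_D g \<xi>))"
    by (rule Bochner_Integration.integrable_bound[OF i]) (use b in auto)
  then show "weighted_integrable (r - 1 / 2) (fourier_D g)"
    using m by (simp add: weighted_integrable_def)
  show "weighted_norm (r - 1 / 2) (fourier_D g) \<le> weighted_norm r g"
    unfolding weighted_norm_def by (rule integral_mono[OF j i b])
qed

lemma weighted_integrable_linear:
  assumes "weighted_integrable r g" "weighted_integrable r h"
  shows "weighted_integrable r (\<lambda>\<xi>. a * g \<xi> + b * h \<xi>)"
    and "weighted_norm r (\<lambda>\<xi>. a * g \<xi> + b * h \<xi>) \<le> cmod a * weighted_norm r g + cmod b * weighted_norm r h"
proof -
  have [measurable]: "g \<in> borel_measurable borel" "h \<in> borel_measurable borel" using assms by (auto simp: weighted_integrable_def)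
  define B where "B = (\<lambda>\<xi>. cmod a * ((1 + \<xi>\<^sup>2) powr r * cmod (g \<xi>)) + cmod b * ((1 + \<xi>\<^sup>2) powr r * cmod (h \<xi>)))"
  have B: "integrable lborel B" unfolding B_def using assms by (auto simp: weighted_integrable_def)
  have b: "(1 + \<xi>\<^sup>2) powr r * cmod (a * g \<xi> + b * h \<xi>) \<le> B \<xi>" for \<xi>
  proof -
    have "(1 + \<xi>\<^sup>2) powr r * cmod (a * g \<xi> + b * h \<xi>) \<le> (1 + \<xi>\<^sup>2) powr r * (cmod a * cmod (g \<xi>) + cmod b * cmod (h \<xi>))"
      by (intro mult_left_mono order_trans[OF norm_triangle_ineq]) (auto simp: norm_mult)
    then show ?thesis by (simp add: B_def algebra_simps)
  qed
  have i: "integrable lborel (\<lambda>\<xi>. (1 + \<xi>\<^sup>2) powr r * cmod (a * g \<xi> + b * h \<xi>))"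
    by (rule Bochner_Integration.integrable_bound[OF B]) (auto intro!: AE_I2 order_trans[OF b abs_ge_self])
  then show "weighted_integrable r (\<lambda>\<xi>. a * g \<xi> + b * h \<xi>)" by (simp add: weighted_integrable_def)
  have "weighted_norm r (\<lambda>\<xi>. a * g \<xi> + b * h \<xi>) \<le> (LINT \<xi>|lborel. B \<xi>)"
    unfolding weighted_norm_def by (rule integral_mono[OF i B b])
  also have "\<dots> = cmod a * weighted_norm r g + cmod b * weighted_norm r h"
    unfolding B_def weighted_norm_def using assms by (simp add: weighted_integrable_def)
  finally show "weighted_norm r (\<lambda>\<xi>. a * g \<xi> + b * h \<xi>) \<le> cmod a * weighted_norm r g + cmod b * weighted_norm r h" .
qed

text \<open>Membership in \<open>sobolev_space\<close> asserts the weighted integrability for some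
  transform; uniqueness up to null sets transfers it to the chosen one.\<close>

lemma fourier_of:
  assumes "f \<in> sobolev_space s"
  shows "is_L2_fourier f (fourier_of f)"
    and "integrable lborel (\<lambda>\<xi>. (1 + \<xi>\<^sup>2) powr s * (cmod (fourier_of f \<xi>))\<^sup>2)"
proof -
  obtain g where g: "is_L2_fourier f g" "integrable lborel (\<lambda>\<xi>. (1 + \<xi>\<^sup>2) powr s * (cmod (g \<xi>))\<^sup>2)"
    using assms by (auto simp: sobolev_space_def)
  show F: "is_L2_fourier f (fourier_of f)" unfolding fourier_of_def by (rule someI[of "is_L2_fourier f", OF g(1)])
  have [measurable]: "fourier_of f \<in> borel_measurable borel" "g \<in> borel_measurable borel"
    using F g(1) by (auto simp: is_L2_fourier_def L2_fun_def)
  show "integrable lborel (\<lambda>\<xi>. (1 + \<xi>\<^sup>2) powr s * (cmod (fourier_of f \<xi>))\<^sup>2)"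
  proof (rule integrable_cong_AE_imp[OF g(2)])
    show "AE \<xi> in lborel. (1 + \<xi>\<^sup>2) powr s * (cmod (g \<xi>))\<^sup>2 = (1 + \<xi>\<^sup>2) powr s * (cmod (fourier_of f \<xi>))\<^sup>2"
      using is_L2_fourier_unique[OF F g(1)] by eventually_elim simp
  qed measurable
qed

text \<open>Allows the norm of a difference, or of a difference quotient, to be computed from the
  linear combination of the given transforms.\<close>

lemma sobolev_norm_eq:
  assumes g: "is_L2_fourier f g"
  shows "sobolev_norm s f = sqrt (LINT \<xi>|lborel. (1 + \<xi>\<^sup>2) powr s * (cmod (g \<xi>))\<^sup>2)"
proof -
  have F: "is_L2_fourier f (fourier_of f)" unfolding fourier_of_def by (rule someI[of "is_L2_fourier f", OF g])
  have [measurable]: "fourier_of f \<in> borel_measurable borel" "g \<in> borel_measurable borel"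
    using F g by (auto simp: is_L2_fourier_def L2_fun_def)
  have "(LINT \<xi>|lborel. (1 + \<xi>\<^sup>2) powr s * (cmod (fourier_of f \<xi>))\<^sup>2) = (LINT \<xi>|lborel. (1 + \<xi>\<^sup>2) powr s * (cmod (g \<xi>))\<^sup>2)"
    using is_L2_fourier_unique[OF F g] by (intro integral_cong_AE) auto
  then show ?thesis by (simp add: sobolev_norm_def fourier_of_def)
qed

text \<open>The L^2 norm of (1 + \<xi>^2)^(r - s/2), the factor split off by the Cauchy-Schwarz
  inequality. The integral converges for s - 2r > 1/2.\<close>

definition embedding_const :: "real \<Rightarrow> real \<Rightarrow> real" where
  "embedding_const s r = sqrt (LINT \<xi>|lborel. (1 + \<xi>\<^sup>2) powr (2 * r - s))"

text \<open>Cauchy-Schwarz for (1 + \<xi>^2)^(r - s/2) times (1 + \<xi>^2)^(s/2) |g|. The explicit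
  norm bound is what turns convergence in the Sobolev norm into convergence uniform in x.\<close>

lemma weighted_integrable_of_sobolev:
  assumes F: "is_L2_fourier f g" and w: "integrable lborel (\<lambda>\<xi>. (1 + \<xi>\<^sup>2) powr s * (cmod (g \<xi>))\<^sup>2)"
    and r: "s - 2 * r > 1 / 2"
  shows "weighted_integrable r g"
    and "weighted_norm r g \<le> embedding_const s r * sobolev_norm s f"
proof -
  have [measurable]: "g \<in> borel_measurable borel" using F by (auto simp: is_L2_fourier_def L2_fun_def)
  define A where "A = (\<lambda>\<xi>::real. (1 + \<xi>\<^sup>2) powr (r - s / 2))"
  define B where "B = (\<lambda>\<xi>. (1 + \<xi>\<^sup>2) powr (s / 2) * cmod (g \<xi>))"
  have [measurable]: "A \<in> borel_measurable borel" "B \<in> borel_measurable borel" unfolding A_def B_def by measurable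
  have A2: "(norm (A \<xi>))\<^sup>2 = (1 + \<xi>\<^sup>2) powr (2 * r - s)" for \<xi>
    unfolding A_def by (simp add: power2_eq_square flip: powr_add)
  have B2: "(norm (B \<xi>))\<^sup>2 = (1 + \<xi>\<^sup>2) powr s * (cmod (g \<xi>))\<^sup>2" for \<xi>
    unfolding B_def by (simp add: power_mult_distrib power2_eq_square[of "_ powr _"] flip: powr_add)
  have Ai: "integrable lborel (\<lambda>\<xi>. (norm (A \<xi>))\<^sup>2)"
    unfolding A2 using integrable_powr_decay[of "s - 2 * r"] r by simp
  have Bi: "integrable lborel (\<lambda>\<xi>. (norm (B \<xi>))\<^sup>2)" unfolding B2 by (rule w)
  have AB: "A \<xi> * B \<xi> = (1 + \<xi>\<^sup>2) powr r * cmod (g \<xi>)" for \<xi>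
    unfolding A_def B_def mult.assoc[symmetric] by (simp flip: powr_add)
  have i: "integrable lborel (\<lambda>\<xi>. A \<xi> * B \<xi>)" by (rule L2_mult_integrable[OF _ _ Ai Bi]) auto
  then show "weighted_integrable r g" unfolding AB by (simp add: weighted_integrable_def)
  have "ennreal ((norm (LINT \<xi>|lborel. A \<xi> * B \<xi>))\<^sup>2)
     \<le> (\<integral>\<^sup>+\<xi>. ennreal ((norm (A \<xi>))\<^sup>2) \<partial>lborel) * (\<integral>\<^sup>+\<xi>. ennreal ((norm (B \<xi>))\<^sup>2) \<partial>lborel)"
    by (rule Cauchy_Schwarz_LINT[OF _ _ i]) auto
  also have "\<dots> = ennreal ((LINT \<xi>|lborel. (norm (A \<xi>))\<^sup>2) * (LINT \<xi>|lborel. (norm (B \<xi>))\<^sup>2))"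
    by (subst nn_integral_eq_integral[OF Ai], simp, subst nn_integral_eq_integral[OF Bi], simp)
      (simp add: ennreal_mult)
  finally have "(norm (LINT \<xi>|lborel. A \<xi> * B \<xi>))\<^sup>2 \<le> (LINT \<xi>|lborel. (norm (A \<xi>))\<^sup>2) * (LINT \<xi>|lborel. (norm (B \<xi>))\<^sup>2)"
    by (subst (asm) ennreal_le_iff) (auto intro!: mult_nonneg_nonneg)
  then have "norm (LINT \<xi>|lborel. A \<xi> * B \<xi>) \<le> sqrt ((LINT \<xi>|lborel. (norm (A \<xi>))\<^sup>2) * (LINT \<xi>|lborel. (norm (B \<xi>))\<^sup>2))"
    by (rule real_le_rsqrt)
  then show "weighted_norm r g \<le> embedding_const s r * sobolev_norm s f"
    unfolding weighted_norm_def embedding_const_def sobolev_norm_eq[OF F] AB A2 B2 real_sqrt_mult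
    by simp
qed

lemma sobolev_weight_linear:
  fixes g h :: "real \<Rightarrow> complex"
  assumes [measurable]: "g \<in> borel_measurable borel" "h \<in> borel_measurable borel"
    and g: "integrable lborel (\<lambda>\<xi>. (1 + \<xi>\<^sup>2) powr s * (cmod (g \<xi>))\<^sup>2)"
    and h: "integrable lborel (\<lambda>\<xi>. (1 + \<xi>\<^sup>2) powr s * (cmod (h \<xi>))\<^sup>2)"
  shows "integrable lborel (\<lambda>\<xi>. (1 + \<xi>\<^sup>2) powr s * (cmod (a * g \<xi> + b * h \<xi>))\<^sup>2)"
proof -
  have e: "(1 + \<xi>\<^sup>2) powr s * (cmod z)\<^sup>2 = (norm (complex_of_real ((1 + \<xi>\<^sup>2) powr (s / 2)) * z))\<^sup>2" for \<xi> z
    by (simp add: norm_mult power_mult_distrib power2_eq_square[of "_ powr _"] flip: powr_add)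
  define k where "k = (\<lambda>g \<xi>. complex_of_real ((1 + \<xi>\<^sup>2) powr (s / 2)) * g \<xi>)"
  have "L2_fun (k g)" "L2_fun (k h)"
    using g h unfolding L2_fun_def e k_def by auto
  then have "L2_fun (\<lambda>\<xi>. a * k g \<xi> + b * k h \<xi>)" by (rule L2_fun_linear)
  moreover have "a * k g \<xi> + b * k h \<xi> = complex_of_real ((1 + \<xi>\<^sup>2) powr (s / 2)) * (a * g \<xi> + b * h \<xi>)" for \<xi>
    by (simp add: k_def algebra_simps)
  ultimately show ?thesis unfolding e by (simp add: L2_fun_def)
qed

definition Re_inv_fourier :: "(real \<Rightarrow> complex) \<Rightarrow> real \<Rightarrow> real" where
  "Re_inv_fourier g x = Re (inv_fourier g x)"

lemma fourier_D_linear: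
  "fourier_D (\<lambda>\<xi>. a * g \<xi> + b * h \<xi>) = (\<lambda>\<xi>. a * fourier_D g \<xi> + b * fourier_D h \<xi>)"
  by (auto simp: fourier_D_def algebra_simps)

lemma Re_inv_fourier_bound:
  assumes "weighted_integrable r g" "r \<ge> 0"
  shows "\<bar>Re_inv_fourier g x\<bar> \<le> weighted_norm r g"
  using abs_Re_le_cmod[of "inv_fourier g x"] inv_fourier_norm_le[OF weighted_integrable_integrable(1)[OF assms], of x]
    weighted_integrable_integrable(2)[OF assms] unfolding Re_inv_fourier_def by linarith

lemma Re_inv_fourier_linear:
  assumes "weighted_integrable r g" "weighted_integrable r h" "r \<ge> 0"
  shows "Re_inv_fourier (\<lambda>\<xi>. complex_of_real a * g \<xi> + complex_of_real b * h \<xi>) x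
    = a * Re_inv_fourier g x + b * Re_inv_fourier h x"
  using inv_fourier_linear[OF weighted_integrable_integrable(1) weighted_integrable_integrable(1), OF assms(1,3) assms(2,3)]
  by (simp add: Re_inv_fourier_def)

lemma Re_inv_fourier_continuous:
  assumes "weighted_integrable r g" "r \<ge> 0"
  shows "continuous_on S (Re_inv_fourier g)"
  unfolding Re_inv_fourier_def[abs_def]
  by (intro continuous_on_Re continuous_on_inv_fourier weighted_integrable_integrable(1)[OF assms])

lemma Re_inv_fourier_DERIV:
  assumes "weighted_integrable r g" "r \<ge> 1 / 2"
  shows "(Re_inv_fourier g has_real_derivative Re_inv_fourier (fourier_D g) x) (at x)"
proof -
  have "integrable lborel g" using assms by (intro weighted_integrable_integrable(1)[of r]) auto
  moreover have "integrable lborel (fourier_D g)"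
    by (rule weighted_integrable_integrable(1)[OF weighted_integrable_D(1)[OF assms(1)]]) (use assms in simp)
  ultimately show ?thesis
    unfolding Re_inv_fourier_def[abs_def] fourier_D_def[abs_def] by (intro DERIV_inv_fourier)
qed

lemma deriv_outside:
  fixes f :: "real \<Rightarrow> real"
  assumes "\<And>x. x \<notin> {a..b} \<Longrightarrow> f x = 0" "x \<notin> {a..b}"
  shows "deriv f x = 0"
proof (rule DERIV_imp_deriv)
  have "((\<lambda>x. 0) has_real_derivative 0) (at x)" by simp
  then show "(f has_real_derivative 0) (at x)"
    by (rule DERIV_cong_ev[THEN iffD1, rotated -1, OF _ refl _ refl])
      (use assms in \<open>auto intro!: eventually_mono[OF eventually_nhds_in_open[of "- {a..b}"]]\<close>)
qed

lemma test_function_support: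
  assumes "test_function \<phi>"
  obtains a b where "\<And>x. x \<notin> {a..b} \<Longrightarrow> \<phi> x - deriv (deriv \<phi>) x = 0"
    and "continuous_on UNIV (\<lambda>x. \<phi> x - deriv (deriv \<phi>) x)"
proof -
  have d: "(deriv ^^ k) \<phi> field_differentiable at x" for k x using assms by (auto simp: test_function_def)
  have "bounded {x. \<phi> x \<noteq> 0}"
    using assms unfolding test_function_def
    by (intro bounded_subset[OF compact_imp_bounded closure_subset]) auto
  then obtain a where a: "\<And>x. \<phi> x \<noteq> 0 \<Longrightarrow> \<bar>x\<bar> \<le> a" unfolding bounded_real by auto
  have 0: "\<phi> x = 0" if "x \<notin> {-a..a}" for x using a[of x] that by (cases "\<phi> x = 0") (auto simp: abs_le_iff)
  have 1: "deriv \<phi> x = 0" if "x \<notin> {-a..a}" for x using 0 that by (rule deriv_outside)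
  have 2: "deriv (deriv \<phi>) x = 0" if "x \<notin> {-a..a}" for x using 1 that by (rule deriv_outside)
  have c: "continuous_on UNIV ((deriv ^^ k) \<phi>)" for k
    using d by (intro continuous_at_imp_continuous_on) (auto intro: field_differentiable_imp_continuous_at)
  show thesis
  proof (rule that[of "-a" a])
    show "\<phi> x - deriv (deriv \<phi>) x = 0" if "x \<notin> {-a..a}" for x using 0[OF that] 2[OF that] by simp
    show "continuous_on UNIV (\<lambda>x. \<phi> x - deriv (deriv \<phi>) x)"
      using c[of 0] c[of "Suc (Suc 0)"] by (intro continuous_intros) auto
  qed
qed

text \<open>Collects what the classical argument needs, all limits in t being uniform in x. The
  function v is the continuous representative of the time derivative supplied by
  \<open>strong_solution\<close>, which as a member of a Sobolev space is determined only up to null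
  sets.\<close>

lemma strong_solution_regularity:
  assumes sol: "strong_solution n s T u0 u" and s: "s > 5 / 2"
  obtains p q v w :: "real \<Rightarrow> real \<Rightarrow> real" and B :: "real \<Rightarrow> real"
  where "\<And>t x. t \<in> existence_interval T \<Longrightarrow> (u t has_real_derivative p t x) (at x)"
    and "\<And>t x. t \<in> existence_interval T \<Longrightarrow> (p t has_real_derivative q t x) (at x)"
    and "\<And>t. t \<in> existence_interval T \<Longrightarrow> continuous_on UNIV (q t)"
    and "\<And>t e. t \<in> existence_interval T \<Longrightarrow> e > 0 \<Longrightarrow> \<forall>\<^sub>F r in at t within existence_interval T.
        \<forall>x. \<bar>u r x - u t x\<bar> < e \<and> \<bar>p r x - p t x\<bar> < e \<and> \<bar>q r x - q t x\<bar> < e"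
    and "continuous_on (existence_interval T) B"
    and "\<And>t x. t \<in> existence_interval T \<Longrightarrow> \<bar>u t x\<bar> \<le> B t \<and> \<bar>p t x\<bar> \<le> B t \<and> \<bar>q t x\<bar> \<le> B t"
    and "\<And>t x. t \<in> existence_interval T \<Longrightarrow> (v t has_real_derivative w t x) (at x)"
    and "\<And>t. t \<in> existence_interval T \<Longrightarrow> continuous_on UNIV (w t)"
    and "\<And>t e. t \<in> existence_interval T \<Longrightarrow> e > 0 \<Longrightarrow> \<forall>\<^sub>F r in at t within existence_interval T.
        \<forall>x. \<bar>(u r x - u t x) / (r - t) - v t x\<bar> < e \<and> \<bar>(p r x - p t x) / (r - t) - w t x\<bar> < e"
    and "\<And>t. t \<in> existence_interval T \<Longrightarrow> satisfies_equation_at n (u t) (v t)"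
    and "\<And>t. t \<in> existence_interval T \<Longrightarrow> integrable lborel (\<lambda>x. (u t x)\<^sup>2)"
proof -
  define I where "I = existence_interval T"
  obtain v0 where v0: "sobolev_C1_on I (s - 1) u v0" "\<And>t. t \<in> I \<Longrightarrow> satisfies_equation_at n (u t) (v0 t)"
    and uc: "\<And>t. t \<in> I \<Longrightarrow> continuous_on UNIV (u t)" and us: "sobolev_continuous_on I s u"
    using sol by (auto simp: strong_solution_def I_def)
  have S: "u t \<in> sobolev_space s" "u t \<in> sobolev_space (s - 1)" "v0 t \<in> sobolev_space (s - 1)" if "t \<in> I" for t
    using that us v0(1) by (auto simp: sobolev_C1_on_def sobolev_continuous_on_def)
  define G where "G = (\<lambda>t. fourier_of (u t))"
  define K where "K = (\<lambda>t. fourier_of (v0 t))"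
  have GF: "is_L2_fourier (u t) (G t)" and KF: "is_L2_fourier (v0 t) (K t)" if "t \<in> I" for t
    using fourier_of(1) S[OF that] by (auto simp: G_def K_def)
  have Gm: "G t \<in> borel_measurable borel" and Km: "K t \<in> borel_measurable borel" if "t \<in> I" for t
    using GF[OF that] KF[OF that] by (auto simp: is_L2_fourier_def L2_fun_def)
  have Gs: "integrable lborel (\<lambda>\<xi>. (1 + \<xi>\<^sup>2) powr s * (cmod (G t \<xi>))\<^sup>2)"
    and Gs1: "integrable lborel (\<lambda>\<xi>. (1 + \<xi>\<^sup>2) powr (s - 1) * (cmod (G t \<xi>))\<^sup>2)"
    and Ks1: "integrable lborel (\<lambda>\<xi>. (1 + \<xi>\<^sup>2) powr (s - 1) * (cmod (K t \<xi>))\<^sup>2)" if "t \<in> I" for t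
    using fourier_of(2) S[OF that] by (auto simp: G_def K_def)
  \<comment> \<open>Two derivatives of u come from H^s with r = 1, and one derivative of u_t from
    H^(s-1) with r = 1/2; both conditions amount to s > 5/2.\<close>
  have s1: "s - 2 * 1 > 1 / 2" and s2: "(s - 1) - 2 * (1 / 2) > 1 / 2" using s by auto
  have G1: "weighted_integrable 1 (G t)" if "t \<in> I" for t
    by (rule weighted_integrable_of_sobolev(1)[OF GF[OF that] Gs[OF that] s1])
  have G1': "weighted_integrable (1 / 2) (fourier_D (G t))" if "t \<in> I" for t
    using weighted_integrable_D(1)[OF G1[OF that]] by simp
  have G1'': "weighted_integrable 0 (fourier_D (fourier_D (G t)))" if "t \<in> I" for t
    using weighted_integrable_D(1)[OF G1'[OF that]] by simp
  have G12: "weighted_integrable (1 / 2) (G t)" if "t \<in> I" for t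
    by (rule weighted_integrable_of_sobolev(1)[OF GF[OF that] Gs1[OF that] s2])
  have G12': "weighted_integrable 0 (fourier_D (G t))" if "t \<in> I" for t
    using weighted_integrable_D(1)[OF G12[OF that]] by simp
  have K12: "weighted_integrable (1 / 2) (K t)" if "t \<in> I" for t
    by (rule weighted_integrable_of_sobolev(1)[OF KF[OF that] Ks1[OF that] s2])
  have K12': "weighted_integrable 0 (fourier_D (K t))" if "t \<in> I" for t
    using weighted_integrable_D(1)[OF K12[OF that]] by simp
  define p where "p = (\<lambda>t. Re_inv_fourier (fourier_D (G t)))"
  define q where "q = (\<lambda>t. Re_inv_fourier (fourier_D (fourier_D (G t))))"
  define v where "v = (\<lambda>t. Re_inv_fourier (K t))"
  define w where "w = (\<lambda>t. Re_inv_fourier (fourier_D (K t)))"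
  define B where "B = (\<lambda>t. weighted_norm 1 (G t))"
  have u: "u t = Re_inv_fourier (G t)" if "t \<in> I" for t
    unfolding Re_inv_fourier_def
    by (rule ext, rule fourier_inversion[OF GF[OF that] weighted_integrable_integrable(1)[OF G1[OF that]] uc[OF that]]) simp
  have bounds: "\<bar>Re_inv_fourier g x\<bar> \<le> weighted_norm 1 g \<and> \<bar>Re_inv_fourier (fourier_D g) x\<bar> \<le> weighted_norm 1 g
      \<and> \<bar>Re_inv_fourier (fourier_D (fourier_D g)) x\<bar> \<le> weighted_norm 1 g" if "weighted_integrable 1 g" for g x
    using Re_inv_fourier_bound[OF that] Re_inv_fourier_bound[of "1/2" "fourier_D g" x] Re_inv_fourier_bound[of 0 "fourier_D (fourier_D g)" x]
      weighted_integrable_D[OF that] weighted_integrable_D[of "1/2" "fourier_D g"]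
    by (auto intro: order_trans)
  have bounds2: "\<bar>Re_inv_fourier g x\<bar> \<le> weighted_norm (1/2) g \<and> \<bar>Re_inv_fourier (fourier_D g) x\<bar> \<le> weighted_norm (1/2) g"
    if "weighted_integrable (1/2) g" for g x
    using Re_inv_fourier_bound[OF that] Re_inv_fourier_bound[of 0 "fourier_D g" x] weighted_integrable_D[OF that]
    by (auto intro: order_trans)
  \<comment> \<open>The transform of u r - u t. The factors 1 and -1 are written out so that the
    linearity lemmas match.\<close>
  define dG where "dG = (\<lambda>r t \<xi>. complex_of_real 1 * G r \<xi> + complex_of_real (- 1) * G t \<xi>)"
  have dG: "weighted_integrable 1 (dG r t)" if "r \<in> I" "t \<in> I" for r t
    unfolding dG_def by (intro weighted_integrable_linear(1) G1 that)
  have dG_norm: "weighted_norm 1 (dG r t) \<le> embedding_const s 1 * sobolev_norm s (\<lambda>x. u r x - u t x)"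
    if "r \<in> I" "t \<in> I" for r t
  proof -
    have "is_L2_fourier (\<lambda>x. 1 * u r x + (- 1) * u t x) (dG r t)"
      unfolding dG_def by (intro is_L2_fourier_linear GF that)
    moreover have "integrable lborel (\<lambda>\<xi>. (1 + \<xi>\<^sup>2) powr s * (cmod (dG r t \<xi>))\<^sup>2)"
      unfolding dG_def by (intro sobolev_weight_linear Gm Gs that)
    ultimately show ?thesis using weighted_integrable_of_sobolev(2)[OF _ _ s1] by fastforce
  qed
  have dG_lim: "((\<lambda>r. weighted_norm 1 (dG r t)) \<longlongrightarrow> 0) (at t within I)" if t: "t \<in> I" for t
  proof (rule tendsto_sandwich[OF _ _ tendsto_const])
    show "\<forall>\<^sub>F r in at t within I. 0 \<le> weighted_norm 1 (dG r t)" by (simp add: weighted_norm_nonneg)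
    show "\<forall>\<^sub>F r in at t within I. weighted_norm 1 (dG r t) \<le> embedding_const s 1 * sobolev_norm s (\<lambda>x. u r x - u t x)"
      unfolding eventually_at_filter using dG_norm t by (auto intro!: always_eventually)
    show "((\<lambda>r. embedding_const s 1 * sobolev_norm s (\<lambda>x. u r x - u t x)) \<longlongrightarrow> 0) (at t within I)"
      using us t by (intro tendsto_mult_right_zero) (auto simp: sobolev_continuous_on_def)
  qed
  have near: "\<forall>\<^sub>F r in at t within I. \<forall>x. \<bar>u r x - u t x\<bar> < e \<and> \<bar>p r x - p t x\<bar> < e \<and> \<bar>q r x - q t x\<bar> < e"
    if t: "t \<in> I" and e: "e > 0" for t e
  proof -
    have "\<forall>\<^sub>F r in at t within I. r \<in> I" by (simp add: eventually_at_filter)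
    then show ?thesis
      using order_tendstoD(2)[OF dG_lim[OF t] e]
    proof eventually_elim
      case (elim r)
      have "Re_inv_fourier (dG r t) x = u r x - u t x" for x
        unfolding dG_def Re_inv_fourier_linear[OF G1[OF elim(1)] G1[OF t] zero_le_one] using u t elim by simp
      moreover have "Re_inv_fourier (fourier_D (dG r t)) x = p r x - p t x" for x
        using Re_inv_fourier_linear[OF G1'[OF elim(1)] G1'[OF t], of 1 "-1"]
        unfolding dG_def fourier_D_linear p_def by simp
      moreover have "Re_inv_fourier (fourier_D (fourier_D (dG r t))) x = q r x - q t x" for x
        using Re_inv_fourier_linear[OF G1''[OF elim(1)] G1''[OF t], of 1 "-1"]
        unfolding dG_def fourier_D_linear q_def by simp
      ultimately show ?case using bounds[OF dG[OF elim(1) t]] elim(2) by (smt (verit))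
    qed
  qed
  \<comment> \<open>The reverse triangle inequality for the weighted norm, obtained by writing G r
    as dG + G t and G t as G r - dG.\<close>
  have Bc: "continuous_on I B"
    unfolding continuous_on_def
  proof
    fix t assume t: "t \<in> I"
    have "\<bar>B r - B t\<bar> \<le> weighted_norm 1 (dG r t)" if r: "r \<in> I" for r
    proof -
      have "B r = weighted_norm 1 (\<lambda>\<xi>. 1 * dG r t \<xi> + 1 * G t \<xi>)" "B t = weighted_norm 1 (\<lambda>\<xi>. 1 * G r \<xi> + (- 1) * dG r t \<xi>)"
        by (simp_all add: B_def dG_def)
      moreover have "weighted_norm 1 (\<lambda>\<xi>. 1 * dG r t \<xi> + 1 * G t \<xi>) \<le> cmod 1 * weighted_norm 1 (dG r t) + cmod 1 * weighted_norm 1 (G t)"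
        by (intro weighted_integrable_linear(2) dG G1 r t)
      moreover have "weighted_norm 1 (\<lambda>\<xi>. 1 * G r \<xi> + (- 1) * dG r t \<xi>) \<le> cmod 1 * weighted_norm 1 (G r) + cmod (- 1) * weighted_norm 1 (dG r t)"
        by (intro weighted_integrable_linear(2) dG G1 r t)
      ultimately show ?thesis by (simp add: B_def)
    qed
    then have "((\<lambda>r. B r - B t) \<longlongrightarrow> 0) (at t within I)"
      by (intro Lim_null_comparison[OF _ dG_lim[OF t]]) (auto simp: eventually_at_filter intro!: always_eventually)
    then show "(B \<longlongrightarrow> B t) (at t within I)" by (rule LIM_zero_cancel)
  qed
  define dK where "dK = (\<lambda>r t \<xi>. complex_of_real 1 * (complex_of_real (1 / (r - t)) * G r \<xi> + complex_of_real (- (1 / (r - t))) * G t \<xi>) + complex_of_real (- 1) * K t \<xi>)"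
  have q12: "weighted_integrable (1/2) (\<lambda>\<xi>. complex_of_real (1 / (r - t)) * G r \<xi> + complex_of_real (- (1 / (r - t))) * G t \<xi>)"
    if "r \<in> I" "t \<in> I" for r t by (intro weighted_integrable_linear(1) G12 that)
  have dK: "weighted_integrable (1/2) (dK r t)" if "r \<in> I" "t \<in> I" for r t
    unfolding dK_def by (intro weighted_integrable_linear(1) G12 K12 that)
  have dK_norm: "weighted_norm (1/2) (dK r t) \<le> embedding_const (s - 1) (1/2) * sobolev_norm (s - 1) (\<lambda>x. (u r x - u t x) / (r - t) - v0 t x)"
    if "r \<in> I" "t \<in> I" for r t
  proof -
    have "is_L2_fourier (\<lambda>x. 1 * ((1 / (r - t)) * u r x + (- (1 / (r - t))) * u t x) + (- 1) * v0 t x) (dK r t)"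
      unfolding dK_def by (intro is_L2_fourier_linear GF KF that)
    moreover have "(\<lambda>x. 1 * ((1 / (r - t)) * u r x + (- (1 / (r - t))) * u t x) + (- 1) * v0 t x) = (\<lambda>x. (u r x - u t x) / (r - t) - v0 t x)"
      by (auto simp: diff_divide_distrib)
    ultimately have F: "is_L2_fourier (\<lambda>x. (u r x - u t x) / (r - t) - v0 t x) (dK r t)" by simp
    have "integrable lborel (\<lambda>\<xi>. (1 + \<xi>\<^sup>2) powr (s - 1) * (cmod (dK r t \<xi>))\<^sup>2)"
      unfolding dK_def using Gm Km that
      by (intro sobolev_weight_linear Gs1 Ks1) auto
    then show ?thesis by (rule weighted_integrable_of_sobolev(2)[OF F _ s2])
  qed
  have dK_lim: "((\<lambda>r. weighted_norm (1/2) (dK r t)) \<longlongrightarrow> 0) (at t within I)" if t: "t \<in> I" for t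
  proof (rule tendsto_sandwich[OF _ _ tendsto_const])
    show "\<forall>\<^sub>F r in at t within I. 0 \<le> weighted_norm (1/2) (dK r t)" by (simp add: weighted_norm_nonneg)
    show "\<forall>\<^sub>F r in at t within I. weighted_norm (1/2) (dK r t) \<le> embedding_const (s - 1) (1/2) * sobolev_norm (s - 1) (\<lambda>x. (u r x - u t x) / (r - t) - v0 t x)"
      unfolding eventually_at_filter using dK_norm t by (auto intro!: always_eventually)
    show "((\<lambda>r. embedding_const (s - 1) (1/2) * sobolev_norm (s - 1) (\<lambda>x. (u r x - u t x) / (r - t) - v0 t x)) \<longlongrightarrow> 0) (at t within I)"
      using v0(1) t by (intro tendsto_mult_right_zero) (auto simp: sobolev_C1_on_def)
  qed
  have quot: "\<forall>\<^sub>F r in at t within I. \<forall>x. \<bar>(u r x - u t x) / (r - t) - v t x\<bar> < e \<and> \<bar>(p r x - p t x) / (r - t) - w t x\<bar> < e"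
    if t: "t \<in> I" and e: "e > 0" for t e
  proof -
    have "\<forall>\<^sub>F r in at t within I. r \<in> I" by (simp add: eventually_at_filter)
    then show ?thesis
      using order_tendstoD(2)[OF dK_lim[OF t] e]
    proof eventually_elim
      case (elim r)
      have h: "0 \<le> (1 / 2 :: real)" by simp
      have "Re_inv_fourier (dK r t) x = (u r x - u t x) / (r - t) - v t x" for x
        unfolding dK_def Re_inv_fourier_linear[OF q12[OF elim(1) t] K12[OF t] h]
          Re_inv_fourier_linear[OF G12[OF elim(1)] G12[OF t] h]
        using u t elim by (simp add: v_def diff_divide_distrib)
      moreover have "Re_inv_fourier (fourier_D (dK r t)) x = (p r x - p t x) / (r - t) - w t x" for x
      proof -
        have "weighted_integrable 0 (\<lambda>\<xi>. complex_of_real (1 / (r - t)) * fourier_D (G r) \<xi> + complex_of_real (- (1 / (r - t))) * fourier_D (G t) \<xi>)"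
          by (intro weighted_integrable_linear(1) G12' t elim(1))
        note lin = Re_inv_fourier_linear[OF this K12'[OF t] order_refl] Re_inv_fourier_linear[OF G12'[OF elim(1)] G12'[OF t] order_refl]
        show ?thesis unfolding dK_def fourier_D_linear lin by (simp add: p_def w_def diff_divide_distrib)
      qed
      ultimately show ?case using bounds2[OF dK[OF elim(1) t]] elim(2) by (smt (verit))
    qed
  qed
  \<comment> \<open>The time derivative enters the equation only through its pairing with \<phi> -
    \<phi>'', which is continuous with compact support, so it may be replaced by its representative
    v.\<close>
  have weak: "satisfies_equation_at n (u t) (v t)" if t: "t \<in> I" for t
    unfolding satisfies_equation_at_def
  proof (intro allI impI)
    fix \<phi> assume \<phi>: "test_function \<phi>"
    obtain a b where ab: "\<And>x. x \<notin> {a..b} \<Longrightarrow> \<phi> x - deriv (deriv \<phi>) x = 0"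
      "continuous_on UNIV (\<lambda>x. \<phi> x - deriv (deriv \<phi>) x)"
      using test_function_support[OF \<phi>] by blast
    have "integrable lborel (K t)" by (rule weighted_integrable_integrable(1)[OF K12[OF t]]) simp
    then have "(LINT x|lborel. v0 t x * (\<phi> x - deriv (deriv \<phi>) x)) = (LINT x|lborel. v t x * (\<phi> x - deriv (deriv \<phi>) x))"
      unfolding v_def Re_inv_fourier_def by (rule L2_fourier_pairing[OF KF[OF t] _ ab(2) ab(1)])
    then show "(LINT x|lborel. v t x * (\<phi> x - deriv (deriv \<phi>) x))
     + (LINT x|lborel. ((u t x)\<^sup>2 - (deriv (u t) x)\<^sup>2) ^ (n - 1) * deriv (u t) x * momentum (u t) x * \<phi> x)
     - (LINT x|lborel. ((u t x)\<^sup>2 - (deriv (u t) x)\<^sup>2) ^ (n - 1) * u t x * momentum (u t) x * deriv \<phi> x) = 0"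
      using v0(2)[OF t, unfolded satisfies_equation_at_def, rule_format, OF \<phi>] by simp
  qed
  show thesis
  proof (rule that[of p q B v w])
    fix t x assume t: "t \<in> existence_interval T"
    then have tI: "t \<in> I" by (simp add: I_def)
    show "(u t has_real_derivative p t x) (at x)"
      unfolding u[OF tI] p_def by (rule Re_inv_fourier_DERIV[OF G1[OF tI]]) simp
    show "(p t has_real_derivative q t x) (at x)"
      unfolding p_def q_def by (rule Re_inv_fourier_DERIV[OF G1'[OF tI]]) simp
    show "\<bar>u t x\<bar> \<le> B t \<and> \<bar>p t x\<bar> \<le> B t \<and> \<bar>q t x\<bar> \<le> B t"
      using bounds[OF G1[OF tI], of x] by (simp add: u[OF tI] p_def q_def B_def)
    show "(v t has_real_derivative w t x) (at x)"
      unfolding v_def w_def by (rule Re_inv_fourier_DERIV[OF K12[OF tI]]) simp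
  next
    fix t assume t: "t \<in> existence_interval T"
    then have tI: "t \<in> I" by (simp add: I_def)
    show "continuous_on UNIV (q t)" unfolding q_def by (rule Re_inv_fourier_continuous[OF G1''[OF tI]]) simp
    show "continuous_on UNIV (w t)" unfolding w_def by (rule Re_inv_fourier_continuous[OF K12'[OF tI]]) simp
    show "satisfies_equation_at n (u t) (v t)" by (rule weak[OF tI])
    show "integrable lborel (\<lambda>x. (u t x)\<^sup>2)"
      using GF[OF tI] by (simp add: is_L2_fourier_def L2_fun_def)
  qed (use near quot Bc in \<open>simp_all add: I_def\<close>)
qed

subsection \<open>Persistence of the sign of the momentum\<close>

text \<open>Supplies the primitive \<open>Y\<close> of m and its time derivative \<open>Z\<close> to
  the maximum principle, and returns the sign of m as q \<le> u, together with the bounds that the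
  comparison of u_x with u requires.\<close>

lemma momentum_nonneg:
  fixes u :: "real \<Rightarrow> real \<Rightarrow> real"
  assumes sol: "strong_solution n s T u0 u" and s: "s > 5 / 2"
    and m0: "\<And>x. momentum u0 x \<ge> 0" and t: "t \<in> existence_interval T"
  obtains p q C where "\<And>x. (u t has_real_derivative p x) (at x)" "\<And>x. (p has_real_derivative q x) (at x)"
    "\<And>x. \<bar>u t x\<bar> \<le> C" "\<And>x. \<bar>p x\<bar> \<le> C" "\<And>x. q x \<le> u t x" "integrable lborel (\<lambda>x. (u t x)\<^sup>2)"
proof -
  obtain p q v w B where up: "\<And>t x. t \<in> existence_interval T \<Longrightarrow> (u t has_real_derivative p t x) (at x)"
    and pq: "\<And>t x. t \<in> existence_interval T \<Longrightarrow> (p t has_real_derivative q t x) (at x)"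
    and qc: "\<And>t. t \<in> existence_interval T \<Longrightarrow> continuous_on UNIV (q t)"
    and near: "\<And>t e. t \<in> existence_interval T \<Longrightarrow> e > 0 \<Longrightarrow> \<forall>\<^sub>F r in at t within existence_interval T.
        \<forall>x. \<bar>u r x - u t x\<bar> < e \<and> \<bar>p r x - p t x\<bar> < e \<and> \<bar>q r x - q t x\<bar> < e"
    and Bc: "continuous_on (existence_interval T) B"
    and B: "\<And>t x. t \<in> existence_interval T \<Longrightarrow> \<bar>u t x\<bar> \<le> B t \<and> \<bar>p t x\<bar> \<le> B t \<and> \<bar>q t x\<bar> \<le> B t"
    and vw: "\<And>t x. t \<in> existence_interval T \<Longrightarrow> (v t has_real_derivative w t x) (at x)"
    and wc: "\<And>t. t \<in> existence_interval T \<Longrightarrow> continuous_on UNIV (w t)"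
    and quot: "\<And>t e. t \<in> existence_interval T \<Longrightarrow> e > 0 \<Longrightarrow> \<forall>\<^sub>F r in at t within existence_interval T.
        \<forall>x. \<bar>(u r x - u t x) / (r - t) - v t x\<bar> < e \<and> \<bar>(p r x - p t x) / (r - t) - w t x\<bar> < e"
    and eq: "\<And>t. t \<in> existence_interval T \<Longrightarrow> satisfies_equation_at n (u t) (v t)"
    and L2: "\<And>t. t \<in> existence_interval T \<Longrightarrow> integrable lborel (\<lambda>x. (u t x)\<^sup>2)"
    by (rule strong_solution_regularity[OF sol s], rule that)
  \<comment> \<open>On the closed interval [0, t] the bound B is itself bounded, by compactness;
    towards T it may blow up.\<close>
  define t1 where "t1 = t"
  have t1: "t1 \<ge> 0" using t by (auto simp: existence_interval_def t1_def)
  have I: "r \<in> existence_interval T" if "r \<in> {0..t1}" for r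
    using that t by (auto simp: existence_interval_def t1_def intro: le_less_trans[of _ "ereal t"])
  then have sub: "{0..t1} \<subseteq> existence_interval T" by auto
  have uc: "continuous_on S (u r)" if "r \<in> {0..t1}" for r S
    by (rule continuous_on_of_DERIV) (rule up[OF I[OF that]])
  have pc: "continuous_on S (p r)" if "r \<in> {0..t1}" for r S
    by (rule continuous_on_of_DERIV) (rule pq[OF I[OF that]])
  have vc: "continuous_on S (v r)" if "r \<in> {0..t1}" for r S
    by (rule continuous_on_of_DERIV) (rule vw[OF I[OF that]])
  have "bounded (B ` {0..t1})"
    by (intro compact_imp_bounded compact_continuous_image continuous_on_subset[OF Bc sub]) auto
  then obtain K where K: "\<And>r. r \<in> {0..t1} \<Longrightarrow> \<bar>B r\<bar> \<le> K" unfolding bounded_real by blast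
  have b: "\<bar>u r x\<bar> \<le> K" "\<bar>p r x\<bar> \<le> K" "\<bar>q r x\<bar> \<le> K" if "r \<in> {0..t1}" for r x
    using B[OF I[OF that], of x] K[OF that] by auto
  have K0: "K \<ge> 0" using b(1)[of 0 0] t1 by auto
  define m where "m = (\<lambda>r x. u r x - q r x)"
  define E where "E = (\<lambda>r x. (u r x)\<^sup>2 - (p r x)\<^sup>2)"
  define A where "A = (\<lambda>r x. E r x ^ (n - 1) * u r x)"
  define D where "D = (\<lambda>r x. E r x ^ (n - 1) * p r x)"
  have du: "deriv (u r) = p r" if "r \<in> {0..t1}" for r
    using up[OF I[OF that]] by (auto intro!: DERIV_imp_deriv)
  have dp: "deriv (p r) = q r" if "r \<in> {0..t1}" for r
    using pq[OF I[OF that]] by (auto intro!: DERIV_imp_deriv)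
  have mom: "momentum (u r) = m r" if "r \<in> {0..t1}" for r
    by (auto simp: momentum_def m_def du[OF that] dp[OF that])
  have mc: "continuous_on S (m r)" if "r \<in> {0..t1}" for r S
    unfolding m_def by (intro continuous_intros uc that continuous_on_subset[OF qc[OF I[OF that]]]) auto
  have Dc: "continuous_on S (D r)" if "r \<in> {0..t1}" for r S
    unfolding D_def E_def by (intro continuous_intros uc pc that)
  have Ac: "continuous_on S (A r)" if "r \<in> {0..t1}" for r S
    unfolding A_def E_def by (intro continuous_intros uc pc that)
  define Eb where "Eb = K\<^sup>2 + K\<^sup>2"
  have Eb: "\<bar>E r x\<bar> \<le> Eb" if "r \<in> {0..t1}" for r x
  proof -
    have "(u r x)\<^sup>2 \<le> K\<^sup>2" "(p r x)\<^sup>2 \<le> K\<^sup>2"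
      using b[OF that, of x] by (auto simp: abs_le_square_iff[symmetric])
    then show ?thesis using zero_le_power2[of "u r x"] zero_le_power2[of "p r x"]
      unfolding E_def Eb_def by (smt (verit))
  qed
  have Eb0: "Eb \<ge> 0" by (simp add: Eb_def)
  define Ab where "Ab = Eb ^ (n - 1) * K"
  have pw: "\<bar>E r x ^ k\<bar> \<le> Eb ^ k" if "r \<in> {0..t1}" for r x k
    using Eb[OF that, of x] by (simp add: power_abs power_mono)
  have Abd: "\<bar>A r x\<bar> \<le> Ab" and Dbd: "\<bar>D r x\<bar> \<le> Ab" if "r \<in> {0..t1}" for r x
    unfolding A_def D_def Ab_def abs_mult using pw[OF that] b[OF that] Eb0 K0 by (auto intro!: mult_mono)
  \<comment> \<open>A bound for the x-derivative of A, with 4 K K bounding that of E. For n = 1 the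
    exponent \<open>n - 1 - 1\<close> is 0 by truncated subtraction, harmlessly, since the factor
    \<open>real (n - 1)\<close> vanishes.\<close>
  define L where "L = real (n - 1) * (4 * K * K * Eb ^ (n - 1 - 1)) * K + Eb ^ (n - 1) * K"
  have AL: "\<bar>A r y - A r x\<bar> \<le> L * \<bar>y - x\<bar>" if r: "r \<in> {0..t1}" for r x y
  proof -
    define A' where "A' = (\<lambda>x. real (n - 1) * ((2 * u r x * p r x - 2 * p r x * q r x) * E r x ^ (n - 1 - 1)) * u r x + E r x ^ (n - 1) * p r x)"
    have dE: "(E r has_real_derivative (2 * u r x * p r x - 2 * p r x * q r x)) (at x)" for x
      unfolding E_def by (auto intro!: derivative_eq_intros up[OF I[OF r]] pq[OF I[OF r]])
    have dA: "(A r has_real_derivative A' x) (at x)" for x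
      using DERIV_mult[OF DERIV_power[OF dE[of x], of "n - 1"] up[OF I[OF r], of x]]
      unfolding A_def A'_def by (simp add: add.commute mult_ac)
    have "\<bar>A' x\<bar> \<le> L" for x
    proof -
      have "\<bar>2 * u r x * p r x - 2 * p r x * q r x\<bar> \<le> 4 * K * K"
      proof -
        have "\<bar>u r x * p r x\<bar> \<le> K * K" "\<bar>p r x * q r x\<bar> \<le> K * K"
          unfolding abs_mult using b[OF r, of x] K0 by (auto intro!: mult_mono)
        then show ?thesis by linarith
      qed
      then have "\<bar>(2 * u r x * p r x - 2 * p r x * q r x) * E r x ^ (n - 1 - 1)\<bar> \<le> 4 * K * K * Eb ^ (n - 1 - 1)"
        unfolding abs_mult[of _ "E r x ^ _"] using pw[OF r] K0 by (intro mult_mono) auto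
      then have "\<bar>real (n - 1) * ((2 * u r x * p r x - 2 * p r x * q r x) * E r x ^ (n - 1 - 1)) * u r x\<bar>
          \<le> real (n - 1) * (4 * K * K * Eb ^ (n - 1 - 1)) * K"
        unfolding abs_mult[of _ "u r x"] abs_mult[of "real (n - 1)"] abs_of_nat using b[OF r] K0 Eb0
        by (intro mult_mono) auto
      moreover have "\<bar>E r x ^ (n - 1) * p r x\<bar> \<le> Eb ^ (n - 1) * K"
        unfolding abs_mult using pw[OF r] b[OF r] Eb0 K0 by (intro mult_mono) auto
      ultimately show ?thesis unfolding A'_def L_def by linarith
    qed
    then show ?thesis
      using field_differentiable_bound[of UNIV "A r" A' L y x] dA by (auto simp: has_field_derivative_at_within)
  qed
  have anti: "\<exists>F. (\<forall>x. (F has_real_derivative f x) (at x)) \<and> F 0 = 0" if "continuous_on UNIV f" for f :: "real \<Rightarrow> real"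
  proof -
    obtain F where F: "\<And>x. (F has_real_derivative f x) (at x)"
      using continuous_on_antiderivative[OF \<open>continuous_on UNIV f\<close>] by blast
    have "((\<lambda>x. F x - F 0) has_real_derivative f x) (at x)" for x
      using DERIV_diff[OF F[of x] DERIV_const[of "F 0"]] by simp
    then show ?thesis by (intro exI[of _ "\<lambda>x. F x - F 0"]) simp
  qed
  have "\<forall>r\<in>{0..t1}. \<exists>F. (\<forall>x. (F has_real_derivative u r x) (at x)) \<and> F 0 = 0"
    using anti uc by blast
  \<comment> \<open>Normalising the primitives at x = 0 makes the error of the time quotient of
    \<Phi> the primitive from 0 of the error of the time quotient of u.\<close>
  from bchoice[OF this] obtain \<Phi> where \<Phi>: "\<And>r x. r \<in> {0..t1} \<Longrightarrow> (\<Phi> r has_real_derivative u r x) (at x)"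
    and \<Phi>0: "\<And>r. r \<in> {0..t1} \<Longrightarrow> \<Phi> r 0 = 0" by blast
  have "\<forall>r\<in>{0..t1}. \<exists>F. (\<forall>x. (F has_real_derivative v r x) (at x)) \<and> F 0 = 0"
    using anti vc by blast
  from bchoice[OF this] obtain \<Psi> where \<Psi>: "\<And>r x. r \<in> {0..t1} \<Longrightarrow> (\<Psi> r has_real_derivative v r x) (at x)"
    and \<Psi>0: "\<And>r. r \<in> {0..t1} \<Longrightarrow> \<Psi> r 0 = 0" by blast
  define Y where "Y = (\<lambda>r x. \<Phi> r x - p r x)"
  define Z where "Z = (\<lambda>r x. \<Psi> r x - w r x)"
  have Yx: "(Y r has_real_derivative m r x) (at x)" if "r \<in> {0..t1}" for r x
    unfolding Y_def m_def by (intro DERIV_diff \<Phi> pq I that)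
  have Yt: "((\<lambda>r. Y r x) has_real_derivative Z r0 x) (at r0 within {0..t1})" if r0: "r0 \<in> {0..t1}" for r0 x
    unfolding has_field_derivative_iff
  proof (rule tendstoI)
    fix e :: real assume e: "e > 0"
    \<comment> \<open>The quotient errors of u and p are small uniformly in x, but integrating that
      of u from 0 to x multiplies it by |x|. The derivative of \<open>Y\<close> in time is needed
      only pointwise in x.\<close>
    define e' where "e' = e / (\<bar>x\<bar> + 2)"
    have e': "e' > 0" "e' * (\<bar>x\<bar> + 2) = e" using e by (auto simp: e'_def)
    have "\<forall>\<^sub>F r in at r0 within {0..t1}. \<forall>x. \<bar>(u r x - u r0 x) / (r - r0) - v r0 x\<bar> < e' \<and> \<bar>(p r x - p r0 x) / (r - r0) - w r0 x\<bar> < e'"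
      by (rule filter_leD[OF at_le[OF sub] quot[OF I[OF r0] e'(1)]])
    moreover have "\<forall>\<^sub>F r in at r0 within {0..t1}. r \<in> {0..t1}" by (simp add: eventually_at_filter)
    ultimately show "\<forall>\<^sub>F r in at r0 within {0..t1}. dist ((Y r x - Y r0 x) / (r - r0)) (Z r0 x) < e"
    proof eventually_elim
      case (elim r)
      define H where "H = (\<lambda>x. (\<Phi> r x - \<Phi> r0 x) / (r - r0) - \<Psi> r0 x)"
      have H: "(H has_real_derivative ((u r x - u r0 x) / (r - r0) - v r0 x)) (at x)" for x
        unfolding H_def by (intro DERIV_diff DERIV_cdivide \<Phi> \<Psi> r0 elim(2))
      have "norm (H x - H 0) \<le> e' * norm (x - 0)"
        by (rule field_differentiable_bound[of UNIV H "\<lambda>x. (u r x - u r0 x) / (r - r0) - v r0 x"])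
          (use H elim(1) in \<open>auto intro: has_field_derivative_at_within less_imp_le\<close>)
      moreover have "H 0 = 0" using \<Phi>0 \<Psi>0 r0 elim(2) by (simp add: H_def)
      moreover have "(Y r x - Y r0 x) / (r - r0) - Z r0 x = H x - ((p r x - p r0 x) / (r - r0) - w r0 x)"
        by (simp add: Y_def Z_def H_def diff_divide_distrib)
      ultimately have "\<bar>(Y r x - Y r0 x) / (r - r0) - Z r0 x\<bar> < e' * \<bar>x\<bar> + 2 * e'"
        using elim(1)[THEN spec, of x] e' by auto
      also have "\<dots> = e" using e'(2) by (simp add: algebra_simps)
      finally show ?case by (simp add: dist_real_def)
    qed
  qed
  have Z: "Z r y - Z r x = - (A r y * m r y - A r x * m r x) - integral {x..y} (\<lambda>z. D r z * m r z)"
    if r: "r \<in> {0..t1}" and xy: "x \<le> y" for r x y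
  proof -
    \<comment> \<open>The weak equation in integrated form, with coefficients A m and D m. The terms
      with w and with the integral of v are the two parts of \<open>Z\<close>.\<close>
    have "(A r y * m r y - w r y) - (A r x * m r x - w r x) = - integral {x..y} (\<lambda>z. v r z + D r z * m r z)"
    proof (rule integrated_of_weak[OF vw[OF I[OF r]] wc[OF I[OF r]] _ _ _ xy])
      show "continuous_on UNIV (\<lambda>z. D r z * m r z)" by (intro continuous_intros Dc mc r)
      show "continuous_on UNIV (\<lambda>z. A r z * m r z)" by (intro continuous_intros Ac mc r)
      fix \<phi> assume "test_function \<phi>"
      from eq[OF I[OF r], unfolded satisfies_equation_at_def du[OF r] mom[OF r], rule_format, OF this]
      show "(LINT x|lborel. v r x * (\<phi> x - deriv (deriv \<phi>) x)) + (LINT x|lborel. D r x * m r x * \<phi> x)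
         - (LINT x|lborel. A r x * m r x * deriv \<phi> x) = 0"
        unfolding A_def D_def E_def .
    qed
    also have "integral {x..y} (\<lambda>z. v r z + D r z * m r z) = integral {x..y} (v r) + integral {x..y} (\<lambda>z. D r z * m r z)"
      by (intro Henstock_Kurzweil_Integration.integral_add integrable_continuous_interval continuous_intros vc Dc mc r)
    also have "integral {x..y} (v r) = \<Psi> r y - \<Psi> r x"
      using xy \<Psi>[OF r] by (intro integral_unique fundamental_theorem_of_calculus)
        (auto simp: has_real_derivative_iff_has_vector_derivative[symmetric] intro: has_field_derivative_at_within)
    finally show ?thesis by (simp add: Z_def)
  qed
  \<comment> \<open>The maximum principle takes one constant for m and both coefficients; 2 K + Ab
    dominates all three.\<close>
  have mb: "\<bar>m r x\<bar> \<le> 2 * K + Ab" if "r \<in> {0..t1}" for r x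
    using b[OF that, of x] Abd[OF that, of x] unfolding m_def by linarith
  \<comment> \<open>Convergence in time uniform in x, combined with continuity in x at the fixed
    time r. The case r' = r is separate because the limit in time excludes the point itself.\<close>
  have cont: "continuous_on ({0..t1} \<times> UNIV) (\<lambda>(t, x). m t x)"
    unfolding continuous_on_iff
  proof (intro ballI allI impI)
    fix z :: "real \<times> real" and e :: real assume z: "z \<in> {0..t1} \<times> UNIV" and e: "e > 0"
    obtain r x where rx: "z = (r, x)" "r \<in> {0..t1}" using z by auto
    obtain d1 where d1: "d1 > 0" "\<And>r' y. r' \<in> existence_interval T \<Longrightarrow> r' \<noteq> r \<Longrightarrow> dist r' r < d1 \<Longrightarrow>
        \<bar>u r' y - u r y\<bar> < e / 4 \<and> \<bar>q r' y - q r y\<bar> < e / 4"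
      using near[OF I[OF rx(2)], of "e / 4"] e unfolding eventually_at by auto
    obtain d2 where d2: "d2 > 0" "\<And>y. dist y x < d2 \<Longrightarrow> dist (m r y) (m r x) < e / 2"
      using mc[OF rx(2), of UNIV, unfolded continuous_on_iff] e by (meson UNIV_I half_gt_zero)
    show "\<exists>d>0. \<forall>z'\<in>{0..t1} \<times> UNIV. dist z' z < d \<longrightarrow> dist (case z' of (t, x) \<Rightarrow> m t x) (case z of (t, x) \<Rightarrow> m t x) < e"
    proof (intro exI[of _ "min d1 d2"] conjI ballI impI)
      show "min d1 d2 > 0" using d1 d2 by simp
      fix z' :: "real \<times> real" assume z': "z' \<in> {0..t1} \<times> UNIV" "dist z' z < min d1 d2"
      obtain r' y where ry: "z' = (r', y)" "r' \<in> {0..t1}" using z'(1) by auto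
      have d: "dist r' r < d1" "dist y x < d2"
        using dist_fst_le[of z' z] dist_snd_le[of z' z] z'(2) by (auto simp: ry rx)
      have "\<bar>m r' y - m r y\<bar> < e / 2"
      proof (cases "r' = r")
        case False
        then show ?thesis using d1(2)[OF I[OF ry(2)] False d(1), of y] unfolding m_def by linarith
      qed (use e in simp)
      moreover have "\<bar>m r y - m r x\<bar> < e / 2" using d2(2)[OF d(2)] by (simp add: dist_real_def)
      ultimately have "\<bar>m r' y - m r x\<bar> < e" by linarith
      then show "dist (case z' of (t, x) \<Rightarrow> m t x) (case z of (t, x) \<Rightarrow> m t x) < e"
        by (simp add: ry rx dist_real_def)
    qed
  qed
  have t0: "0 \<in> {0..t1}" and tt: "t \<in> {0..t1}" using t1 by (auto simp: t1_def)
  have "u 0 = u0" using sol by (simp add: strong_solution_def)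
  then have init: "m 0 x \<ge> 0" for x using m0[of x] mom[OF t0] by simp
  have Ab0: "Ab \<ge> 0" using Abd[OF tt, of 0] by linarith
  have Ab2: "\<bar>A r x\<bar> \<le> 2 * K + Ab" "\<bar>D r x\<bar> \<le> 2 * K + Ab" if "r \<in> {0..t1}" for r x
    using Abd[OF that, of x] Dbd[OF that, of x] K0 by auto
  have "m t x \<ge> 0" for x
    by (rule transport_nonneg[OF t1 cont mb Ab2 AL Dc Yx Yt Z init tt])
  then have "q t x \<le> u t x" for x by (simp add: m_def)
  then show thesis
    using that[of "p t" "q t" K] up[OF t] pq[OF t] b[OF tt] L2[OF t] by blast
qed

theorem proposition1p3:
  fixes n :: nat and s :: real and T :: ereal
    and u0 :: "real \<Rightarrow> real" and u :: "real \<Rightarrow> real \<Rightarrow> real" and t :: real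
  assumes "n \<ge> 1"
    and "s > 5 / 2"
    and "u0 \<in> sobolev_space s"
    and "\<forall>x. momentum u0 x \<ge> 0"
    and "T > 0"
    and "strong_solution n s T u0 u"
    and "\<forall>r\<in>existence_interval T. \<forall>x. u r x > 0"
    and "t \<in> existence_interval T"
  shows "(2 * real n - 1) * (2 - c1 n) / (2 * real n + 1) * max_value (u t) ^ (2 * n + 1)
           - (2 - c1 n) / 2 * max_value (u t) ^ (2 * n - 1) * H1 (u t) + H2 n (u t) \<le> 0"
proof -
  obtain p q C where p: "\<And>x. (u t has_real_derivative p x) (at x)"
    and q: "\<And>x. (p has_real_derivative q x) (at x)"
    and C: "\<And>x. \<bar>u t x\<bar> \<le> C" "\<And>x. \<bar>p x\<bar> \<le> C" and le: "\<And>x. q x \<le> u t x"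
    and int: "integrable lborel (\<lambda>x. (u t x)\<^sup>2)"
    using momentum_nonneg[OF assms(6,2) _ assms(8)] assms(4) by metis
  show ?thesis
  proof (rule functional_inequality[OF assms(1) p _ _ _ int])
    show "continuous_on UNIV p" by (rule continuous_on_of_DERIV) (rule q)
    show "u t x > 0" for x using assms(7,8) by blast
    \<comment> \<open>Here q \<le> u is the nonnegativity of the momentum at time t; the conclusion
      is (1 + d/dx) u \<ge> 0 together with (1 - d/dx) u \<ge> 0.\<close>
    show "\<bar>p x\<bar> \<le> u t x" for x by (rule abs_deriv_le_self[OF p q C le])
  qed
qed

end
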